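(* For every $n\ge 0$: the space $\mathcal{T}_{n+1}$ is the quotient of the space $\mathcal{T}_n\times\mathsf{X}$ by the equivalence relation generated by the identifications $$\xi\otimes x=\kappa_{g,n}(\xi)\otimes g(x)$$ for all $g\in\mathfrak{A}$, $x\in\mathsf{X}$, $\xi\in K_{g,n}$ such that $g|_x=\varepsilon$ (where $\xi\otimes x$ denotes the class of $(\xi,x)$). The set $K_{g,n+1}$ for $g\in\mathfrak{A}$ is equal to $$\bigcup_{h\in\mathfrak{A},\ x\in\mathsf{X},\ h|_x=g}K_{h,n}\otimes x.$$ The map $\kappa_{g,n+1}:K_{g,n+1}\to K_{g,n+1}$ for $g\in\mathfrak{A}$ acts by the rule $$\kappa_{g,n+1}(\xi\otimes x)=\kappa_{h,n}(\xi)\otimes h(x),$$ where $h\in\mathfrak{A}$ is such that $h|_x=g$, and $\xi\in K_{h,n}$.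
   Context: Let $\mathsf{X}=\{1,2,3,4\}$ and let $\mathsf{X}^*$ be the rooted tree of finite words. For a permutation $\tau$ of $\mathsf{X}$ and automorphisms $g_i$ of $\mathsf{X}^*$, $\tau(g_1,g_2,g_3,g_4)$ denotes the automorphism $xv\mapsto\tau(x)g_x(v)$ (trivial entries omitted). Left actions; $\varepsilon$ is the identity. Sections: $g(xv)=g(x)\,g|_x(v)$, $g|_{xv}=g|_x|_v$. Let $\sigma=(1\,2)(3\,4)$, $\pi=(1\,3)(2\,4)$. $\Gamma$ is generated by $\alpha=\sigma$, $a=\pi$, $\beta=(\alpha,\gamma,\alpha,\gamma)$, $b=(a\alpha,a\alpha,c,c)$, $\gamma=(\beta,\varepsilon,\varepsilon,\beta)$, $c=(b\beta,b\beta,b,b)$. $\mathfrak{A}=\{\varepsilon,\alpha,\beta,\gamma,a,b,c,a\alpha,b\beta,c\gamma,a\alpha\gamma,\alpha c\}$; all its elements satisfy $g^2=\varepsilon$, and it is closed under taking sections. $\Gamma_A=\langle\beta,\gamma,b,c\rangle$, $\Gamma_B=\langle\alpha,\gamma,a,c\rangle$, $\Gamma_C=\langle\alpha,\beta,a,b\rangle$, $\Gamma_{A_1}=\langle\alpha,b,c\rangle$, $\Gamma_{B_1}=\langle\beta,a,c\gamma\rangle$, $\Gamma_{C_1}=\langle\gamma,a\alpha,b\beta\rangle$ (finite groups). $\mathcal{G}$ is the set of these six groups and all their pairwise and triple intersections (including $\{\varepsilon\}$). $\Xi$ is the (geometric realization of the) simplicial complex of chains of the poset, ordered by inclusion, of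 subsets $G\cdot g\subset\Gamma$, $G\in\mathcal{G}$, $g\in\Gamma$; $\Gamma$ acts on $\Xi$ from the right by translations. $\mathcal{T}_0\subset\Xi$ is the subcomplex of chains in $\mathcal{G}$. Bimodule: $\mathfrak{M}^{\otimes n}=\mathsf{X}^n\times\Gamma$, elements written $v\cdot h$, with $(v\cdot h)\cdot g=v\cdot hg$ and $g\cdot(v\cdot h)=g(v)\cdot g|_vh$; $\mathfrak M=\mathfrak M^{\otimes 1}$. $\Xi_n=\Xi\otimes\mathfrak{M}^{\otimes n}$ is the quotient of $\Xi\times\mathfrak{M}^{\otimes n}$ ($\mathfrak{M}^{\otimes n}$ discrete) by $\xi\cdot g\otimes m=\xi\otimes g\cdot m$, a right $\Gamma$-space by $(\xi\otimes m)\cdot g=\xi\otimes m\cdot g$; $\Xi_{n+1}=\Xi_n\otimes\mathfrak{M}$. $\mathcal{T}_n=\{\xi\otimes v:\xi\in\mathcal{T}_0,\ v\in\mathsf{X}^n\}\subset\Xi_n$. For $g\in\Gamma$, $K_{g,n}=\mathcal{T}_n\cap\mathcal{T}_n\cdot g$, and $\kappa_{g,n}:K_{g,n}\to K_{g^{-1},n}$ is $\xi\mapsto\xi\cdot g^{-1}$. *)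

theory Defs
  imports "HOL-Analysis.Analysis" "HOL-Algebra.Generated_Groups"
begin

section \<open>Automorphisms of the rooted tree of words\<close>

datatype letter = L1 | L2 | L3 | L4

type_synonym word = "letter list"

type_synonym taut = "word \<Rightarrow> word"

text \<open>The edges of the rooted tree join a word \<open>v\<close> to its children \<open>v @ [x]\<close>.\<close>

definition tree_aut :: "taut \<Rightarrow> bool" where
  "tree_aut g \<longleftrightarrow> bij g \<and> g [] = [] \<and>
     (\<forall>v w. (\<exists>y. g w = g v @ [y]) \<longleftrightarrow> (\<exists>x. w = v @ [x]))"

definition Aut :: "taut monoid" where
  "Aut = \<lparr>carrier = {g. tree_aut g}, monoid.mult = (\<circ>), one = id\<rparr>"

definition sect :: "taut \<Rightarrow> word \<Rightarrow> taut" where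
  "sect g v = (\<lambda>w. drop (length v) (g (v @ w)))"

definition on_letter :: "taut \<Rightarrow> letter \<Rightarrow> letter" where
  "on_letter g x = hd (g [x])"

section \<open>The group \<open>\<Gamma>\<close>\<close>

fun sigma :: "letter \<Rightarrow> letter" where
  "sigma L1 = L2" | "sigma L2 = L1" | "sigma L3 = L4" | "sigma L4 = L3"

fun pi_perm :: "letter \<Rightarrow> letter" where
  "pi_perm L1 = L3" | "pi_perm L2 = L4" | "pi_perm L3 = L1" | "pi_perm L4 = L2"

fun g_alpha :: taut where
  "g_alpha [] = []"
| "g_alpha (x # v) = sigma x # v"

fun g_a :: taut where
  "g_a [] = []"
| "g_a (x # v) = pi_perm x # v"

fun g_beta :: taut and g_gamma :: taut where
  "g_beta [] = []"
| "g_beta (L1 # v) = L1 # g_alpha v"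
| "g_beta (L2 # v) = L2 # g_gamma v"
| "g_beta (L3 # v) = L3 # g_alpha v"
| "g_beta (L4 # v) = L4 # g_gamma v"
| "g_gamma [] = []"
| "g_gamma (L1 # v) = L1 # g_beta v"
| "g_gamma (L2 # v) = L2 # v"
| "g_gamma (L3 # v) = L3 # v"
| "g_gamma (L4 # v) = L4 # g_beta v"

lemma length_g_alpha [simp]: "length (g_alpha v) = length v"
  by (cases v) auto

lemma length_g_a [simp]: "length (g_a v) = length v"
  by (cases v) auto

lemma length_g_beta_gamma [simp]:
  "length (g_beta v) = length v" "length (g_gamma v) = length v"
  by (induction v and v rule: g_beta_g_gamma.induct) auto

function (sequential) g_b :: taut and g_c :: taut where
  "g_b [] = []"
| "g_b (L1 # v) = L1 # g_a (g_alpha v)"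
| "g_b (L2 # v) = L2 # g_a (g_alpha v)"
| "g_b (L3 # v) = L3 # g_c v"
| "g_b (L4 # v) = L4 # g_c v"
| "g_c [] = []"
| "g_c (L1 # v) = L1 # g_b (g_beta v)"
| "g_c (L2 # v) = L2 # g_b (g_beta v)"
| "g_c (L3 # v) = L3 # g_b v"
| "g_c (L4 # v) = L4 # g_b v"
  by pat_completeness auto
termination
  by (relation "Wellfounded.measure (case_sum length length)") auto

lemma length_g_b_c [simp]:
  "length (g_b v) = length v" "length (g_c v) = length v"
  by (induction v and v rule: g_b_g_c.induct) auto

lemma bij_of_invol: "(\<And>x. f (f x) = x) \<Longrightarrow> bij f"
  by (rule o_bij[of f]) (auto simp: fun_eq_iff)

lemma group_Aut: "group Aut"
proof (rule groupI)
  fix g assume "g \<in> carrier Aut"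
  then have g: "bij g" "g [] = []" "\<And>v w. (\<exists>y. g w = g v @ [y]) \<longleftrightarrow> (\<exists>x. w = v @ [x])"
    by (auto simp: Aut_def tree_aut_def)
  have gi: "g (inv_into UNIV g w) = w" "inv_into UNIV g (g w) = w" for w
    using g(1) by (simp_all add: bij_inv_eq_iff surj_f_inv_f bij_is_surj bij_is_inj)
  have "tree_aut (inv_into UNIV g)"
    unfolding tree_aut_def
  proof (intro conjI allI)
    show "bij (inv_into UNIV g)" using g(1) by (rule bij_imp_bij_inv)
    show "inv_into UNIV g [] = []" using gi(2)[of "[]"] g(2) by simp
    fix v w
    show "(\<exists>y. inv_into UNIV g w = inv_into UNIV g v @ [y]) \<longleftrightarrow> (\<exists>x. w = v @ [x])"
      using g(3)[of "inv_into UNIV g w" "inv_into UNIV g v"] by (simp add: gi)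
  qed
  then show "\<exists>h\<in>carrier Aut. h \<otimes>\<^bsub>Aut\<^esub> g = \<one>\<^bsub>Aut\<^esub>"
    using gi(2) by (intro bexI[of _ "inv_into UNIV g"]) (auto simp: Aut_def)
qed (auto simp: Aut_def tree_aut_def bij_comp)

lemma sigma_pi [simp]:
  "sigma (sigma x) = x" "pi_perm (pi_perm x) = x" "pi_perm (sigma x) = sigma (pi_perm x)"
  by (cases x; simp)+

lemma alpha_a_invol [simp]:
  "g_alpha (g_alpha v) = v" "g_a (g_a v) = v" "g_a (g_alpha v) = g_alpha (g_a v)"
  by (cases v; simp)+

lemma beta_gamma_invol [simp]: "g_beta (g_beta v) = v" "g_gamma (g_gamma v) = v"
  by (induction v and v rule: g_beta_g_gamma.induct) auto

lemma alpha_c_a_alpha_gamma_comm: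
  "g_alpha (g_c v) = g_c (g_alpha v)" "g_a (g_alpha (g_gamma v)) = g_gamma (g_a (g_alpha v))"
  by (cases v rule: g_c.cases; simp)+

lemma beta_gamma_comm_b_c:
  "g_b (g_beta v) = g_beta (g_b v) \<and> g_c (g_gamma v) = g_gamma (g_c v)"
proof (induction "length v" arbitrary: v)
  case 0
  then show ?case by simp
next
  case (Suc n)
  then obtain x u where v: "v = x # u" and u: "length u = n" by (cases v) auto
  then show ?case
    using Suc(1)[of u] Suc(1)[of "g_beta u"] alpha_c_a_alpha_gamma_comm[of u] alpha_c_a_alpha_gamma_comm[of "g_alpha u"]
    by (cases x) (simp_all)
qed

lemma b_c_invol [simp]: "g_b (g_b v) = v" "g_c (g_c v) = v"
  by (induction v and v rule: g_b_g_c.induct) (auto simp: beta_gamma_comm_b_c, (metis beta_gamma_invol(1))+)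

lemma invol_in_Aut:
  assumes "\<And>v x. \<exists>y. g (v @ [x]) = g v @ [y]" "\<And>v. g (g v) = v" "g [] = []"
  shows "g \<in> carrier Aut"
  using assms bij_of_invol[of g] unfolding Aut_def tree_aut_def
  by simp metis

lemma ex_snoc_alpha_a: "\<exists>y. g_alpha (v @ [x]) = g_alpha v @ [y]" "\<exists>y. g_a (v @ [x]) = g_a v @ [y]"
  by (cases v; simp)+
lemma ex_snoc_beta_gamma: "\<exists>y. g_beta (v @ [x]) = g_beta v @ [y]" "\<exists>y. g_gamma (v @ [x]) = g_gamma v @ [y]"
  by (induction v and v rule: g_beta_g_gamma.induct) (cases x; auto simp: ex_snoc_alpha_a)+
lemma ex_snoc_b_c: "(\<exists>y. g_b (v @ [x]) = g_b v @ [y]) \<and> (\<exists>y. g_c (v @ [x]) = g_c v @ [y])"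
proof (induction "length v" arbitrary: v x)
  case 0
  then show ?case by (cases x) auto
next
  case (Suc n)
  then obtain z u where v: "v = z # u" and u: "length u = n" by (cases v) auto
  obtain y1 where y1: "g_alpha (u @ [x]) = g_alpha u @ [y1]" using ex_snoc_alpha_a by blast
  obtain y2 where y2: "g_a (g_alpha u @ [y1]) = g_a (g_alpha u) @ [y2]" using ex_snoc_alpha_a by blast
  obtain y3 where y3: "g_beta (u @ [x]) = g_beta u @ [y3]" using ex_snoc_beta_gamma by blast
  have "\<exists>y. g_b (g_beta u @ [y3]) = g_b (g_beta u) @ [y]" "\<exists>y. g_b (u @ [x]) = g_b u @ [y]"
    "\<exists>y. g_c (u @ [x]) = g_c u @ [y]"
    using Suc(1)[of "g_beta u" y3] Suc(1)[of u x] u by auto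
  then show ?case
    using y1 y2 y3 by (cases z) (simp_all add: v del: alpha_a_invol)
qed

lemma generators_in_Aut: "{g_alpha, g_a, g_beta, g_b, g_gamma, g_c} \<subseteq> carrier Aut"
  by (auto intro!: invol_in_Aut ex_snoc_alpha_a ex_snoc_beta_gamma conjunct1[OF ex_snoc_b_c] conjunct2[OF ex_snoc_b_c])

definition Gam :: "taut set" where
  "Gam = generate Aut {g_alpha, g_a, g_beta, g_b, g_gamma, g_c}"

definition frakA :: "taut set" where
  "frakA = {id, g_alpha, g_beta, g_gamma, g_a, g_b, g_c, g_a \<circ> g_alpha, g_b \<circ> g_beta,
     g_c \<circ> g_gamma, g_a \<circ> g_alpha \<circ> g_gamma, g_alpha \<circ> g_c}"

definition six_groups :: "taut set set" where
  "six_groups =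
    {generate Aut {g_beta, g_gamma, g_b, g_c},
     generate Aut {g_alpha, g_gamma, g_a, g_c},
     generate Aut {g_alpha, g_beta, g_a, g_b},
     generate Aut {g_alpha, g_b, g_c},
     generate Aut {g_beta, g_a, g_c \<circ> g_gamma},
     generate Aut {g_gamma, g_a \<circ> g_alpha, g_b \<circ> g_beta}}"

definition calG :: "taut set set" where
  "calG = six_groups
     \<union> {G \<inter> H | G H. G \<in> six_groups \<and> H \<in> six_groups}
     \<union> {G \<inter> H \<inter> K | G H K. G \<in> six_groups \<and> H \<in> six_groups \<and> K \<in> six_groups}
     \<union> {{id}}"

section \<open>Geometric realization of the order complex of a family of sets\<close>

definition fin_chains :: "'a set set \<Rightarrow> 'a set set set" where
  "fin_chains P = {C. finite C \<and> C \<noteq> {} \<and> C \<subseteq> P \<and> chain_subset C}"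

text \<open>Points of the realization are given by their barycentric coordinates,
  extended by 0 to sets that are not vertices.\<close>

definition simplex_on :: "'v set \<Rightarrow> ('v \<Rightarrow> real) set" where
  "simplex_on C = {\<xi>. (\<forall>S. 0 \<le> \<xi> S) \<and> {S. \<xi> S \<noteq> 0} \<subseteq> C \<and> sum \<xi> C = 1}"

definition realization :: "'a set set \<Rightarrow> ('a set \<Rightarrow> real) set" where
  "realization P = (\<Union>C\<in>fin_chains P. simplex_on C)"

text \<open>The weak topology. On a single finite-dimensional simplex, the topology of
  pointwise convergence used here is the Euclidean one.\<close>

definition realization_top :: "'a set set \<Rightarrow> ('a set \<Rightarrow> real) topology" where
  "realization_top P = topology (\<lambda>U. U \<subseteq> realization P \<and>
     (\<forall>C\<in>fin_chains P. openin (top_of_set (simplex_on C)) (U \<inter> simplex_on C)))"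

lemma openin_realization_top:
  "openin (realization_top P) U \<longleftrightarrow> U \<subseteq> realization P \<and>
     (\<forall>C\<in>fin_chains P. openin (top_of_set (simplex_on C)) (U \<inter> simplex_on C))"
proof -
  have "istopology (\<lambda>U. U \<subseteq> realization P \<and>
     (\<forall>C\<in>fin_chains P. openin (top_of_set (simplex_on C)) (U \<inter> simplex_on C)))"
    unfolding istopology_def
  proof (intro conjI allI impI ballI)
    fix S T C
    assume "S \<subseteq> realization P \<and>
       (\<forall>C\<in>fin_chains P. openin (top_of_set (simplex_on C)) (S \<inter> simplex_on C))"
      and "T \<subseteq> realization P \<and>
       (\<forall>C\<in>fin_chains P. openin (top_of_set (simplex_on C)) (T \<inter> simplex_on C))"
      and "C \<in> fin_chains P"
    then have "openin (top_of_set (simplex_on C)) ((S \<inter> simplex_on C) \<inter> (T \<inter> simplex_on C))"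
      by blast
    then show "openin (top_of_set (simplex_on C)) (S \<inter> T \<inter> simplex_on C)"
      by (simp add: Int_ac)
  next
    fix \<K> C
    assume "\<forall>K\<in>\<K>. K \<subseteq> realization P \<and>
       (\<forall>C\<in>fin_chains P. openin (top_of_set (simplex_on C)) (K \<inter> simplex_on C))"
      and "C \<in> fin_chains P"
    then have "openin (top_of_set (simplex_on C)) (\<Union>K\<in>\<K>. K \<inter> simplex_on C)"
      by (intro openin_Union) blast
    then show "openin (top_of_set (simplex_on C)) (\<Union>\<K> \<inter> simplex_on C)"
      by (simp only: Int_Union2)
  qed blast+
  then show ?thesis
    by (simp add: realization_top_def topology_inverse')
qed

section \<open>Quotients\<close>

text \<open>The equivalence relation on \<open>A\<close> generated by a relation \<open>R\<close> on \<open>A\<close>.\<close>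

definition equiv_gen :: "'a set \<Rightarrow> 'a rel \<Rightarrow> 'a rel" where
  "equiv_gen A R = Restr ((R \<union> R\<inverse>)\<^sup>*) A"

lemma equiv_equiv_gen: "equiv A (equiv_gen A R)"
proof (rule equivI)
  have "sym ((R \<union> R\<inverse>)\<^sup>*)"
    by (intro sym_rtrancl sym_Un_converse)
  then show "sym (equiv_gen A R)"
    unfolding equiv_gen_def sym_def by blast
  show "trans (equiv_gen A R)"
    unfolding equiv_gen_def trans_def by (auto intro: rtrancl_trans)
qed (auto simp: equiv_gen_def refl_on_def)

lemma equiv_gen_least:
  assumes "equiv A E" "R \<subseteq> E"
  shows "equiv_gen A R \<subseteq> E"
proof -
  have "(x, y) \<in> E" if "(x, y) \<in> (R \<union> R\<inverse>)\<^sup>*" "x \<in> A" for x y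
    using that
  proof (induction rule: rtrancl_induct)
    case base
    then show ?case using assms by (auto simp: equiv_def refl_on_def)
  next
    case (step y z)
    then show ?case using assms unfolding equiv_def sym_def trans_def by blast
  qed
  then show ?thesis by (auto simp: equiv_gen_def)
qed

definition quotient_top :: "'a topology \<Rightarrow> 'a rel \<Rightarrow> 'a set topology" where
  "quotient_top X E = topology (\<lambda>U. U \<subseteq> topspace X // E \<and>
     openin X {x \<in> topspace X. E `` {x} \<in> U})"

lemma openin_quotient_top:
  "openin (quotient_top X E) U \<longleftrightarrow> U \<subseteq> topspace X // E \<and>
     openin X {x \<in> topspace X. E `` {x} \<in> U}"
proof -
  have "istopology (\<lambda>U. U \<subseteq> topspace X // E \<and> openin X {x \<in> topspace X. E `` {x} \<in> U})"
    unfolding istopology_def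
  proof (intro conjI allI impI)
    fix S T
    assume "S \<subseteq> topspace X // E \<and> openin X {x \<in> topspace X. E `` {x} \<in> S}"
      and "T \<subseteq> topspace X // E \<and> openin X {x \<in> topspace X. E `` {x} \<in> T}"
    then have "openin X ({x \<in> topspace X. E `` {x} \<in> S} \<inter> {x \<in> topspace X. E `` {x} \<in> T})"
      by blast
    also have "{x \<in> topspace X. E `` {x} \<in> S} \<inter> {x \<in> topspace X. E `` {x} \<in> T}
        = {x \<in> topspace X. E `` {x} \<in> S \<inter> T}" by blast
    finally show "openin X {x \<in> topspace X. E `` {x} \<in> S \<inter> T}" .
  next
    fix \<K>
    assume "\<forall>K\<in>\<K>. K \<subseteq> topspace X // E \<and> openin X {x \<in> topspace X. E `` {x} \<in> K}"
    then have "openin X (\<Union>K\<in>\<K>. {x \<in> topspace X. E `` {x} \<in> K})"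
      by (intro openin_Union) blast
    also have "(\<Union>K\<in>\<K>. {x \<in> topspace X. E `` {x} \<in> K})
        = {x \<in> topspace X. E `` {x} \<in> \<Union>\<K>}" by blast
    finally show "openin X {x \<in> topspace X. E `` {x} \<in> \<Union>\<K>}" .
  qed blast+
  then show ?thesis
    by (simp add: quotient_top_def topology_inverse')
qed

section \<open>The complex \<open>\<Xi>\<close>\<close>

definition coset_poset :: "taut set set" where
  "coset_poset = {G #>\<^bsub>Aut\<^esub> g | G g. G \<in> calG \<and> g \<in> Gam}"

definition Xi :: "(taut set \<Rightarrow> real) set" where
  "Xi = realization coset_poset"

definition Xi_top :: "(taut set \<Rightarrow> real) topology" where
  "Xi_top = realization_top coset_poset"

definition T0 :: "(taut set \<Rightarrow> real) set" where
  "T0 = realization calG"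

text \<open>The simplicial extension of the right translation \<open>S \<mapsto> S #> g\<close> of the vertices.\<close>

definition Xi_act :: "(taut set \<Rightarrow> real) \<Rightarrow> taut \<Rightarrow> (taut set \<Rightarrow> real)" where
  "Xi_act \<xi> g = (\<lambda>S. \<xi> (S #>\<^bsub>Aut\<^esub> inv\<^bsub>Aut\<^esub> g))"

section \<open>The bimodule and the spaces \<open>\<Xi>\<^sub>n\<close>\<close>

text \<open>The pair \<open>(v, h)\<close> stands for the element \<open>v \<cdot> h\<close>.\<close>

definition bimod :: "nat \<Rightarrow> (word \<times> taut) set" where
  "bimod n = {v. length v = n} \<times> Gam"

fun bim_left :: "taut \<Rightarrow> word \<times> taut \<Rightarrow> word \<times> taut" where
  "bim_left g (v, h) = (g v, sect g v \<circ> h)"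

fun bim_right :: "word \<times> taut \<Rightarrow> taut \<Rightarrow> word \<times> taut" where
  "bim_right (v, h) g = (v, h \<circ> g)"

text \<open>\<open>v \<cdot> h \<otimes> w \<cdot> k = v \<otimes> h(w) \<cdot> h|\<^sub>w k\<close>, identifying the tensor product of words with their
  concatenation.\<close>

fun bim_tensor :: "word \<times> taut \<Rightarrow> word \<times> taut \<Rightarrow> word \<times> taut" where
  "bim_tensor (v, h) (w, k) = (v @ h w, sect h w \<circ> k)"

type_synonym tens = "((taut set \<Rightarrow> real) \<times> word \<times> taut) set"

definition tens_rel :: "nat \<Rightarrow> ((taut set \<Rightarrow> real) \<times> word \<times> taut) rel" where
  "tens_rel n = equiv_gen (Xi \<times> bimod n)
     {((Xi_act \<xi> g, m), (\<xi>, bim_left g m)) | \<xi> g m. \<xi> \<in> Xi \<and> g \<in> Gam \<and> m \<in> bimod n}"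

definition tensor :: "nat \<Rightarrow> (taut set \<Rightarrow> real) \<Rightarrow> word \<times> taut \<Rightarrow> tens" where
  "tensor n \<xi> m = tens_rel n `` {(\<xi>, m)}"

definition Xi_n_top :: "nat \<Rightarrow> tens topology" where
  "Xi_n_top n = quotient_top (prod_topology Xi_top (discrete_topology (bimod n))) (tens_rel n)"

text \<open>The right action \<open>(\<xi> \<otimes> m) \<cdot> g = \<xi> \<otimes> m \<cdot> g\<close> on \<open>\<Xi>\<^sub>n\<close>. The union is over all representatives;
  since they all yield the same class, it is that class.\<close>

definition tens_act :: "nat \<Rightarrow> tens \<Rightarrow> taut \<Rightarrow> tens" where
  "tens_act n A g = (\<Union>(\<xi>, m)\<in>A. tensor n \<xi> (bim_right m g))"

text \<open>The element \<open>A \<otimes> x\<close> of \<open>\<Xi>\<^sub>n \<otimes> \<MM> = \<Xi>\<^sub>n\<^sub>+\<^sub>1\<close> for a letter \<open>x = x \<cdot> \<epsilon>\<close>, that is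
  \<open>(\<xi> \<otimes> m) \<otimes> x = \<xi> \<otimes> (m \<otimes> x)\<close>.\<close>

definition tens_letter :: "nat \<Rightarrow> tens \<Rightarrow> letter \<Rightarrow> tens" where
  "tens_letter n A x = (\<Union>(\<xi>, m)\<in>A. tensor (Suc n) \<xi> (bim_tensor m ([x], id)))"

definition T :: "nat \<Rightarrow> tens set" where
  "T n = {tensor n \<xi> (v, id) | \<xi> v. \<xi> \<in> T0 \<and> length v = n}"

definition T_top :: "nat \<Rightarrow> tens topology" where
  "T_top n = subtopology (Xi_n_top n) (T n)"

definition K :: "taut \<Rightarrow> nat \<Rightarrow> tens set" where
  "K g n = T n \<inter> (\<lambda>A. tens_act n A g) ` T n"

definition kappa :: "taut \<Rightarrow> nat \<Rightarrow> tens \<Rightarrow> tens" where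
  "kappa g n = (\<lambda>A\<in>K g n. tens_act n A (inv\<^bsub>Aut\<^esub> g))"

definition identifications :: "nat \<Rightarrow> (tens \<times> letter) rel" where
  "identifications n =
     {((A, x), (kappa g n A, on_letter g x)) | g x A.
        g \<in> frakA \<and> A \<in> K g n \<and> sect g [x] = id}"

end

theory Submission
  imports Defs
begin

text \<open>The complex \<open>T0\<close> is a strict fundamental domain of \<open>\<Gamma>\<close> on \<open>\<Xi>\<close>: a point \<open>\<xi>\<close> of it has the
  smallest group of its chain as stabilizer \<open>stab \<xi>\<close>. Hence \<open>\<xi> \<otimes> v = \<eta> \<otimes> w \<cdot> h\<close> for points of \<open>T0\<close>
  means \<open>\<xi> = \<eta>\<close>, \<open>k(v) = w\<close> and \<open>k|\<^sub>v = h\<close> for some \<open>k \<in> stab \<xi>\<close>, and everything about \<open>\<T>\<^sub>n\<close> becomes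
  a statement on the sections \<open>k|\<^sub>v\<close> of the groups \<open>G \<in> \<G>\<close>. What has to be shown is that an
  element of \<open>G\<close> whose section at \<open>vx\<close> lies in \<open>\<AA>\<close> is, up to elements of \<open>G\<close> with trivial
  section at the current word, one whose section at the prefix \<open>v\<close> already lies in \<open>\<AA>\<close>. This
  holds by induction on \<open>v\<close>: the isotropy group of a letter in \<open>G\<close> maps onto a group that is again
  in \<open>\<G>\<close>, or contained in \<open>\<AA>\<close>, or equal to \<open>\<langle>a\<alpha>\<gamma>, \<alpha>c\<rangle>\<close>. For the topology, a subset of \<open>\<T>\<^sub>n\<close>
  is closed iff its preimage in each simplex of \<open>T0 \<times> X\<^sup>n\<close> is.\<close>

section \<open>Tree automorphisms and their sections\<close>

text \<open>The obstacle is that a section may enter \<open>frakA\<close> too late. In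
  \<open>gen SB\<close> the element \<alpha>\<gamma>\<alpha> has the section \<beta> at the letter
  2, but it is not in \<open>frakA\<close>, and no element of \<open>frakA\<close> in
  \<open>gen SB\<close> has the section \<beta> at 2. The way out is to move 2 to 1 by \<alpha>,
  whose section is trivial, and to use \<gamma> at 1. Hence a single equality of tensors may need a
  chain of identifications, and the chains have to be carried through the induction. The induction
  also depends on knowing which elements of \<open>frakA\<close> can occur as sections: the six
  groups contain products outside \<open>frakA\<close>, and \<open>frakA\<close> is not a group.
  This is why memberships in the groups are refuted at length, always by sections and by orbits of
  letters. Topologically, stabilizers grow when a point passes to a face. The condition that \<xi>
  \<otimes> m lies in a given set therefore splits, on a simplex, into finitely many conditions on
  faces. Faces are closed but in general not open, so the argument runs with closed sets.\<close>

interpretation Aut: group Aut by (rule group_Aut)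

lemma Aut_mult [simp]: "g \<otimes>\<^bsub>Aut\<^esub> h = g \<circ> h"
  and Aut_one [simp]: "\<one>\<^bsub>Aut\<^esub> = id"
  by (simp_all add: Aut_def)

lemma Aut_comp [simp, intro]: "g \<in> carrier Aut \<Longrightarrow> h \<in> carrier Aut \<Longrightarrow> g \<circ> h \<in> carrier Aut"
  using Aut.m_closed by fastforce

lemma Aut_id [simp, intro]: "id \<in> carrier Aut"
  using Aut.one_closed by simp

lemma Aut_inv_comp [simp]:
  assumes "g \<in> carrier Aut"
  shows "inv\<^bsub>Aut\<^esub> g \<circ> g = id" "g \<circ> inv\<^bsub>Aut\<^esub> g = id"
  using Aut.l_inv[OF assms] Aut.r_inv[OF assms] by simp_all

lemma Aut_inv_apply [simp]:
  assumes "g \<in> carrier Aut"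
  shows "(inv\<^bsub>Aut\<^esub> g) (g v) = v" "g ((inv\<^bsub>Aut\<^esub> g) v) = v"
  using Aut_inv_comp[OF assms] by (metis comp_apply id_apply)+

lemma Aut_inv_mult:
  "g \<in> carrier Aut \<Longrightarrow> h \<in> carrier Aut \<Longrightarrow> inv\<^bsub>Aut\<^esub> (g \<circ> h) = inv\<^bsub>Aut\<^esub> h \<circ> inv\<^bsub>Aut\<^esub> g"
  using Aut.inv_mult_group by fastforce

lemma Aut_inv_invol:
  assumes "g \<in> carrier Aut" "g \<circ> g = id"
  shows "inv\<^bsub>Aut\<^esub> g = g"
  using Aut.inv_equality[of g g] assms by simp

lemma Aut_Nil [simp]: "g \<in> carrier Aut \<Longrightarrow> g [] = []"
  by (simp add: Aut_def tree_aut_def)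

lemma Aut_snoc:
  assumes "g \<in> carrier Aut"
  obtains y where "g (v @ [x]) = g v @ [y]"
proof -
  have "\<forall>v w. (\<exists>y. g w = g v @ [y]) \<longleftrightarrow> (\<exists>x. w = v @ [x])"
    using assms unfolding Aut_def tree_aut_def mem_Collect_eq partial_object.simps by blast
  then have "\<exists>y. g (v @ [x]) = g v @ [y]" by blast
  with that show ?thesis by blast
qed

lemma Aut_append_ex:
  assumes "g \<in> carrier Aut"
  shows "\<exists>w'. g (v @ w) = g v @ w' \<and> length w' = length w"
proof (induction w rule: rev_induct)
  case (snoc x w)
  then obtain w' where "g (v @ w) = g v @ w'" "length w' = length w" by blast
  then show ?case
    using Aut_snoc[OF assms, of "v @ w" x] by (metis append_assoc length_append_singleton)
qed simp

lemma length_Aut [simp]: "g \<in> carrier Aut \<Longrightarrow> length (g v) = length v"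
  using Aut_append_ex[of g "[]" v] by auto

lemma Aut_append:
  assumes "g \<in> carrier Aut"
  shows "g (v @ w) = g v @ sect g v w"
  using Aut_append_ex[OF assms, of v w] assms
  by (metis append_eq_conv_conj length_Aut sect_def)

lemma Aut_Cons:
  assumes "g \<in> carrier Aut"
  shows "g (x # w) = on_letter g x # sect g [x] w"
proof -
  have "g [x] = [on_letter g x]"
    using length_Aut[OF assms, of "[x]"] by (cases "g [x]") (auto simp: on_letter_def)
  then show ?thesis
    using Aut_append[OF assms, of "[x]" w] by simp
qed

lemma Aut_single: "g \<in> carrier Aut \<Longrightarrow> g [x] = [on_letter g x]"
  using Aut_Cons[of g x "[]"] length_Aut[of g "[x]"] by simp

lemma sect_Nil [simp]: "sect g [] = g"
  by (simp add: sect_def)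

lemma sect_id [simp]: "sect id v = id"
  by (auto simp: sect_def)

lemma on_letter_id [simp]: "on_letter id x = x"
  by (simp add: on_letter_def)

lemma sect_append: "g \<in> carrier Aut \<Longrightarrow> sect g (v @ w) = sect (sect g v) w"
  by (rule ext) (simp add: sect_def drop_drop add.commute)

lemma sect_Cons: "g \<in> carrier Aut \<Longrightarrow> sect g (x # w) = sect (sect g [x]) w"
  using sect_append[of g "[x]" w] by simp

lemma sect_comp:
  assumes "g \<in> carrier Aut" "h \<in> carrier Aut"
  shows "sect (g \<circ> h) v = sect g (h v) \<circ> sect h v"
proof
  fix w
  have "(g \<circ> h) (v @ w) = g (h v) @ sect g (h v) (sect h v w)"
    using assms by (simp add: Aut_append[OF assms(1)] Aut_append[OF assms(2)])
  moreover have "(g \<circ> h) (v @ w) = g (h v) @ sect (g \<circ> h) v w"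
    using Aut_append[OF Aut_comp[OF assms], of v w] by simp
  ultimately show "sect (g \<circ> h) v w = (sect g (h v) \<circ> sect h v) w"
    by simp
qed

lemma on_letter_comp [simp]:
  "g \<in> carrier Aut \<Longrightarrow> h \<in> carrier Aut \<Longrightarrow> on_letter (g \<circ> h) x = on_letter g (on_letter h x)"
  using Aut_single[of "g \<circ> h" x] by (simp add: Aut_single)

lemma sect_comp_letter [simp]:
  assumes "g \<in> carrier Aut" "h \<in> carrier Aut"
  shows "sect (g \<circ> h) [x] = sect g [on_letter h x] \<circ> sect h [x]"
  using assms by (simp add: sect_comp Aut_single)

lemma Aut_eqI:
  assumes "g \<in> carrier Aut" "h \<in> carrier Aut"
    and "\<And>x. on_letter g x = on_letter h x" "\<And>x. sect g [x] = sect h [x]"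
  shows "g = h"
proof
  fix v show "g v = h v"
    using assms by (cases v) (simp_all add: Aut_Cons)
qed

lemma sect_in_Aut [simp, intro]:
  assumes "g \<in> carrier Aut"
  shows "sect g v \<in> carrier Aut"
proof -
  note a = Aut_append[OF assms]
  have inv: "inv\<^bsub>Aut\<^esub> g \<in> carrier Aut" using assms by simp
  have 1: "sect (inv\<^bsub>Aut\<^esub> g) (g v) (sect g v w) = w" for w
    using sect_comp[OF inv assms, of v] assms
    by (simp add: fun_eq_iff)
  have 2: "sect g v (sect (inv\<^bsub>Aut\<^esub> g) (g v) w) = w" for w
    using sect_comp[OF assms inv, of "g v"] assms
    by (simp add: fun_eq_iff)
  have "bij (sect g v)"
    by (rule o_bij[of "sect (inv\<^bsub>Aut\<^esub> g) (g v)"]) (auto simp: fun_eq_iff 1 2)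
  moreover have "sect g v [] = []"
    using a[of v "[]"] by simp
  moreover have "(\<exists>y. sect g v w = sect g v u @ [y]) \<longleftrightarrow> (\<exists>x. w = u @ [x])" for u w
  proof -
    have "(\<exists>y. g (v @ w) = g (v @ u) @ [y]) \<longleftrightarrow> (\<exists>x. v @ w = (v @ u) @ [x])"
      using assms unfolding Aut_def tree_aut_def mem_Collect_eq partial_object.simps by blast
    then show ?thesis by (simp only: a append_assoc same_append_eq)
  qed
  ultimately show ?thesis
    unfolding Aut_def tree_aut_def mem_Collect_eq partial_object.simps by blast
qed

lemma on_letter_sect_butlast:
  assumes "g \<in> carrier Aut"
  shows "g (v @ [x]) = g v @ [on_letter (sect g v) x]"
  using assms by (simp add: Aut_append Aut_single)

section \<open>Groups generated by involutions\<close>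

abbreviation gen :: "taut set \<Rightarrow> taut set" where
  "gen S \<equiv> generate Aut S"

definition invol_set :: "taut set \<Rightarrow> bool" where
  "invol_set S \<longleftrightarrow> (\<forall>s\<in>S. s \<in> carrier Aut \<and> s \<circ> s = id)"

lemma invol_set_carrier: "invol_set S \<Longrightarrow> S \<subseteq> carrier Aut"
  by (auto simp: invol_set_def)

lemma gen_subgroup: "invol_set S \<Longrightarrow> subgroup (gen S) Aut"
  by (intro Aut.generate_is_subgroup invol_set_carrier)

lemma gen_in_Aut: "invol_set S \<Longrightarrow> g \<in> gen S \<Longrightarrow> g \<in> carrier Aut"
  using Aut.generate_in_carrier invol_set_carrier by blast

lemma gen_id [simp, intro]: "id \<in> gen S"
  using generate.one[of Aut S] by simp

lemma gen_comp [intro]: "g \<in> gen S \<Longrightarrow> h \<in> gen S \<Longrightarrow> g \<circ> h \<in> gen S"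
  using generate.eng[of g Aut S h] by simp

lemma gen_inv: "invol_set S \<Longrightarrow> g \<in> gen S \<Longrightarrow> inv\<^bsub>Aut\<^esub> g \<in> gen S"
  using gen_subgroup subgroup.m_inv_closed by fastforce

lemma gen_least:
  assumes "subgroup H Aut" "S \<subseteq> H"
  shows "gen S \<subseteq> H"
  using Aut.generate_subgroup_incl[OF assms(2,1)] .

text \<open>Generators are their own inverses, so every element is a product of generators alone and
  induction may prepend one generator at a time.\<close>

lemma gen_induct [consumes 2, case_names id mult]:
  assumes g: "g \<in> gen S" and S: "invol_set S"
    and id: "P id"
    and mult: "\<And>s g. s \<in> S \<Longrightarrow> g \<in> gen S \<Longrightarrow> P g \<Longrightarrow> P (s \<circ> g)"
  shows "P g"
proof -
  \<comment> \<open>The library induction splits a product at an arbitrary place; quantifying over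
    the right factor \<open>h\<close> lets two such statements compose.\<close>
  have "\<forall>h\<in>gen S. P h \<longrightarrow> P (g \<circ> h)"
    using g
  proof (induction rule: generate.induct)
    case one
    then show ?case by simp
  next
    case (incl h)
    show ?case unfolding Aut_mult using incl mult by blast
  next
    case (inv h)
    have "inv\<^bsub>Aut\<^esub> h = h" using S inv by (auto simp: invol_set_def intro: Aut_inv_invol)
    show ?case unfolding \<open>inv\<^bsub>Aut\<^esub> h = h\<close> Aut_mult using inv mult by blast
  next
    case (eng h1 h2)
    then show ?case unfolding Aut_mult comp_assoc by blast
  qed
  with id show ?thesis by force
qed

section \<open>Sections and relations of the generators\<close>

lemma generators_Aut [simp]:
  "g_alpha \<in> carrier Aut" "g_beta \<in> carrier Aut" "g_gamma \<in> carrier Aut"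
  "g_a \<in> carrier Aut" "g_b \<in> carrier Aut" "g_c \<in> carrier Aut"
  using generators_in_Aut by auto

lemma on_letter_generators [simp]:
  "on_letter g_alpha x = sigma x" "on_letter g_a x = pi_perm x"
  "on_letter g_beta x = x" "on_letter g_gamma x = x" "on_letter g_b x = x" "on_letter g_c x = x"
  by (cases x; simp add: on_letter_def)+

lemma sect_generators [simp]:
  "sect g_alpha [x] = id" "sect g_a [x] = id"
  "sect g_beta [L1] = g_alpha" "sect g_beta [L2] = g_gamma"
  "sect g_beta [L3] = g_alpha" "sect g_beta [L4] = g_gamma"
  "sect g_gamma [L1] = g_beta" "sect g_gamma [L2] = id"
  "sect g_gamma [L3] = id" "sect g_gamma [L4] = g_beta"
  "sect g_b [L1] = g_a \<circ> g_alpha" "sect g_b [L2] = g_a \<circ> g_alpha"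
  "sect g_b [L3] = g_c" "sect g_b [L4] = g_c"
  "sect g_c [L1] = g_b \<circ> g_beta" "sect g_c [L2] = g_b \<circ> g_beta"
  "sect g_c [L3] = g_b" "sect g_c [L4] = g_b"
  by (auto simp: sect_def fun_eq_iff)

lemma b_alpha_a_beta_comm:
  "g_b (g_alpha v) = g_alpha (g_b v)" "g_a (g_beta v) = g_beta (g_a v)"
  by (cases v rule: g_b.cases; simp)+

lemma gamma_alpha_a_comm: "g_gamma (g_alpha (g_a v)) = g_alpha (g_a (g_gamma v))"
  using alpha_c_a_alpha_gamma_comm(2)[of v] by simp

lemma a_c_gamma_comm: "g_c (g_gamma (g_a v)) = g_a (g_c (g_gamma v))"
  by (cases v rule: g_b.cases; simp add: beta_gamma_comm_b_c)

text \<open>The two relations need each other: \<gamma> and b\<beta> are the sections of \<beta> and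
  c\<gamma> at the letters 2 and 4, while \<beta> and c\<gamma> are those of \<gamma> and b\<beta>
  at 4. At the other letters earlier relations suffice.\<close>

lemma beta_gamma_b_c_comm:
  "g_beta (g_c (g_gamma v)) = g_c (g_gamma (g_beta v)) \<and>
   g_gamma (g_b (g_beta v)) = g_b (g_beta (g_gamma v))"
proof (induction "length v" arbitrary: v)
  case (Suc n)
  then obtain x u where v: "v = x # u" and u: "length u = n" by (cases v) auto
  then show ?case
    using Suc(1)[of u]
    by (cases x) (simp_all add: b_alpha_a_beta_comm alpha_c_a_alpha_gamma_comm beta_gamma_comm_b_c)
qed simp

text \<open>Each rule also appears behind a prefix \<open>f\<close>, because \<open>o_assoc\<close>
  nests products to the left and a cancellation in the middle of a product must still match. The
  same holds for \<open>comm_rules\<close>.\<close>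

lemma invol_rules [simp]:
  "g_alpha \<circ> g_alpha = id" "g_beta \<circ> g_beta = id" "g_gamma \<circ> g_gamma = id"
  "g_a \<circ> g_a = id" "g_b \<circ> g_b = id" "g_c \<circ> g_c = id"
  "f \<circ> g_alpha \<circ> g_alpha = f" "f \<circ> g_beta \<circ> g_beta = f" "f \<circ> g_gamma \<circ> g_gamma = f"
  "f \<circ> g_a \<circ> g_a = f" "f \<circ> g_b \<circ> g_b = f" "f \<circ> g_c \<circ> g_c = f"
  by (auto simp: fun_eq_iff)

lemma comm_rules [simp]:
  "g_alpha \<circ> g_a = g_a \<circ> g_alpha" "f \<circ> g_alpha \<circ> g_a = f \<circ> g_a \<circ> g_alpha"
  "g_c \<circ> g_alpha = g_alpha \<circ> g_c" "f \<circ> g_c \<circ> g_alpha = f \<circ> g_alpha \<circ> g_c"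
  "g_beta \<circ> g_b = g_b \<circ> g_beta" "f \<circ> g_beta \<circ> g_b = f \<circ> g_b \<circ> g_beta"
  "g_gamma \<circ> g_c = g_c \<circ> g_gamma" "f \<circ> g_gamma \<circ> g_c = f \<circ> g_c \<circ> g_gamma"
  "g_gamma \<circ> g_a \<circ> g_alpha = g_a \<circ> g_alpha \<circ> g_gamma"
  "f \<circ> g_gamma \<circ> g_a \<circ> g_alpha = f \<circ> g_a \<circ> g_alpha \<circ> g_gamma"
  "g_b \<circ> g_alpha = g_alpha \<circ> g_b" "f \<circ> g_b \<circ> g_alpha = f \<circ> g_alpha \<circ> g_b"
  "g_a \<circ> g_beta = g_beta \<circ> g_a" "f \<circ> g_a \<circ> g_beta = f \<circ> g_beta \<circ> g_a"
  by (auto simp: fun_eq_iff alpha_c_a_alpha_gamma_comm beta_gamma_comm_b_c b_alpha_a_beta_comm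
      gamma_alpha_a_comm)

lemma frakA_invol:
  assumes "g \<in> frakA"
  shows "g \<in> carrier Aut" "g \<circ> g = id"
  using assms
  by (auto simp: frakA_def o_assoc)

lemma invol_set_frakA: "S \<subseteq> frakA \<Longrightarrow> invol_set S"
  by (auto simp: invol_set_def dest: frakA_invol)

lemma frakA_sect_letter: "g \<in> frakA \<Longrightarrow> sect g [x] \<in> frakA"
  by (cases x) (auto simp: frakA_def o_assoc)

lemma frakA_sect: "g \<in> frakA \<Longrightarrow> sect g v \<in> frakA"
proof (induction v rule: rev_induct)
  case (snoc x v)
  then show ?case
    using frakA_invol(1)[of g] frakA_sect_letter[of "sect g v" x] by (simp add: sect_append)
qed simp

lemma gen_single:
  assumes "s \<in> frakA"
  shows "gen {s} = {id, s}"
proof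
  have "subgroup {id, s} Aut"
    using frakA_invol[OF assms] Aut_inv_invol[of s] Aut_inv_invol[of id]
    by (intro Aut.subgroupI) auto
  then show "gen {s} \<subseteq> {id, s}" by (rule gen_least) simp
qed (auto intro: generate.incl)

lemma gen_commuting_pair:
  assumes "s \<in> frakA" "t \<in> frakA" "s \<circ> t = t \<circ> s"
  shows "gen {s, t} = {id, s, t, s \<circ> t}"
proof
  have st: "s (s v) = v" "t (t v) = v" "t (s v) = s (t v)" for v
    using assms frakA_invol(2)[of s] frakA_invol(2)[of t] by (auto simp: fun_eq_iff)
  have inv: "invol_set {s, t}" using assms by (intro invol_set_frakA) auto
  show "gen {s, t} \<subseteq> {id, s, t, s \<circ> t}"
  proof
    fix g assume "g \<in> gen {s, t}"
    from this inv show "g \<in> {id, s, t, s \<circ> t}"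
      by (induction rule: gen_induct) (auto simp: fun_eq_iff st)
  qed
  show "{id, s, t, s \<circ> t} \<subseteq> gen {s, t}"
    by (auto intro: generate.incl)
qed

text \<open>All occurrences of the commuting involution \<open>s\<close> in a word collect at its
  front, where at most one survives.\<close>

lemma gen_insert_commuting:
  assumes S: "insert s S \<subseteq> frakA" and comm: "\<And>t. t \<in> S \<Longrightarrow> s \<circ> t = t \<circ> s"
    and g: "g \<in> gen (insert s S)"
  shows "g \<in> gen S \<or> (\<exists>w\<in>gen S. g = s \<circ> w)"
proof -
  have ss: "s \<circ> (s \<circ> w) = w" for w
    using S frakA_invol(2)[of s] by (simp add: o_assoc)
  have ts: "t \<circ> (s \<circ> w) = s \<circ> (t \<circ> w)" if "t \<in> S" for t w
    using comm[OF that] by (simp add: o_assoc)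
  have "invol_set (insert s S)" using S by (rule invol_set_frakA)
  with g show ?thesis
  proof (induction rule: gen_induct)
    case (mult t g)
    show ?case
    proof (cases "t = s")
      case True
      with mult ss show ?thesis by metis
    next
      case False
      with mult have "t \<in> S" by simp
      then have "t \<circ> w \<in> gen S" if "w \<in> gen S" for w
        using that gen_comp[OF generate.incl[OF \<open>t \<in> S\<close>]] by blast
      with mult(3) ts[OF \<open>t \<in> S\<close>] show ?thesis by metis
    qed
  qed (rule disjI1, rule gen_id)
qed

section \<open>Self-similarity of the finite subgroups\<close>

text \<open>A generator moving a letter has trivial section there, so the isotropy group of
  a letter in \<open>gen S\<close> determines all sections at its orbit, which lie in \<open>gen (M x)\<close>.\<close>

definition wreath :: "taut set \<Rightarrow> (letter \<Rightarrow> taut set) \<Rightarrow> bool" where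
  "wreath S M \<longleftrightarrow> S \<subseteq> frakA \<and> (\<forall>x. M x \<subseteq> frakA) \<and>
     (\<forall>s\<in>S. \<forall>x. sect s [x] \<in> gen (M x) \<and> M (on_letter s x) = M x \<and>
        (on_letter s x = x \<or> sect s [x] = id))"

text \<open>Follow the letter \<open>x\<close> through a word for \<open>g\<close>. A generator that
  fixes the current letter is dropped, one that moves it has trivial section there and is kept; the
  kept generators form \<open>t\<close>.\<close>

lemma wreath_gen:
  assumes "wreath S M" "g \<in> gen S"
  shows "sect g [x] \<in> gen (M x)" "M (on_letter g x) = M x"
    "\<exists>t\<in>gen S. on_letter t x = on_letter g x \<and> sect t [x] = id"
proof -
  have S: "S \<subseteq> frakA" using assms(1) by (simp add: wreath_def)
  then have inv: "invol_set S" by (rule invol_set_frakA)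
  let ?P = "\<lambda>g. sect g [x] \<in> gen (M x) \<and> M (on_letter g x) = M x \<and>
    (\<exists>t\<in>gen S. on_letter t x = on_letter g x \<and> sect t [x] = id)"
  have "?P g"
    using assms(2) inv
  proof (induction rule: gen_induct)
    case id
    have "?P id" by (auto intro!: bexI[of _ id])
    then show ?case .
  next
    case (mult s g)
    then obtain t where t: "t \<in> gen S" "on_letter t x = on_letter g x" "sect t [x] = id" by blast
    have sA: "s \<in> carrier Aut" and gA: "g \<in> carrier Aut" and tA: "t \<in> carrier Aut"
      using S frakA_invol(1) mult(1) gen_in_Aut[OF inv] mult(2) t(1) by auto
    let ?y = "on_letter g x"
    have s: "sect s [?y] \<in> gen (M ?y)" "M (on_letter s ?y) = M ?y"
      "on_letter s ?y = ?y \<or> sect s [?y] = id"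
      using assms(1) mult(1) by (auto simp: wreath_def)
    have "sect s [?y] \<circ> sect g [x] \<in> gen (M x)"
      using s(1) mult(3) by (metis gen_comp)
    moreover have "\<exists>t'\<in>gen S. on_letter t' x = on_letter s ?y \<and> sect t' [x] = id"
      using s(3)
    proof
      assume "on_letter s ?y = ?y"
      with t show ?thesis by auto
    next
      assume "sect s [?y] = id"
      moreover have "s \<circ> t \<in> gen S" using mult(1) t(1) by (metis gen_comp generate.incl)
      ultimately show ?thesis
        using t sA tA by (intro bexI[of _ "s \<circ> t"]) simp_all
    qed
    ultimately have "?P (s \<circ> g)" using s(2) mult(3) sA gA by simp
    then show ?case .
  qed
  then show "sect g [x] \<in> gen (M x)" "M (on_letter g x) = M x"
    "\<exists>t\<in>gen S. on_letter t x = on_letter g x \<and> sect t [x] = id" by auto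
qed

text \<open>Applied with \<open>f\<close> the identity, to see that all letters are fixed, and with
  \<open>f\<close> the membership in a two-letter block, to bound the orbits.\<close>

lemma gen_block:
  assumes "S \<subseteq> frakA" "\<forall>s\<in>S. \<forall>x. f (on_letter s x) = f x" "g \<in> gen S"
  shows "f (on_letter g x) = f x"
  using assms(3) invol_set_frakA[OF assms(1)]
proof (induction rule: gen_induct)
  case (mult s g)
  moreover have "s \<in> carrier Aut" "g \<in> carrier Aut"
    using mult assms(1) frakA_invol(1) gen_in_Aut[OF invol_set_frakA[OF assms(1)]] by auto
  ultimately have "f (on_letter (s \<circ> g) x) = f x" using assms(2) by simp
  then show ?case .
next
  case id
  have "f (on_letter id x) = f x" by simp
  then show ?case .
qed

text \<open>The six groups are called \<open>A\<close>, \<open>B\<close>, \<open>C\<close>, \<open>A1\<close>, \<open>B1\<close>, \<open>C1\<close>; \<open>SXY\<close> generates the intersection of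
  the groups \<open>X\<close> and \<open>Y\<close>. The group \<open>gen SR\<close> is not in \<open>\<G>\<close>, but occurs among the sections of \<open>C1\<close>.\<close>

abbreviation "SA \<equiv> {g_beta, g_gamma, g_b, g_c}"
abbreviation "SB \<equiv> {g_alpha, g_gamma, g_a, g_c}"
abbreviation "SC \<equiv> {g_alpha, g_beta, g_a, g_b}"
abbreviation "SA1 \<equiv> {g_alpha, g_b, g_c}"
abbreviation "SB1 \<equiv> {g_beta, g_a, g_c \<circ> g_gamma}"
abbreviation "SC1 \<equiv> {g_gamma, g_a \<circ> g_alpha, g_b \<circ> g_beta}"
abbreviation "SAC \<equiv> {g_b, g_beta}"
abbreviation "SAA1 \<equiv> {g_b, g_c}"
abbreviation "SAB1 \<equiv> {g_beta, g_c \<circ> g_gamma}"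
abbreviation "SAC1 \<equiv> {g_gamma, g_b \<circ> g_beta}"
abbreviation "SBB1 \<equiv> {g_a, g_c \<circ> g_gamma}"
abbreviation "SCA1 \<equiv> {g_alpha, g_b}"
abbreviation "SCB1 \<equiv> {g_beta, g_a}"
abbreviation "SCC1 \<equiv> {g_a \<circ> g_alpha, g_b \<circ> g_beta}"
abbreviation "SR \<equiv> {g_a \<circ> g_alpha \<circ> g_gamma, g_alpha \<circ> g_c}"

lemma all_letter: "(\<forall>x. P x) \<longleftrightarrow> P L1 \<and> P L2 \<and> P L3 \<and> P L4"
  by (metis letter.exhaust)

lemma gen_incl: "s \<in> S \<Longrightarrow> s \<in> gen S"
  by (rule generate.incl)

lemma gen_incl2: "s \<in> S \<Longrightarrow> t \<in> S \<Longrightarrow> s \<circ> t \<in> gen S"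
  by (intro gen_comp generate.incl)

lemmas wreath_simps = wreath_def all_letter frakA_def o_assoc gen_incl gen_incl2

text \<open>The entry at \<open>x\<close> is generated by the sections of the generators over the
  orbit of \<open>x\<close>. The sections of \<open>gen SA\<close> at 1, 2, 3, 4 give
  \<open>gen SC\<close>, \<open>gen SC1\<close>, \<open>gen SA1\<close> and \<open>gen SA\<close>,
  which is how the short groups enter. The pair \<open>SR\<close> comes from b\<beta>, whose
  sections at 2 and 3 are its two members.\<close>

lemma wreath_A: "wreath SA (case_letter SC SC1 SA1 SA)"
  and wreath_B: "wreath SB (\<lambda>_. SAC)"
  and wreath_C: "wreath SC (\<lambda>_. SB)"
  and wreath_A1: "wreath SA1 (case_letter SCC1 SCC1 SAA1 SAA1)"
  and wreath_B1: "wreath SB1 (case_letter SCA1 SAC1 SCA1 SAC1)"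
  and wreath_C1: "wreath SC1 (case_letter SB1 SR SR SB1)"
  and wreath_AA1: "wreath SAA1 (case_letter SCC1 SCC1 SAA1 SAA1)"
  and wreath_AB1: "wreath SAB1 (case_letter SCA1 SAC1 SCA1 SAC1)"
  and wreath_AC1: "wreath SAC1 (case_letter SCB1 {g_a \<circ> g_alpha \<circ> g_gamma} {g_alpha \<circ> g_c} SAB1)"
  and wreath_BB1: "wreath SBB1 (case_letter {g_b} {g_b \<circ> g_beta} {g_b} {g_b \<circ> g_beta})"
  and wreath_CA1: "wreath SCA1 (case_letter {g_a \<circ> g_alpha} {g_a \<circ> g_alpha} {g_c} {g_c})"
  and wreath_CB1: "wreath SCB1 (case_letter {g_alpha} {g_gamma} {g_alpha} {g_gamma})"
  and wreath_CC1: "wreath SCC1 (case_letter SBB1 SR SR SBB1)"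
  by (simp_all add: wreath_simps)

lemmas sect_A = wreath_gen(1)[OF wreath_A]
  and sect_B = wreath_gen(1)[OF wreath_B]
  and sect_C = wreath_gen(1)[OF wreath_C]
  and sect_A1 = wreath_gen(1)[OF wreath_A1]
  and sect_B1 = wreath_gen(1)[OF wreath_B1]
  and sect_C1 = wreath_gen(1)[OF wreath_C1]
  and sect_AA1 = wreath_gen(1)[OF wreath_AA1]
  and sect_AB1 = wreath_gen(1)[OF wreath_AB1]
  and sect_AC1 = wreath_gen(1)[OF wreath_AC1]
  and sect_CA1 = wreath_gen(1)[OF wreath_CA1]
  and sect_CC1 = wreath_gen(1)[OF wreath_CC1]

lemma letters_A: "g \<in> gen SA \<Longrightarrow> on_letter g x = x"
  and letters_AC: "g \<in> gen SAC \<Longrightarrow> on_letter g x = x"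
  and letters_A1: "g \<in> gen SA1 \<Longrightarrow> on_letter g x \<in> {x, sigma x}"
  and letters_B1: "g \<in> gen SB1 \<Longrightarrow> on_letter g x \<in> {x, pi_perm x}"
  and letters_C1: "g \<in> gen SC1 \<Longrightarrow> on_letter g x \<in> {x, pi_perm (sigma x)}"
proof -
  show "g \<in> gen SA \<Longrightarrow> on_letter g x = x"
    using gen_block[of SA "\<lambda>x. x" g x] by (simp add: frakA_def)
  show "g \<in> gen SAC \<Longrightarrow> on_letter g x = x"
    using gen_block[of SAC "\<lambda>x. x" g x] by (simp add: frakA_def)
  have "g \<in> gen SA1 \<Longrightarrow> (on_letter g x \<in> {L1, L2}) = (x \<in> {L1, L2})"
    using gen_block[of SA1 "\<lambda>x. x \<in> {L1, L2}" g x] by (simp add: frakA_def all_letter)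
  then show "g \<in> gen SA1 \<Longrightarrow> on_letter g x \<in> {x, sigma x}"
    by (cases x; cases "on_letter g x") simp_all
  have "g \<in> gen SB1 \<Longrightarrow> (on_letter g x \<in> {L1, L3}) = (x \<in> {L1, L3})"
    using gen_block[of SB1 "\<lambda>x. x \<in> {L1, L3}" g x] by (simp add: frakA_def all_letter)
  then show "g \<in> gen SB1 \<Longrightarrow> on_letter g x \<in> {x, pi_perm x}"
    by (cases x; cases "on_letter g x") simp_all
  have "g \<in> gen SC1 \<Longrightarrow> (on_letter g x \<in> {L1, L4}) = (x \<in> {L1, L4})"
    using gen_block[of SC1 "\<lambda>x. x \<in> {L1, L4}" g x] by (simp add: frakA_def all_letter)
  then show "g \<in> gen SC1 \<Longrightarrow> on_letter g x \<in> {x, pi_perm (sigma x)}"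
    by (cases x; cases "on_letter g x") simp_all
qed

lemma gen_subset_gen:
  assumes "S \<subseteq> gen S'" "invol_set S'" shows "gen S \<subseteq> gen S'"
  using assms gen_least gen_subgroup by blast

lemma CC1_sub_C: "gen SCC1 \<subseteq> gen SC"
  and CC1_sub_C1: "gen SCC1 \<subseteq> gen SC1"
  and CA1_sub_C: "gen SCA1 \<subseteq> gen SC"
  and CA1_sub_A1: "gen SCA1 \<subseteq> gen SA1"
  and AC1_sub_A: "gen SAC1 \<subseteq> gen SA"
  and AC1_sub_C1: "gen SAC1 \<subseteq> gen SC1"
  and CB1_sub_C: "gen SCB1 \<subseteq> gen SC"
  and CB1_sub_B1: "gen SCB1 \<subseteq> gen SB1"
  and AB1_sub_A: "gen SAB1 \<subseteq> gen SA"
  and AB1_sub_B1: "gen SAB1 \<subseteq> gen SB1"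
  and AA1_sub_A: "gen SAA1 \<subseteq> gen SA"
  and AA1_sub_A1: "gen SAA1 \<subseteq> gen SA1"
  and BB1_sub_B: "gen SBB1 \<subseteq> gen SB"
  and BB1_sub_B1: "gen SBB1 \<subseteq> gen SB1"
  and R_sub_B: "gen SR \<subseteq> gen SB"
  by (rule gen_subset_gen; simp add: gen_incl gen_incl2 gen_comp invol_set_frakA frakA_def)+


section \<open>Which elements of \<AA> can lie in which of the six groups\<close>

text \<open>Sections of \<open>gen SB\<close> lie in \<open>gen SAC\<close>, which fixes all
  letters, whereas \<beta>, b and b\<beta> have the sections \<alpha>, a\<alpha> and a at 1. The
  lemmas below descend along sections in the same way until an orbit of letters decides.\<close>

lemma not_in_B: "g_beta \<notin> gen SB" "g_b \<notin> gen SB" "g_b \<circ> g_beta \<notin> gen SB"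
  using sect_B[of g_beta L1] sect_B[of g_b L1] sect_B[of "g_b \<circ> g_beta" L1]
    letters_AC[of g_alpha L1] letters_AC[of "g_a \<circ> g_alpha" L1] letters_AC[of g_a L1]
  by auto

lemma not_in_C:
  "g_gamma \<notin> gen SC" "g_c \<notin> gen SC" "g_c \<circ> g_gamma \<notin> gen SC"
  "g_a \<circ> g_alpha \<circ> g_gamma \<notin> gen SC" "g_alpha \<circ> g_c \<notin> gen SC"
  using sect_C[of g_gamma L1] sect_C[of g_c L1] sect_C[of "g_c \<circ> g_gamma" L1]
    sect_C[of "g_a \<circ> g_alpha \<circ> g_gamma" L1] sect_C[of "g_alpha \<circ> g_c" L1] not_in_B
  by auto

lemma not_in_A1:
  "g_beta \<notin> gen SA1" "g_gamma \<notin> gen SA1" "g_a \<notin> gen SA1" "g_a \<circ> g_alpha \<notin> gen SA1"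
  "g_b \<circ> g_beta \<notin> gen SA1" "g_c \<circ> g_gamma \<notin> gen SA1" "g_a \<circ> g_alpha \<circ> g_gamma \<notin> gen SA1"
proof -
  have alpha: "g_alpha \<notin> gen SCC1" and a: "g_a \<notin> gen SCC1"
    using letters_C1[of _ L1] CC1_sub_C1 by fastforce+
  have "g_alpha \<notin> gen SBB1" "g_a \<circ> g_alpha \<notin> gen SBB1"
    using letters_B1[of _ L1] BB1_sub_B1 by fastforce+
  then have "g_beta \<notin> gen SCC1" "g_b \<notin> gen SCC1"
    using sect_CC1[of g_beta L1] sect_CC1[of g_b L1] by auto
  then show "g_gamma \<notin> gen SA1" "g_c \<circ> g_gamma \<notin> gen SA1"
    using sect_A1[of g_gamma L1] sect_A1[of "g_c \<circ> g_gamma" L1] by auto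
  show "g_beta \<notin> gen SA1" "g_b \<circ> g_beta \<notin> gen SA1"
    using sect_A1[of g_beta L1] sect_A1[of "g_b \<circ> g_beta" L1] alpha a by auto
  show "g_a \<notin> gen SA1" "g_a \<circ> g_alpha \<notin> gen SA1" "g_a \<circ> g_alpha \<circ> g_gamma \<notin> gen SA1"
    using letters_A1[of _ L1] by fastforce+
qed

lemma not_in_B1:
  "g_alpha \<notin> gen SB1" "g_gamma \<notin> gen SB1" "g_b \<notin> gen SB1" "g_c \<notin> gen SB1"
  "g_b \<circ> g_beta \<notin> gen SB1" "g_a \<circ> g_alpha \<notin> gen SB1"
  "g_a \<circ> g_alpha \<circ> g_gamma \<notin> gen SB1" "g_alpha \<circ> g_c \<notin> gen SB1"
proof -
  have "g_alpha \<notin> gen {g_a \<circ> g_alpha}"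
    using letters_C1[of g_alpha L1] gen_subset_gen[of "{g_a \<circ> g_alpha}" SC1]
    by (auto simp: gen_incl invol_set_frakA frakA_def)
  then have "g_beta \<notin> gen SCA1"
    using sect_CA1[of g_beta L1] by auto
  moreover have "g_a \<notin> gen SCA1" "g_a \<circ> g_alpha \<notin> gen SCA1" "g_b \<circ> g_beta \<notin> gen SCA1"
    using not_in_A1 CA1_sub_A1 by auto
  ultimately show "g_gamma \<notin> gen SB1" "g_b \<notin> gen SB1" "g_c \<notin> gen SB1" "g_b \<circ> g_beta \<notin> gen SB1"
    using sect_B1[of g_gamma L1] sect_B1[of g_b L1] sect_B1[of g_c L1]
      sect_B1[of "g_b \<circ> g_beta" L1] by auto
  show "g_alpha \<notin> gen SB1" "g_a \<circ> g_alpha \<notin> gen SB1"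
    "g_a \<circ> g_alpha \<circ> g_gamma \<notin> gen SB1" "g_alpha \<circ> g_c \<notin> gen SB1"
    using letters_B1[of _ L1] by fastforce+
qed

lemma not_in_C1:
  "g_alpha \<notin> gen SC1" "g_beta \<notin> gen SC1" "g_a \<notin> gen SC1" "g_b \<notin> gen SC1" "g_c \<notin> gen SC1"
  "g_c \<circ> g_gamma \<notin> gen SC1" "g_alpha \<circ> g_c \<notin> gen SC1"
proof -
  show "g_alpha \<notin> gen SC1" "g_a \<notin> gen SC1" "g_alpha \<circ> g_c \<notin> gen SC1"
    using letters_C1[of _ L1] by fastforce+
  show "g_beta \<notin> gen SC1" "g_b \<notin> gen SC1" "g_c \<notin> gen SC1" "g_c \<circ> g_gamma \<notin> gen SC1"
    using sect_C1[of g_beta L1] sect_C1[of g_b L1] sect_C1[of g_c L1]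
      sect_C1[of "g_c \<circ> g_gamma" L1] not_in_B1 by auto
qed

lemma not_in_A:
  "g_alpha \<notin> gen SA" "g_a \<notin> gen SA" "g_a \<circ> g_alpha \<notin> gen SA"
  "g_a \<circ> g_alpha \<circ> g_gamma \<notin> gen SA" "g_alpha \<circ> g_c \<notin> gen SA"
  using letters_A[of _ L1] by fastforce+

text \<open>These bounds list what the refutations leave of \<open>frakA\<close>. They make it a
  finite check whether each section in \<open>frakA\<close> is realized.\<close>

lemma frakA_Int_A: "g \<in> frakA \<Longrightarrow> g \<in> gen SA \<Longrightarrow>
     g \<in> {id, g_beta, g_gamma, g_b, g_c, g_b \<circ> g_beta, g_c \<circ> g_gamma}"
  and frakA_Int_B: "g \<in> frakA \<Longrightarrow> g \<in> gen SB \<Longrightarrow>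
     g \<in> {id, g_alpha, g_gamma, g_a, g_c, g_a \<circ> g_alpha, g_c \<circ> g_gamma,
       g_a \<circ> g_alpha \<circ> g_gamma, g_alpha \<circ> g_c}"
  and frakA_Int_C: "g \<in> frakA \<Longrightarrow> g \<in> gen SC \<Longrightarrow>
     g \<in> {id, g_alpha, g_beta, g_a, g_b, g_a \<circ> g_alpha, g_b \<circ> g_beta}"
  and frakA_Int_A1: "g \<in> frakA \<Longrightarrow> g \<in> gen SA1 \<Longrightarrow> g \<in> {id, g_alpha, g_b, g_c, g_alpha \<circ> g_c}"
  and frakA_Int_B1: "g \<in> frakA \<Longrightarrow> g \<in> gen SB1 \<Longrightarrow> g \<in> {id, g_beta, g_a, g_c \<circ> g_gamma}"
  and frakA_Int_C1: "g \<in> frakA \<Longrightarrow> g \<in> gen SC1 \<Longrightarrow>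
     g \<in> {id, g_gamma, g_a \<circ> g_alpha, g_b \<circ> g_beta, g_a \<circ> g_alpha \<circ> g_gamma}"
  unfolding frakA_def
  using not_in_A not_in_B not_in_C not_in_A1 not_in_B1 not_in_C1 by (blast+)

section \<open>The intersections of the six groups\<close>

lemma Int_eqI: "(\<And>g. g \<in> A \<Longrightarrow> g \<in> B \<Longrightarrow> g \<in> C) \<Longrightarrow> C \<subseteq> A \<Longrightarrow> C \<subseteq> B \<Longrightarrow> A \<inter> B = C"
  by blast

lemma SA_frakA: "SA \<subseteq> frakA" "SB \<subseteq> frakA" "SC \<subseteq> frakA" "SA1 \<subseteq> frakA" "SB1 \<subseteq> frakA" "SC1 \<subseteq> frakA"
  by (simp_all add: frakA_def)

lemma six_in_Aut [simp]:
  "g \<in> gen SA \<Longrightarrow> g \<in> carrier Aut" "g \<in> gen SB \<Longrightarrow> g \<in> carrier Aut"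
  "g \<in> gen SC \<Longrightarrow> g \<in> carrier Aut" "g \<in> gen SA1 \<Longrightarrow> g \<in> carrier Aut"
  "g \<in> gen SB1 \<Longrightarrow> g \<in> carrier Aut" "g \<in> gen SC1 \<Longrightarrow> g \<in> carrier Aut"
  using gen_in_Aut[OF invol_set_frakA] SA_frakA by blast+

text \<open>On \<open>\<langle>\<beta>, \<gamma>, b, c\<rangle>\<close> the section at the letter 4 is an involutive automorphism, exchanging
  \<open>\<beta>\<close> with \<open>\<gamma>\<close> and \<open>b\<close> with \<open>c\<close>.\<close>

lemma sect_sect_A:
  assumes "g \<in> gen SA"
  shows "sect (sect g [L4]) [L4] = g"
  using assms invol_set_frakA[OF SA_frakA(1)]
proof (induction rule: gen_induct)
  case id
  have "sect (sect id [L4]) [L4] = id" by simp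
  then show ?case .
next
  case (mult s g)
  have "on_letter g L4 = L4" "on_letter (sect g [L4]) L4 = L4" "g \<in> carrier Aut" "s \<in> carrier Aut"
    using mult letters_A[of g L4] letters_A[of "sect g [L4]" L4] sect_A[of g L4] by auto
  then have "sect (sect (s \<circ> g) [L4]) [L4] = s \<circ> g"
    using mult by auto
  then show ?case .
qed

lemma gen_SAC: "gen SAC = {id, g_b, g_beta, g_b \<circ> g_beta}"
  by (rule gen_commuting_pair) (simp_all add: frakA_def)

lemma beta_c_gamma_comm: "g_beta \<circ> (g_c \<circ> g_gamma) = g_c \<circ> g_gamma \<circ> g_beta"
  by (simp add: fun_eq_iff beta_gamma_b_c_comm)

lemma gen_SAB1: "gen SAB1 = {id, g_beta, g_c \<circ> g_gamma, g_beta \<circ> (g_c \<circ> g_gamma)}"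
  by (rule gen_commuting_pair) (simp_all add: frakA_def beta_c_gamma_comm)

text \<open>The section of \<open>g\<close> at 4 is one of the four elements of
  \<open>gen SAC\<close>, and by \<open>sect_sect_A\<close> taking the section at 4 once more
  returns \<open>g\<close>. The same double descent at the letter 4 determines the other
  intersections with \<open>gen SA\<close>.\<close>

lemma Int_AB: "g \<in> gen SA \<Longrightarrow> g \<in> gen SB \<Longrightarrow> g \<in> {id, g_gamma, g_c, g_c \<circ> g_gamma}"
  using sect_B[of g L4] sect_sect_A[of g] by (auto simp: gen_SAC)

lemma Int_AC: "g \<in> gen SA \<Longrightarrow> g \<in> gen SC \<Longrightarrow> g \<in> {id, g_b, g_beta, g_b \<circ> g_beta}"
  using sect_C[of g L4] sect_A[of g L4] Int_AB[of "sect g [L4]"] sect_sect_A[of g] by auto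

lemma Int_AA1: "gen SA \<inter> gen SA1 = gen SAA1"
proof -
  have "g \<in> gen SAA1" if "g \<in> gen SA" "g \<in> gen SA1" for g
    using that sect_A1[of g L4] sect_AA1[of "sect g [L4]" L4] sect_sect_A[of g] by simp
  then show ?thesis by (rule Int_eqI[OF _ AA1_sub_A AA1_sub_A1])
qed

lemma Int_AB1: "gen SA \<inter> gen SB1 = gen SAB1"
proof -
  have "g \<in> gen SAB1" if "g \<in> gen SA" "g \<in> gen SB1" for g
    using that sect_B1[of g L4] sect_AC1[of "sect g [L4]" L4] sect_sect_A[of g] by simp
  then show ?thesis by (rule Int_eqI[OF _ AB1_sub_A AB1_sub_B1])
qed

lemma Int_AC1: "gen SA \<inter> gen SC1 = gen SAC1"
proof -
  have "g \<in> gen SAC1" if g: "g \<in> gen SA" "g \<in> gen SC1" for g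
  proof -
    have "sect g [L4] \<in> gen SAB1"
      using g sect_C1[of g L4] sect_A[of g L4] Int_AB1 by auto
    then show ?thesis
      using g sect_AB1[of "sect g [L4]" L4] sect_sect_A[of g] by simp
  qed
  then show ?thesis by (rule Int_eqI[OF _ AC1_sub_A AC1_sub_C1])
qed

lemma letters_B:
  assumes "g \<in> gen SB"
  shows "(\<forall>x. on_letter g x = x) \<or> (\<forall>x. on_letter g x = sigma x) \<or>
    (\<forall>x. on_letter g x = pi_perm x) \<or> (\<forall>x. on_letter g x = sigma (pi_perm x))"
proof -
  let ?P = "\<lambda>g. (\<forall>x. on_letter g x = x) \<or> (\<forall>x. on_letter g x = sigma x) \<or>
    (\<forall>x. on_letter g x = pi_perm x) \<or> (\<forall>x. on_letter g x = sigma (pi_perm x))"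
  show "?P g"
    using assms invol_set_frakA[OF SA_frakA(2)]
  proof (induction rule: gen_induct)
    case id
    have "?P id" by simp
    then show ?case .
  next
    case (mult s g)
    have "s \<in> carrier Aut" "g \<in> carrier Aut"
      using mult by auto
    then have "?P (s \<circ> g)"
      using mult(1,3) by (elim insertE emptyE disjE) simp_all
    then show ?case .
  qed
qed

text \<open>All sections of \<open>g\<close> lie in the intersection of \<open>gen SAC\<close> with
  \<open>gen SB\<close>, which is trivial by \<open>not_in_B\<close>. So \<open>g\<close> is
  determined by its action on letters, a member of the Klein four-group generated by
  \<open>sigma\<close> and \<open>pi_perm\<close>.\<close>

lemma Int_BC:
  assumes "g \<in> gen SB" "g \<in> gen SC"
  shows "g \<in> {id, g_alpha, g_a, g_a \<circ> g_alpha}"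
proof -
  obtain t where t: "t \<in> {id, g_alpha, g_a, g_a \<circ> g_alpha}" "\<forall>x. on_letter g x = on_letter t x"
    using letters_B[OF assms(1)]
    by (elim disjE) (rule that[of id] that[of g_alpha] that[of g_a] that[of "g_a \<circ> g_alpha"]; simp)+
  have "sect g [x] = id" for x
    using sect_B[OF assms(1), of x] sect_C[OF assms(2), of x] not_in_B
    by (auto simp: gen_SAC)
  moreover have "sect t [x] = id" for x using t(1) by auto
  moreover have "t \<in> carrier Aut" using t(1) by auto
  ultimately have "g = t" using Aut_eqI[of g t] t(2) six_in_Aut(2)[OF assms(1)] by metis
  with t(1) show ?thesis by simp
qed

text \<open>\<alpha> is central in \<open>gen SA1\<close>; likewise a in \<open>gen SB1\<close> and
  \<gamma> in \<open>gen SC1\<close> below. The last equation lets \<open>w\<close> inherit from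
  \<open>g\<close> the membership in any other group that contains the central generator.\<close>

lemma split_A1:
  assumes "g \<in> gen SA1"
  obtains "g \<in> gen SAA1" | w where "w \<in> gen SAA1" "g = g_alpha \<circ> w" "w = g_alpha \<circ> g"
proof -
  have "g \<in> gen SAA1 \<or> (\<exists>w\<in>gen SAA1. g = g_alpha \<circ> w)"
    using assms by (rule gen_insert_commuting[rotated -1]) (auto simp: frakA_def)
  then show thesis
  proof (elim disjE bexE)
    fix w assume w: "w \<in> gen SAA1" "g = g_alpha \<circ> w"
    then have "w = g_alpha \<circ> g" by (simp add: o_assoc)
    with w show thesis by (rule that(2))
  qed (rule that(1))
qed

lemma split_B1:
  assumes "g \<in> gen SB1"
  obtains "g \<in> gen SAB1" | w where "w \<in> gen SAB1" "g = g_a \<circ> w" "w = g_a \<circ> g"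
proof -
  have eq: "SB1 = insert g_a SAB1" by auto
  have "g \<in> gen SAB1 \<or> (\<exists>w\<in>gen SAB1. g = g_a \<circ> w)"
    using assms unfolding eq
    by (rule gen_insert_commuting[rotated -1]) (auto simp: frakA_def fun_eq_iff b_alpha_a_beta_comm a_c_gamma_comm)
  then show thesis
  proof (elim disjE bexE)
    fix w assume w: "w \<in> gen SAB1" "g = g_a \<circ> w"
    then have "w = g_a \<circ> g" by (simp add: o_assoc)
    with w show thesis by (rule that(2))
  qed (rule that(1))
qed

lemma split_C1:
  assumes "g \<in> gen SC1"
  obtains "g \<in> gen SCC1" | w where "w \<in> gen SCC1" "g = g_gamma \<circ> w" "w = g_gamma \<circ> g"
proof -
  have "g \<in> gen SCC1 \<or> (\<exists>w\<in>gen SCC1. g = g_gamma \<circ> w)"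
    using assms
    by (rule gen_insert_commuting[rotated -1])
      (auto simp: frakA_def fun_eq_iff beta_gamma_b_c_comm gamma_alpha_a_comm)
  then show thesis
  proof (elim disjE bexE)
    fix w assume w: "w \<in> gen SCC1" "g = g_gamma \<circ> w"
    then have "w = g_gamma \<circ> g" by (simp add: o_assoc)
    with w show thesis by (rule that(2))
  qed (rule that(1))
qed

text \<open>The central generator \<alpha> of \<open>gen SA1\<close> lies in \<open>gen SB\<close>
  and can be stripped from \<open>g\<close>. The rest \<open>w\<close> lies in \<open>gen SA\<close>
  as well, and the list of \<open>Int_AB\<close> leaves only id and c. Most of the mixed
  intersections below follow this pattern.\<close>

lemma Int_BA1: "gen SB \<inter> gen SA1 \<subseteq> frakA"
proof clarify
  fix g assume g: "g \<in> gen SB" "g \<in> gen SA1"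
  have *: "w \<in> {id, g_c}" if "w \<in> gen SAA1" "w \<in> gen SB" for w
    using that Int_AB[of w] AA1_sub_A AA1_sub_A1 not_in_A1 by blast
  from g(2) show "g \<in> frakA"
  proof (cases rule: split_A1)
    case 1
    from *[OF 1 g(1)] show ?thesis by (auto simp: frakA_def)
  next
    case (2 w)
    have "w \<in> gen SB" using g(1) 2(3) by (metis gen_comp gen_incl insertI1)
    with *[OF 2(1)] 2(2) show ?thesis by (auto simp: frakA_def)
  qed
qed

lemma Int_BB1: "gen SB \<inter> gen SB1 = gen SBB1"
proof -
  have "g \<in> gen SBB1" if g: "g \<in> gen SB" "g \<in> gen SB1" for g
  proof -
    have *: "w \<in> {id, g_c \<circ> g_gamma}" if "w \<in> gen SAB1" "w \<in> gen SB" for w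
      using that Int_AB[of w] AB1_sub_A AB1_sub_B1 not_in_B1 by blast
    from g(2) show ?thesis
    proof (cases rule: split_B1)
      case 1
      from *[OF 1 g(1)] show ?thesis by (auto simp: gen_incl)
    next
      case (2 w)
      have "w \<in> gen SB" using g(1) 2(3) by (metis gen_comp gen_incl insertI1 insertI2)
      with *[OF 2(1)] 2(2) have "g = g_a \<or> g = g_a \<circ> (g_c \<circ> g_gamma)" by auto
      then show ?thesis by (auto intro: gen_incl gen_incl2)
    qed
  qed
  then show ?thesis by (rule Int_eqI[OF _ BB1_sub_B BB1_sub_B1])
qed

lemma Int_BC1: "gen SB \<inter> gen SC1 \<subseteq> frakA"
proof clarify
  fix g assume g: "g \<in> gen SB" "g \<in> gen SC1"
  have *: "w \<in> {id, g_a \<circ> g_alpha}" if "w \<in> gen SCC1" "w \<in> gen SB" for w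
    using that Int_BC[of w] CC1_sub_C CC1_sub_C1 not_in_C1 by blast
  from g(2) show "g \<in> frakA"
  proof (cases rule: split_C1)
    case 1
    from *[OF 1 g(1)] show ?thesis by (auto simp: frakA_def)
  next
    case (2 w)
    have "w \<in> gen SB" using g(1) 2(3) by (metis gen_comp gen_incl insertI1 insertI2)
    with *[OF 2(1)] 2(2) show ?thesis by (auto simp: frakA_def o_assoc)
  qed
qed

lemma Int_CA1: "gen SC \<inter> gen SA1 = gen SCA1"
proof -
  have "g \<in> gen SCA1" if g: "g \<in> gen SC" "g \<in> gen SA1" for g
  proof -
    have *: "w \<in> {id, g_b}" if "w \<in> gen SAA1" "w \<in> gen SC" for w
      using that Int_AC[of w] AA1_sub_A AA1_sub_A1 not_in_A1 by blast
    from g(2) show ?thesis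
    proof (cases rule: split_A1)
      case 1
      from *[OF 1 g(1)] show ?thesis by (auto simp: gen_incl)
    next
      case (2 w)
      have "w \<in> gen SC" using g(1) 2(3) by (metis gen_comp gen_incl insertI1 insertI2)
      with *[OF 2(1)] 2(2) have "g = g_alpha \<or> g = g_alpha \<circ> g_b" by auto
      then show ?thesis by (auto intro: gen_incl gen_incl2)
    qed
  qed
  then show ?thesis by (rule Int_eqI[OF _ CA1_sub_C CA1_sub_A1])
qed

lemma Int_CB1: "gen SC \<inter> gen SB1 = gen SCB1"
proof -
  have "g \<in> gen SCB1" if g: "g \<in> gen SC" "g \<in> gen SB1" for g
  proof -
    have *: "w \<in> {id, g_beta}" if "w \<in> gen SAB1" "w \<in> gen SC" for w
      using that Int_AC[of w] AB1_sub_A AB1_sub_B1 not_in_B1 by blast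
    from g(2) show ?thesis
    proof (cases rule: split_B1)
      case 1
      from *[OF 1 g(1)] show ?thesis by (auto simp: gen_incl)
    next
      case (2 w)
      have "w \<in> gen SC" using g(1) 2(3) by (metis gen_comp gen_incl insertI1 insertI2)
      with *[OF 2(1)] 2(2) have "g = g_a \<or> g = g_a \<circ> g_beta" by auto
      then show ?thesis by (metis gen_incl gen_incl2 insertI1 insertI2)
    qed
  qed
  then show ?thesis by (rule Int_eqI[OF _ CB1_sub_C CB1_sub_B1])
qed

text \<open>Here the central generator \<gamma> does not lie in \<open>gen SC\<close>, while
  \<open>gen SCC1\<close> does, so the second case of the splitting would put \<gamma> into
  \<open>gen SC\<close>.\<close>

lemma Int_CC1: "gen SC \<inter> gen SC1 = gen SCC1"
proof -
  have "g \<in> gen SCC1" if g: "g \<in> gen SC" "g \<in> gen SC1" for g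
    using g(2)
  proof (cases rule: split_C1)
    case (2 w)
    have "invol_set SC" using SA_frakA(3) by (rule invol_set_frakA)
    moreover have "w \<in> gen SC" using 2(1) CC1_sub_C by blast
    ultimately have "g \<circ> inv\<^bsub>Aut\<^esub> w \<in> gen SC" using g(1) gen_inv gen_comp by blast
    moreover have "g \<circ> inv\<^bsub>Aut\<^esub> w = g_gamma"
      using 2(2) \<open>w \<in> gen SC\<close> by (simp add: comp_assoc)
    ultimately show ?thesis using not_in_C by simp
  qed
  then show ?thesis by (rule Int_eqI[OF _ CC1_sub_C CC1_sub_C1])
qed

text \<open>\<alpha>b is the section at 1 of \<beta>(c\<gamma>), the one element of
  \<open>gen SAB1\<close> that the earlier refutations do not cover.\<close>

lemma alpha_b_not_in: "g_alpha \<circ> g_b \<notin> gen SC1" "g_alpha \<circ> g_b \<notin> gen SB1"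
  using letters_C1[of "g_alpha \<circ> g_b" L1] letters_B1[of "g_alpha \<circ> g_b" L1] by auto

lemma SAB1_trivial:
  assumes "g \<in> gen SAB1" "g \<in> gen SA1 \<or> g \<in> gen SC1"
  shows "g = id"
  using assms not_in_A1 not_in_C1 alpha_b_not_in CC1_sub_C1
    sect_A1[of "g_beta \<circ> (g_c \<circ> g_gamma)" L1] sect_C1[of "g_beta \<circ> (g_c \<circ> g_gamma)" L1]
  by (auto simp: gen_SAB1)

lemma Int_A1B1: "g \<in> gen SA1 \<Longrightarrow> g \<in> gen SB1 \<Longrightarrow> g = id"
  and Int_B1C1: "g \<in> gen SB1 \<Longrightarrow> g \<in> gen SC1 \<Longrightarrow> g = id"
proof -
  have "g = id" if g: "g \<in> gen SB1" "g \<in> gen SA1 \<or> g \<in> gen SC1"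
    using g(1)
  proof (cases rule: split_B1)
    case (2 w)
    have w: "w \<in> gen SA" using 2(1) AB1_sub_A by blast
    have "on_letter g L1 = L3" using 2(2) w letters_A[OF w, of L1] by simp
    then show ?thesis using g(2) letters_A1[of g L1] letters_C1[of g L1] by auto
  qed (use SAB1_trivial g(2) in blast)
  then show "g \<in> gen SA1 \<Longrightarrow> g \<in> gen SB1 \<Longrightarrow> g = id" "g \<in> gen SB1 \<Longrightarrow> g \<in> gen SC1 \<Longrightarrow> g = id"
    by auto
qed

text \<open>If \<open>g\<close> lies in \<open>gen SAA1\<close>, its section at 4 is in
  \<open>gen SAB1\<close> and in \<open>gen SA1\<close>, hence trivial, and the section at 4 of that
  section is \<open>g\<close>. Otherwise \<open>g\<close> moves 1 to 2, which \<open>gen SC1\<close>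
  cannot do.\<close>

lemma Int_A1C1:
  assumes "g \<in> gen SA1" "g \<in> gen SC1"
  shows "g = id"
  using assms(1)
proof (cases rule: split_A1)
  case 1
  then have gA: "g \<in> gen SA" using AA1_sub_A by blast
  then have "g \<in> gen SAC1" using assms(2) Int_AC1 by blast
  then have "sect g [L4] \<in> gen SAB1" using sect_AC1[of g L4] by simp
  moreover have "sect g [L4] \<in> gen SA1"
    using sect_AA1[OF 1, of L4] AA1_sub_A1 by auto
  ultimately have "sect g [L4] = id" using SAB1_trivial by blast
  then show ?thesis using sect_sect_A[OF gA] by simp
next
  case (2 w)
  have w: "w \<in> gen SA" using 2(1) AA1_sub_A by blast
  have "on_letter g L1 = L2" using 2(2) w letters_A[OF w, of L1] by simp
  then show ?thesis using letters_C1[OF assms(2), of L1] by auto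
qed

section \<open>The members of \<G>, up to subsets of \<AA>\<close>

text \<open>Besides the six groups these are seven of the nine intersections of a long with a short
  group. The two remaining ones, and all intersections within one kind, are contained in
  \<open>frakA\<close>.\<close>

definition vertex_gens :: "taut set set" where
  "vertex_gens = {SA, SB, SC, SA1, SB1, SC1, SAA1, SAB1, SAC1, SBB1, SCA1, SCB1, SCC1}"

abbreviation "long_groups \<equiv> {gen SA, gen SB, gen SC}"
abbreviation "short_groups \<equiv> {gen SA1, gen SB1, gen SC1}"

lemma six_groups_iff: "G \<in> six_groups \<longleftrightarrow> G \<in> long_groups \<or> G \<in> short_groups"
  by (auto simp: six_groups_def)

lemma Int_same_type:
  assumes "G \<noteq> H"
    "G \<in> long_groups \<and> H \<in> long_groups \<or>
     G \<in> short_groups \<and> H \<in> short_groups"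
  shows "G \<inter> H \<subseteq> frakA"
proof -
  have "gen SA \<inter> gen SB \<subseteq> frakA" "gen SA \<inter> gen SC \<subseteq> frakA" "gen SB \<inter> gen SC \<subseteq> frakA"
    using Int_AB Int_AC Int_BC unfolding frakA_def by blast+
  moreover have "gen SA1 \<inter> gen SB1 \<subseteq> frakA" "gen SA1 \<inter> gen SC1 \<subseteq> frakA" "gen SB1 \<inter> gen SC1 \<subseteq> frakA"
    using Int_A1B1 Int_A1C1 Int_B1C1 unfolding frakA_def by blast+
  ultimately show ?thesis using assms by (elim disjE conjE insertE emptyE) (simp_all add: Int_commute)
qed

lemma six_groups_vertex_gens: "G \<in> six_groups \<Longrightarrow> G \<in> generate Aut ` vertex_gens"
  unfolding six_groups_iff
  by (elim disjE insertE emptyE; hypsubst; rule imageI; simp add: vertex_gens_def)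

lemma Int_pair:
  assumes "G \<in> six_groups" "H \<in> six_groups"
  shows "G \<inter> H \<subseteq> frakA \<or> G \<inter> H \<in> generate Aut ` vertex_gens"
proof -
  have mixed: "G \<inter> H \<subseteq> frakA \<or> G \<inter> H \<in> generate Aut ` vertex_gens"
    if "G \<in> long_groups" "H \<in> short_groups" for G H
    using that Int_AA1 Int_AB1 Int_AC1 Int_BA1 Int_BB1 Int_BC1 Int_CA1 Int_CB1 Int_CC1
    by (elim insertE emptyE) (simp_all add: vertex_gens_def)
  show ?thesis
  proof (cases "G = H")
    case True
    then show ?thesis using six_groups_vertex_gens[OF assms(1)] by simp
  next
    case False
    then show ?thesis
      using assms Int_same_type[of G H] mixed[of G H] mixed[of H G]
      unfolding six_groups_iff Int_commute[of H G] by argo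
  qed
qed

lemma calG_cases:
  assumes "G \<in> calG"
  shows "G \<subseteq> frakA \<or> G \<in> generate Aut ` vertex_gens"
proof -
  have triple: "G \<inter> H \<inter> K \<subseteq> frakA \<or> G \<inter> H \<inter> K \<in> generate Aut ` vertex_gens"
    if GHK: "G \<in> six_groups" "H \<in> six_groups" "K \<in> six_groups" for G H K
  proof (cases "G = H \<or> H = K \<or> G = K")
    case True
    moreover have "G \<inter> H \<inter> K = G \<inter> K" if "G = H \<or> H = K" using that by blast
    moreover have "G \<inter> H \<inter> K = G \<inter> H" if "G = K" using that by blast
    ultimately show ?thesis using Int_pair GHK by metis
  next
    case False
    \<comment> \<open>Pigeonhole: two of three different groups are both long or both short.\<close>
    then have "G \<inter> H \<subseteq> frakA \<or> H \<inter> K \<subseteq> frakA \<or> G \<inter> K \<subseteq> frakA"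
      using GHK Int_same_type[of G H] Int_same_type[of H K] Int_same_type[of G K]
      unfolding six_groups_iff by argo
    then show ?thesis by blast
  qed
  consider "G \<in> six_groups"
    | H K where "G = H \<inter> K" "H \<in> six_groups" "K \<in> six_groups"
    | H K L where "G = H \<inter> K \<inter> L" "H \<in> six_groups" "K \<in> six_groups" "L \<in> six_groups"
    | "G = {id}"
    using assms unfolding calG_def by blast
  then show ?thesis
  proof cases
    case 1
    then show ?thesis using six_groups_vertex_gens by simp
  next
    case (2 H K)
    then show ?thesis using Int_pair by simp
  next
    case (3 H K L)
    then show ?thesis using triple by simp
  next
    case 4
    then show ?thesis by (simp add: frakA_def)
  qed
qed

section \<open>Factoring through sections in \<open>\<AA>\<close>\<close>

text \<open>For \<open>H = stab \<xi>\<close>, the pairs \<open>(vx, k(vx))\<close> in \<open>tstep H\<close> are the identifications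
  \<open>\<xi> \<otimes> v \<otimes> x = \<kappa>\<^sub>h(\<xi> \<otimes> v) \<otimes> h(x)\<close> with \<open>h = k|\<^sub>v\<close>.\<close>

definition tstep :: "taut set \<Rightarrow> word rel" where
  "tstep H = {(u, k u) | u k. k \<in> H \<and> u \<noteq> [] \<and> sect k (butlast u) \<in> frakA \<and> sect k u = id}"

text \<open>\<open>n\<close> is the level of the prefix, so the words have length
  \<open>n + 1\<close>. The passage from \<open>u\<close> to \<open>k u\<close> is replaced by
  steps, one \<open>l\<close> with the same section as \<open>k\<close> and with prefix section in
  \<open>frakA\<close>, and steps again. The first steps and \<open>l\<close> describe the sets
  \<open>K\<close>. If the section is trivial, \<open>l\<close> is itself a step and the whole chain
  describes the identifications.\<close>

definition factors :: "taut set \<Rightarrow> nat \<Rightarrow> bool" where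
  "factors H n \<longleftrightarrow> (\<forall>u k. length u = Suc n \<longrightarrow> k \<in> H \<longrightarrow> sect k u \<in> frakA \<longrightarrow>
     (\<exists>u' l. (u, u') \<in> (tstep H)\<^sup>* \<and> l \<in> H \<and> sect l (butlast u') \<in> frakA \<and>
        sect l u' = sect k u \<and> (l u', k u) \<in> (tstep H)\<^sup>*))"

lemma factorsD:
  assumes "factors H n" "length u = Suc n" "k \<in> H" "sect k u \<in> frakA"
  obtains u' l where "(u, u') \<in> (tstep H)\<^sup>*" "l \<in> H" "sect l (butlast u') \<in> frakA"
    "sect l u' = sect k u" "(l u', k u) \<in> (tstep H)\<^sup>*"
  using assms unfolding factors_def by blast

lemma tstepI:
  "k \<in> H \<Longrightarrow> u \<noteq> [] \<Longrightarrow> sect k (butlast u) \<in> frakA \<Longrightarrow> sect k u = id \<Longrightarrow> (u, k u) \<in> tstep H"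
  unfolding tstep_def by blast

lemma tstep_length:
  assumes "H \<subseteq> carrier Aut" "(u, u') \<in> (tstep H)\<^sup>*"
  shows "length u' = length u"
  using assms(2)
proof (induction rule: rtrancl_induct)
  case (step v v')
  then obtain k where "k \<in> H" "v' = k v" by (auto simp: tstep_def)
  then show ?case using step(3) assms(1) length_Aut[of k v] by auto
qed simp

lemma id_frakA [simp]: "id \<in> frakA"
  by (simp add: frakA_def)

lemma factors_subset_frakA: "H \<subseteq> frakA \<Longrightarrow> factors H n"
  unfolding factors_def using frakA_sect by blast

text \<open>The prefix has at least one letter here, and \<open>frakA\<close> is closed under
  sections, so \<open>k\<close> itself serves as \<open>l\<close>.\<close>

lemma factors_if_sections:
  assumes "\<And>k x. k \<in> H \<Longrightarrow> k \<in> carrier Aut \<and> sect k [x] \<in> frakA"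
  shows "factors H (Suc n)"
  unfolding factors_def
proof (intro allI impI)
  fix u :: word and k assume "length u = Suc (Suc n)" "k \<in> H"
  then obtain x y w where u: "u = x # y # w" by (auto simp: length_Suc_conv)
  have "sect k (butlast u) = sect (sect k [x]) (butlast (y # w))"
    using assms[OF \<open>k \<in> H\<close>] sect_Cons[of k x "butlast (y # w)"] u by simp
  then have "sect k (butlast u) \<in> frakA"
    using assms[OF \<open>k \<in> H\<close>] frakA_sect by metis
  with \<open>k \<in> H\<close> show "\<exists>u' l. (u, u') \<in> (tstep H)\<^sup>* \<and> l \<in> H \<and> sect l (butlast u') \<in> frakA \<and>
        sect l u' = sect k u \<and> (l u', k u) \<in> (tstep H)\<^sup>*" by blast
qed

text \<open>\<open>W\<close> supplies preimages of the generators of \<open>gen (M x)\<close> that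
  fix \<open>x\<close>, and such preimages can be multiplied.\<close>

lemma wreath_lift:
  assumes wr: "wreath S M" and W: "W \<subseteq> gen S"
    and onto: "\<forall>x. \<forall>m\<in>M x. \<exists>k\<in>W. on_letter k x = x \<and> sect k [x] = m"
    and l: "l \<in> gen (M x)"
  shows "\<exists>k\<in>gen S. on_letter k x = x \<and> sect k [x] = l"
proof -
  let ?P = "\<lambda>l. \<exists>k\<in>gen S. on_letter k x = x \<and> sect k [x] = l"
  have inv: "invol_set (M x)" "invol_set S"
    using wr by (auto simp: wreath_def intro: invol_set_frakA)
  show "?P l"
    using l inv(1)
  proof (induction rule: gen_induct)
    case id
    have "?P id" by (rule bexI[of _ id]) simp_all
    then show ?case .
  next
    case (mult s g)
    obtain k k' where k: "k \<in> gen S" "on_letter k x = x" "sect k [x] = s"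
      and k': "k' \<in> gen S" "on_letter k' x = x" "sect k' [x] = g"
      using mult onto W by blast
    have "?P (s \<circ> g)"
      using k k' gen_in_Aut[OF inv(2)] gen_comp[OF k(1) k'(1)] by (intro bexI[of _ "k \<circ> k'"]) simp_all
    then show ?case .
  qed
qed

lemma tstep_lift:
  assumes wr: "wreath S M" and W: "W \<subseteq> gen S"
    and onto: "\<forall>x. \<forall>m\<in>M x. \<exists>k\<in>W. on_letter k x = x \<and> sect k [x] = m"
    and "(u, u') \<in> (tstep (gen (M x)))\<^sup>*"
  shows "(x # u, x # u') \<in> (tstep (gen S))\<^sup>*"
  using assms(4)
proof (induction rule: rtrancl_induct)
  case (step u u')
  then obtain l where l: "l \<in> gen (M x)" "u \<noteq> []" "sect l (butlast u) \<in> frakA"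
    "sect l u = id" "u' = l u" by (auto simp: tstep_def)
  obtain k where k: "k \<in> gen S" "on_letter k x = x" "sect k [x] = l"
    using wreath_lift[OF wr W onto l(1)] by blast
  have kA: "k \<in> carrier Aut"
    using wr k(1) gen_in_Aut invol_set_frakA by (auto simp: wreath_def)
  have "(x # u, k (x # u)) \<in> tstep (gen S)"
    using k l sect_Cons[OF kA, of x u] sect_Cons[OF kA, of x "butlast u"] by (intro tstepI) simp_all
  then show ?case
    using step(3) k l Aut_Cons[OF kA, of x u] by simp
qed simp

text \<open>Split \<open>k\<close> on \<open>x # w\<close> into its section \<open>?h\<close> at
  \<open>x\<close>, which acts on \<open>w\<close> and is handled one level lower, and a move
  \<open>t\<close> of the first letter with trivial section. All that happens below \<open>x\<close>
  is lifted to the isotropy group of \<open>x\<close>.\<close>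

lemma factors_Suc:
  assumes wr: "wreath S M" and W: "W \<subseteq> gen S"
    and onto: "\<forall>x. \<forall>m\<in>M x. \<exists>k\<in>W. on_letter k x = x \<and> sect k [x] = m"
    and rec: "\<And>x. factors (gen (M x)) n"
  shows "factors (gen S) (Suc n)"
  unfolding factors_def
proof (intro allI impI)
  fix u :: word and k assume u: "length u = Suc (Suc n)" and k: "k \<in> gen S" and A: "sect k u \<in> frakA"
  have inv: "invol_set S" using wr by (auto simp: wreath_def intro: invol_set_frakA)
  obtain x w where w: "u = x # w" "length w = Suc n" using u by (cases u) auto
  let ?h = "sect k [x]"
  have kA: "k \<in> carrier Aut" using gen_in_Aut[OF inv k] .
  have h: "?h \<in> gen (M x)" "sect ?h w = sect k u"
    using wreath_gen(1)[OF wr k] sect_Cons[OF kA, of x w] w by simp_all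
  then obtain w' l where l: "(w, w') \<in> (tstep (gen (M x)))\<^sup>*" "l \<in> gen (M x)"
    "sect l (butlast w') \<in> frakA" "sect l w' = sect k u" "(l w', ?h w) \<in> (tstep (gen (M x)))\<^sup>*"
    using factorsD[OF rec w(2), of ?h] A by metis
  obtain l' where l': "l' \<in> gen S" "on_letter l' x = x" "sect l' [x] = l"
    using wreath_lift[OF wr W onto l(2)] by blast
  obtain t where t: "t \<in> gen S" "on_letter t x = on_letter k x" "sect t [x] = id"
    using wreath_gen(3)[OF wr k] by blast
  note Aut = gen_in_Aut[OF inv l'(1)] gen_in_Aut[OF inv t(1)]
  have M: "gen (M x) \<subseteq> carrier Aut"
    using wr gen_in_Aut[OF invol_set_frakA, of "M x"] unfolding wreath_def by blast
  then have w': "w' \<noteq> []"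
    using tstep_length[OF M l(1)] w(2) by auto
  have "length (?h w) = Suc n" using kA w(2) by simp
  then have hw: "?h w \<noteq> []" by auto
  \<comment> \<open>\<open>?h w\<close> is nonempty, so the prefix still contains \<open>x\<close>,
    where the section of \<open>t\<close> is trivial.\<close>
  have step: "(x # ?h w, t (x # ?h w)) \<in> tstep (gen S)"
    using t hw sect_Cons[OF Aut(2), of x "?h w"] sect_Cons[OF Aut(2), of x "butlast (?h w)"]
    by (intro tstepI) simp_all
  have "t (x # ?h w) = k u"
    using Aut_Cons[OF Aut(2), of x] Aut_Cons[OF kA, of x w] t w by simp
  then have "(l' (x # w'), k u) \<in> (tstep (gen S))\<^sup>*"
    using tstep_lift[OF wr W onto l(5)] step Aut_Cons[OF Aut(1), of x w'] l'
    by (metis id_apply rtrancl.rtrancl_into_rtrancl)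
  moreover have "(u, x # w') \<in> (tstep (gen S))\<^sup>*"
    using tstep_lift[OF wr W onto l(1)] w by simp
  moreover have "sect l' (butlast (x # w')) \<in> frakA"
    using l(3) l' w' sect_Cons[OF Aut(1), of x "butlast w'"] by simp
  moreover have "sect l' (x # w') = sect k u"
    using l(4) l' sect_Cons[OF Aut(1), of x w'] by simp
  ultimately show "\<exists>u' l. (u, u') \<in> (tstep (gen S))\<^sup>* \<and> l \<in> gen S \<and> sect l (butlast u') \<in> frakA \<and>
        sect l u' = sect k u \<and> (l u', k u) \<in> (tstep (gen S))\<^sup>*"
    using l'(1) by blast
qed

text \<open>The prefix of \<open>[x]\<close> is empty and its section is the element itself, so a
  generator that moves the letter is a step because it lies in \<open>frakA\<close>.\<close>

lemma tstep_orbit: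
  assumes wr: "wreath S M" and k: "k \<in> gen S"
  shows "([x], k [x]) \<in> (tstep (gen S))\<^sup>*"
proof -
  have inv: "invol_set S" using wr by (auto simp: wreath_def intro: invol_set_frakA)
  let ?P = "\<lambda>k. ([x], k [x]) \<in> (tstep (gen S))\<^sup>*"
  show "?P k"
    using k inv
  proof (induction rule: gen_induct)
    case id
    have "?P id" by simp
    then show ?case .
  next
    case (mult s k)
    define y where "y = on_letter k x"
    have y: "k [x] = [y]"
      using Aut_single[OF gen_in_Aut[OF inv mult(2)]] by (simp add: y_def)
    have s: "s \<in> frakA" "s \<in> carrier Aut" "on_letter s y = y \<or> sect s [y] = id"
      using wr mult(1) frakA_invol(1) by (auto simp: wreath_def)
    have "([y], s [y]) \<in> (tstep (gen S))\<^sup>*"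
      using s(3)
    proof
      assume "on_letter s y = y"
      then show ?thesis using Aut_single[OF s(2), of y] by simp
    next
      assume "sect s [y] = id"
      then have "([y], s [y]) \<in> tstep (gen S)"
        using s(1) gen_incl[OF mult(1)] by (intro tstepI) simp_all
      then show ?thesis by blast
    qed
    then have "?P (s \<circ> k)" using mult(3) y by simp
    then show ?case .
  qed
qed

text \<open>With an empty prefix \<open>l\<close> itself must be in \<open>frakA\<close>, and such
  elements may realize a given section only at some letters of the orbit; \<open>k'\<close> moves
  \<open>x\<close> to such a letter.\<close>

lemma factors_0:
  assumes wr: "wreath S M" and V: "V \<subseteq> gen S" and N: "N \<subseteq> gen S" "N \<subseteq> frakA"
    and base: "\<forall>x. \<forall>g\<in>gen (M x) \<inter> frakA. \<exists>k\<in>V. \<exists>l\<in>N. sect l [on_letter k x] = g"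
  shows "factors (gen S) 0"
  unfolding factors_def
proof (intro allI impI)
  fix u :: word and k assume u: "length u = Suc 0" and k: "k \<in> gen S" and A: "sect k u \<in> frakA"
  have inv: "invol_set S" using wr by (auto simp: wreath_def intro: invol_set_frakA)
  obtain x where x: "u = [x]" using u by (auto simp: length_Suc_conv)
  obtain k' l where k': "k' \<in> gen S" and l: "l \<in> gen S" "l \<in> frakA"
    "sect l [on_letter k' x] = sect k [x]"
  proof -
    have "sect k [x] \<in> gen (M x) \<inter> frakA"
      using wreath_gen(1)[OF wr k, of x] A x by simp
    with base obtain k' l where "k' \<in> V" "l \<in> N" "sect l [on_letter k' x] = sect k [x]"
      by metis
    then show thesis using that V N by (meson subsetD)
  qed
  note Aut = gen_in_Aut[OF inv k] gen_in_Aut[OF inv k'] gen_in_Aut[OF inv l(1)]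
  \<comment> \<open>Chosen to send \<open>l (k' [x])\<close> to \<open>k [x]\<close>: the two
    letters are in one orbit and \<open>tstep_orbit\<close> joins them.\<close>
  define h where "h = k \<circ> (inv\<^bsub>Aut\<^esub> k' \<circ> inv\<^bsub>Aut\<^esub> l)"
  have h: "h \<in> gen S"
    unfolding h_def using k k' l(1) inv by (intro gen_comp gen_inv)
  have hl: "h (l (k' [x])) = k [x]"
    using Aut by (simp add: h_def)
  have "l (k' [x]) = [on_letter l (on_letter k' x)]"
    using Aut by (simp add: Aut_single)
  then have "(l (k' [x]), k [x]) \<in> (tstep (gen S))\<^sup>*"
    using tstep_orbit[OF wr h, of "on_letter l (on_letter k' x)"] hl by simp
  moreover have "([x], k' [x]) \<in> (tstep (gen S))\<^sup>*"
    using tstep_orbit[OF wr k'] .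
  moreover have "k' [x] = [on_letter k' x]" using Aut by (simp add: Aut_single)
  ultimately show "\<exists>u' l. (u, u') \<in> (tstep (gen S))\<^sup>* \<and> l \<in> gen S \<and> sect l (butlast u') \<in> frakA \<and>
        sect l u' = sect k u \<and> (l u', k u) \<in> (tstep (gen S))\<^sup>*"
    using l x by (intro exI[of _ "k' [x]"] exI[of _ l]) simp
qed

section \<open>Elements of \<AA> in the groups that occur as sections\<close>

lemma gen_SAC_cases: "g \<in> gen SAC \<Longrightarrow> g \<in> {id, g_beta, g_b, g_b \<circ> g_beta}"
  and frakA_Int_CC1: "g \<in> frakA \<Longrightarrow> g \<in> gen SCC1 \<Longrightarrow> g \<in> {id, g_a \<circ> g_alpha, g_b \<circ> g_beta}"
  and frakA_Int_AA1: "g \<in> frakA \<Longrightarrow> g \<in> gen SAA1 \<Longrightarrow> g \<in> {id, g_b, g_c}"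
  and frakA_Int_CA1: "g \<in> frakA \<Longrightarrow> g \<in> gen SCA1 \<Longrightarrow> g \<in> {id, g_alpha, g_b}"
  and frakA_Int_AC1: "g \<in> frakA \<Longrightarrow> g \<in> gen SAC1 \<Longrightarrow> g \<in> {id, g_gamma, g_b \<circ> g_beta}"
  and frakA_Int_CB1: "g \<in> frakA \<Longrightarrow> g \<in> gen SCB1 \<Longrightarrow> g \<in> {id, g_beta, g_a}"
  and frakA_Int_AB1: "g \<in> frakA \<Longrightarrow> g \<in> gen SAB1 \<Longrightarrow> g \<in> {id, g_beta, g_c \<circ> g_gamma}"
  and frakA_Int_BB1: "g \<in> frakA \<Longrightarrow> g \<in> gen SBB1 \<Longrightarrow> g \<in> {id, g_a, g_c \<circ> g_gamma}"
proof -
  show "g \<in> gen SAC \<Longrightarrow> g \<in> {id, g_beta, g_b, g_b \<circ> g_beta}"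
    by (auto simp: gen_SAC)
  show "g \<in> frakA \<Longrightarrow> g \<in> gen SCC1 \<Longrightarrow> g \<in> {id, g_a \<circ> g_alpha, g_b \<circ> g_beta}"
    using frakA_Int_C[of g] subsetD[OF CC1_sub_C, of g] subsetD[OF CC1_sub_C1, of g]
      not_in_C1 by auto
  show "g \<in> frakA \<Longrightarrow> g \<in> gen SAA1 \<Longrightarrow> g \<in> {id, g_b, g_c}"
    using frakA_Int_A[of g] subsetD[OF AA1_sub_A, of g] subsetD[OF AA1_sub_A1, of g]
      not_in_A1 by auto
  show "g \<in> frakA \<Longrightarrow> g \<in> gen SCA1 \<Longrightarrow> g \<in> {id, g_alpha, g_b}"
    using frakA_Int_C[of g] subsetD[OF CA1_sub_C, of g] subsetD[OF CA1_sub_A1, of g]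
      not_in_A1 by auto
  show "g \<in> frakA \<Longrightarrow> g \<in> gen SAC1 \<Longrightarrow> g \<in> {id, g_gamma, g_b \<circ> g_beta}"
    using frakA_Int_A[of g] subsetD[OF AC1_sub_A, of g] subsetD[OF AC1_sub_C1, of g]
      not_in_C1 by auto
  show "g \<in> frakA \<Longrightarrow> g \<in> gen SCB1 \<Longrightarrow> g \<in> {id, g_beta, g_a}"
    using frakA_Int_C[of g] subsetD[OF CB1_sub_C, of g] subsetD[OF CB1_sub_B1, of g]
      not_in_B1 by auto
  show "g \<in> frakA \<Longrightarrow> g \<in> gen SAB1 \<Longrightarrow> g \<in> {id, g_beta, g_c \<circ> g_gamma}"
    using frakA_Int_A[of g] subsetD[OF AB1_sub_A, of g] subsetD[OF AB1_sub_B1, of g]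
      not_in_B1 by auto
  show "g \<in> frakA \<Longrightarrow> g \<in> gen SBB1 \<Longrightarrow> g \<in> {id, g_a, g_c \<circ> g_gamma}"
    using frakA_Int_B[of g] subsetD[OF BB1_sub_B, of g] subsetD[OF BB1_sub_B1, of g]
      not_in_B1 by auto
qed

lemma d_gamma_alpha_c_comm:
  "g_a \<circ> g_alpha \<circ> g_gamma \<circ> (g_alpha \<circ> g_c) = g_alpha \<circ> g_c \<circ> (g_a \<circ> g_alpha \<circ> g_gamma)"
proof
  fix v show "(g_a \<circ> g_alpha \<circ> g_gamma \<circ> (g_alpha \<circ> g_c)) v = (g_alpha \<circ> g_c \<circ> (g_a \<circ> g_alpha \<circ> g_gamma)) v"
    by (cases v rule: g_b.cases) (simp_all add: beta_gamma_comm_b_c)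
qed

lemma gen_SR:
  "gen SR = {id, g_a \<circ> g_alpha \<circ> g_gamma, g_alpha \<circ> g_c,
    g_a \<circ> g_alpha \<circ> g_gamma \<circ> (g_alpha \<circ> g_c)}"
  by (rule gen_commuting_pair) (simp_all only: d_gamma_alpha_c_comm, simp_all add: frakA_def)

lemma frakA_Int_SR:
  assumes "g \<in> frakA" "g \<in> gen SR"
  shows "g \<in> {id, g_a \<circ> g_alpha \<circ> g_gamma, g_alpha \<circ> g_c}"
proof -
  let ?h = "g_a \<circ> g_alpha \<circ> g_gamma \<circ> (g_alpha \<circ> g_c)"
  have "?h \<notin> frakA"
  proof
    assume "?h \<in> frakA"
    moreover have "?h \<in> gen SB" using R_sub_B gen_SR by blast
    ultimately have "?h \<in> {id, g_alpha, g_gamma, g_a, g_c, g_a \<circ> g_alpha, g_c \<circ> g_gamma,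
        g_a \<circ> g_alpha \<circ> g_gamma, g_alpha \<circ> g_c}"
      by (rule frakA_Int_B)
    \<comment> \<open>Of the listed elements only a sends 1 to 3. But \<open>?h\<close> has the
      section b\<beta> at 1, where that of a is trivial, and b\<beta> is nontrivial since its own
      section at 1 is a.\<close>
    moreover have 1: "on_letter ?h L1 = L3" by simp
    ultimately have "?h = g_a" by (elim insertE emptyE) (simp_all only:, simp_all)
    then have "sect ?h [L1] = id" by simp
    then have "g_b \<circ> g_beta = id" by simp
    then have "sect (g_b \<circ> g_beta) [L1] = id" by simp
    then have "g_a = id" by simp
    then have "on_letter g_a L1 = L1" by simp
    then show False by simp
  qed
  with assms show ?thesis unfolding gen_SR by blast
qed

text \<open>\<open>W\<close> provides the isotropy group with sections generating \<open>gen (M x)\<close>; \<open>V\<close> moves letters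
  inside their orbits, so that \<open>N\<close> realizes all of \<open>gen (M x) \<inter> \<AA>\<close>.\<close>

definition section_data :: "taut set \<Rightarrow> (letter \<Rightarrow> taut set) \<Rightarrow> taut set \<Rightarrow> taut set \<Rightarrow> taut set \<Rightarrow> bool" where
  "section_data S M W V N \<longleftrightarrow> W \<subseteq> gen S \<and> V \<subseteq> gen S \<and> N \<subseteq> gen S \<and> N \<subseteq> frakA \<and>
     (\<forall>x. \<forall>m\<in>M x. \<exists>k\<in>W. on_letter k x = x \<and> sect k [x] = m) \<and>
     (\<forall>x. \<forall>g\<in>gen (M x) \<inter> frakA. \<exists>k\<in>V. \<exists>l\<in>N. sect l [on_letter k x] = g)"

text \<open>\<open>R x\<close> is an explicit finite set containing
  \<open>gen (M x) \<inter> frakA\<close>, so that the last condition can be checked element by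
  element.\<close>

lemma section_dataI:
  assumes "W \<subseteq> gen S" "V \<subseteq> gen S" "N \<subseteq> gen S" "N \<subseteq> frakA"
    and "\<forall>x. \<forall>m\<in>M x. \<exists>k\<in>W. on_letter k x = x \<and> sect k [x] = m"
    and "\<And>x g. g \<in> frakA \<Longrightarrow> g \<in> gen (M x) \<Longrightarrow> g \<in> R x"
    and "\<forall>x. \<forall>g\<in>R x. \<exists>k\<in>V. \<exists>l\<in>N. sect l [on_letter k x] = g"
  shows "section_data S M W V N"
  unfolding section_data_def using assms by (meson IntE)

lemma gen_single_frakA:
  "g \<in> gen {g_a \<circ> g_alpha \<circ> g_gamma} \<Longrightarrow> g \<in> {id, g_a \<circ> g_alpha \<circ> g_gamma}"
  "g \<in> gen {g_alpha \<circ> g_c} \<Longrightarrow> g \<in> {id, g_alpha \<circ> g_c}"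
  "g \<in> gen {g_b} \<Longrightarrow> g \<in> {id, g_b}" "g \<in> gen {g_b \<circ> g_beta} \<Longrightarrow> g \<in> {id, g_b \<circ> g_beta}"
  "g \<in> gen {g_a \<circ> g_alpha} \<Longrightarrow> g \<in> {id, g_a \<circ> g_alpha}" "g \<in> gen {g_c} \<Longrightarrow> g \<in> {id, g_c}"
  "g \<in> gen {g_alpha} \<Longrightarrow> g \<in> {id, g_alpha}" "g \<in> gen {g_gamma} \<Longrightarrow> g \<in> {id, g_gamma}"
  by (simp_all add: gen_single frakA_def)

text \<open>\<open>member_simps\<close> flattens products, and after that the trailing factor
  a\<alpha> of the conjugate is torn apart and \<open>gen_comp\<close> no longer applies.\<close>

lemma gen_conjugate:
  "g_a \<circ> g_alpha \<in> gen S \<Longrightarrow> g_b \<circ> g_beta \<in> gen S \<Longrightarrow>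
    g_a \<circ> g_alpha \<circ> g_b \<circ> g_beta \<circ> g_a \<circ> g_alpha \<in> gen S"
  using gen_comp[OF gen_comp, of "g_a \<circ> g_alpha" S "g_b \<circ> g_beta" "g_a \<circ> g_alpha"]
  by (simp add: o_assoc)

lemmas member_simps = gen_conjugate gen_incl gen_incl2 gen_comp frakA_def o_assoc all_letter

section \<open>Realizing sections in each of the thirteen groups\<close>

lemma section_data_A:
  "section_data SA (case_letter SC SC1 SA1 SA)
     {g_beta, g_gamma, g_b, g_c, g_b \<circ> g_beta, g_c \<circ> g_gamma} {id}
     {id, g_beta, g_gamma, g_b, g_c, g_b \<circ> g_beta, g_c \<circ> g_gamma}"
  by (rule section_dataI[where R = "case_letter
      {id, g_alpha, g_beta, g_a, g_b, g_a \<circ> g_alpha, g_b \<circ> g_beta}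
      {id, g_gamma, g_a \<circ> g_alpha, g_b \<circ> g_beta, g_a \<circ> g_alpha \<circ> g_gamma}
      {id, g_alpha, g_b, g_c, g_alpha \<circ> g_c}
      {id, g_beta, g_gamma, g_b, g_c, g_b \<circ> g_beta, g_c \<circ> g_gamma}"];
    (simp add: member_simps; fail)?)
    (use frakA_Int_A frakA_Int_C frakA_Int_A1 frakA_Int_C1 in \<open>simp split: letter.splits\<close>)

text \<open>\<gamma> has the section \<beta> only at 1 and 4; its conjugate \<alpha>\<gamma>\<alpha>
  has it at 2 and 3. For the isotropy groups of 2 and 3 the conjugate enters \<open>W\<close>,
  whereas \<open>N\<close> must stay in \<open>frakA\<close> and \<open>V\<close> moves the letter
  by \<alpha> instead. The conjugates by \<alpha>, a and a\<alpha> in other tables have the same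
  purpose.\<close>

lemma section_data_B:
  "section_data SB (\<lambda>_. SAC)
     {g_gamma, g_c, g_c \<circ> g_gamma, g_alpha \<circ> g_gamma \<circ> g_alpha, g_c \<circ> g_alpha \<circ> g_gamma \<circ> g_alpha}
     {id, g_alpha} {id, g_gamma, g_c, g_c \<circ> g_gamma}"
  by (rule section_dataI[where R = "\<lambda>_. {id, g_beta, g_b, g_b \<circ> g_beta}"];
    (simp add: member_simps; fail)?) (use gen_SAC_cases in simp)

lemma section_data_C:
  "section_data SC (\<lambda>_. SB)
     {g_beta, g_alpha \<circ> g_beta \<circ> g_alpha, g_b, g_a \<circ> g_b \<circ> g_a, g_b \<circ> g_beta,
      g_b \<circ> g_alpha \<circ> g_beta \<circ> g_alpha, g_a \<circ> g_b \<circ> g_a \<circ> g_beta,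
      g_a \<circ> g_b \<circ> g_a \<circ> g_alpha \<circ> g_beta \<circ> g_alpha}
     {id, g_alpha, g_a, g_a \<circ> g_alpha} {id, g_beta, g_b, g_b \<circ> g_beta}"
  by (rule section_dataI[where R = "\<lambda>_. {id, g_alpha, g_gamma, g_a, g_c, g_a \<circ> g_alpha,
      g_c \<circ> g_gamma, g_a \<circ> g_alpha \<circ> g_gamma, g_alpha \<circ> g_c}"];
    (simp add: member_simps; fail)?) (use frakA_Int_B in simp)

lemma section_data_A1:
  "section_data SA1 (case_letter SCC1 SCC1 SAA1 SAA1)
     {g_b, g_c}
     {id} {id, g_b, g_c}"
  by (rule section_dataI[where R = "case_letter
      {id, g_a \<circ> g_alpha, g_b \<circ> g_beta}
      {id, g_a \<circ> g_alpha, g_b \<circ> g_beta}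
      {id, g_b, g_c}
      {id, g_b, g_c}"];
    (simp add: member_simps; fail)?)
    (use frakA_Int_CC1 frakA_Int_AA1 in \<open>simp split: letter.splits\<close>)

lemma section_data_B1:
  "section_data SB1 (case_letter SCA1 SAC1 SCA1 SAC1)
     {g_beta, g_c \<circ> g_gamma}
     {id} {id, g_beta, g_c \<circ> g_gamma}"
  by (rule section_dataI[where R = "case_letter
      {id, g_alpha, g_b}
      {id, g_gamma, g_b \<circ> g_beta}
      {id, g_alpha, g_b}
      {id, g_gamma, g_b \<circ> g_beta}"];
    (simp add: member_simps; fail)?)
    (use frakA_Int_CA1 frakA_Int_AC1 in \<open>simp split: letter.splits\<close>)

lemma section_data_C1:
  "section_data SC1 (case_letter SB1 SR SR SB1)
     {g_gamma, g_b \<circ> g_beta, g_a \<circ> g_alpha \<circ> g_b \<circ> g_beta \<circ> g_a \<circ> g_alpha}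
     {id, g_a \<circ> g_alpha} {id, g_gamma, g_b \<circ> g_beta}"
  by (rule section_dataI[where R = "case_letter
      {id, g_beta, g_a, g_c \<circ> g_gamma}
      {id, g_a \<circ> g_alpha \<circ> g_gamma, g_alpha \<circ> g_c}
      {id, g_a \<circ> g_alpha \<circ> g_gamma, g_alpha \<circ> g_c}
      {id, g_beta, g_a, g_c \<circ> g_gamma}"];
    (simp add: member_simps; fail)?)
    (use frakA_Int_B1 frakA_Int_SR in \<open>simp split: letter.splits\<close>)

lemma section_data_AA1:
  "section_data SAA1 (case_letter SCC1 SCC1 SAA1 SAA1)
     {g_b, g_c}
     {id} {id, g_b, g_c}"
  by (rule section_dataI[where R = "case_letter
      {id, g_a \<circ> g_alpha, g_b \<circ> g_beta}
      {id, g_a \<circ> g_alpha, g_b \<circ> g_beta}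
      {id, g_b, g_c}
      {id, g_b, g_c}"];
    (simp add: member_simps; fail)?)
    (use frakA_Int_CC1 frakA_Int_AA1 in \<open>simp split: letter.splits\<close>)

lemma section_data_AB1:
  "section_data SAB1 (case_letter SCA1 SAC1 SCA1 SAC1)
     {g_beta, g_c \<circ> g_gamma}
     {id} {id, g_beta, g_c \<circ> g_gamma}"
  by (rule section_dataI[where R = "case_letter
      {id, g_alpha, g_b}
      {id, g_gamma, g_b \<circ> g_beta}
      {id, g_alpha, g_b}
      {id, g_gamma, g_b \<circ> g_beta}"];
    (simp add: member_simps; fail)?)
    (use frakA_Int_CA1 frakA_Int_AC1 in \<open>simp split: letter.splits\<close>)

lemma section_data_AC1:
  "section_data SAC1 (case_letter SCB1 {g_a \<circ> g_alpha \<circ> g_gamma} {g_alpha \<circ> g_c} SAB1)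
     {g_gamma, g_b \<circ> g_beta}
     {id} {id, g_gamma, g_b \<circ> g_beta}"
  by (rule section_dataI[where R = "case_letter
      {id, g_beta, g_a}
      {id, g_a \<circ> g_alpha \<circ> g_gamma}
      {id, g_alpha \<circ> g_c}
      {id, g_beta, g_c \<circ> g_gamma}"];
    (simp add: member_simps; fail)?)
    (use frakA_Int_CB1 frakA_Int_AB1 gen_single_frakA in \<open>simp split: letter.splits\<close>)

lemma section_data_BB1:
  "section_data SBB1 (case_letter {g_b} {g_b \<circ> g_beta} {g_b} {g_b \<circ> g_beta})
     {g_c \<circ> g_gamma}
     {id} {id, g_c \<circ> g_gamma}"
  by (rule section_dataI[where R = "case_letter
      {id, g_b}
      {id, g_b \<circ> g_beta}
      {id, g_b}
      {id, g_b \<circ> g_beta}"];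
    (simp add: member_simps; fail)?)
    (use gen_single_frakA in \<open>simp split: letter.splits\<close>)

lemma section_data_CA1:
  "section_data SCA1 (case_letter {g_a \<circ> g_alpha} {g_a \<circ> g_alpha} {g_c} {g_c})
     {g_b}
     {id} {id, g_b}"
  by (rule section_dataI[where R = "case_letter
      {id, g_a \<circ> g_alpha}
      {id, g_a \<circ> g_alpha}
      {id, g_c}
      {id, g_c}"];
    (simp add: member_simps; fail)?)
    (use gen_single_frakA in \<open>simp split: letter.splits\<close>)

lemma section_data_CB1:
  "section_data SCB1 (case_letter {g_alpha} {g_gamma} {g_alpha} {g_gamma})
     {g_beta}
     {id} {id, g_beta}"
  by (rule section_dataI[where R = "case_letter
      {id, g_alpha}
      {id, g_gamma}
      {id, g_alpha}
      {id, g_gamma}"];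
    (simp add: member_simps; fail)?)
    (use gen_single_frakA in \<open>simp split: letter.splits\<close>)

lemma section_data_CC1:
  "section_data SCC1 (case_letter SBB1 SR SR SBB1)
     {g_b \<circ> g_beta, g_a \<circ> g_alpha \<circ> g_b \<circ> g_beta \<circ> g_a \<circ> g_alpha}
     {id, g_a \<circ> g_alpha} {id, g_b \<circ> g_beta}"
  by (rule section_dataI[where R = "case_letter
      {id, g_a, g_c \<circ> g_gamma}
      {id, g_a \<circ> g_alpha \<circ> g_gamma, g_alpha \<circ> g_c}
      {id, g_a \<circ> g_alpha \<circ> g_gamma, g_alpha \<circ> g_c}
      {id, g_a, g_c \<circ> g_gamma}"];
    (simp add: member_simps; fail)?)
    (use frakA_Int_BB1 frakA_Int_SR in \<open>simp split: letter.splits\<close>)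

definition vertex_table :: "taut set \<Rightarrow> (letter \<Rightarrow> taut set) \<Rightarrow> bool" where
  "vertex_table S M \<longleftrightarrow> wreath S M \<and> (\<exists>W V N. section_data S M W V N)"

text \<open>The list is closed under passing to sections, except for \<open>SR\<close> and for
  groups inside \<open>frakA\<close>. This closure keeps the induction on the length of the word
  within finitely many groups.\<close>

lemma vertex_gens_table:
  assumes "S \<in> vertex_gens"
  obtains M where "vertex_table S M" "\<And>x. M x \<in> insert SR vertex_gens \<or> gen (M x) \<subseteq> frakA"
proof -
  note [simp] = vertex_gens_def all_letter gen_single gen_SAC frakA_def
  have tab: "vertex_table SA (case_letter SC SC1 SA1 SA)" "vertex_table SB (\<lambda>_. SAC)"
    "vertex_table SC (\<lambda>_. SB)"
    "vertex_table SA1 (case_letter SCC1 SCC1 SAA1 SAA1)"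
    "vertex_table SB1 (case_letter SCA1 SAC1 SCA1 SAC1)"
    "vertex_table SC1 (case_letter SB1 SR SR SB1)"
    "vertex_table SAA1 (case_letter SCC1 SCC1 SAA1 SAA1)"
    "vertex_table SAB1 (case_letter SCA1 SAC1 SCA1 SAC1)"
    "vertex_table SAC1 (case_letter SCB1 {g_a \<circ> g_alpha \<circ> g_gamma} {g_alpha \<circ> g_c} SAB1)"
    "vertex_table SBB1 (case_letter {g_b} {g_b \<circ> g_beta} {g_b} {g_b \<circ> g_beta})"
    "vertex_table SCA1 (case_letter {g_a \<circ> g_alpha} {g_a \<circ> g_alpha} {g_c} {g_c})"
    "vertex_table SCB1 (case_letter {g_alpha} {g_gamma} {g_alpha} {g_gamma})"
    "vertex_table SCC1 (case_letter SBB1 SR SR SBB1)"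
    unfolding vertex_table_def
    using wreath_A section_data_A wreath_B section_data_B wreath_C section_data_C
      wreath_A1 section_data_A1
      wreath_B1 section_data_B1
      wreath_C1 section_data_C1
      wreath_AA1 section_data_AA1
      wreath_AB1 section_data_AB1
      wreath_AC1 section_data_AC1
      wreath_BB1 section_data_BB1
      wreath_CA1 section_data_CA1
      wreath_CB1 section_data_CB1
      wreath_CC1 section_data_CC1
    by blast+
  show ?thesis
    using assms unfolding vertex_gens_def
    by (elim insertE emptyE) (rule that, erule ssubst, rule tab, simp split: letter.splits)+
qed

text \<open>\<open>SR\<close> does not fit \<open>wreath\<close>, since a\<alpha>\<gamma> moves 1
  with the nontrivial section \<beta>. But the group has four elements and its sections lie in
  \<open>gen SAC\<close>, hence in \<open>frakA\<close>, so only words of length one need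
  work.\<close>

lemma factors_SR: "factors (gen SR) n"
proof (cases n)
  case (Suc m)
  have SR: "SR \<subseteq> frakA" by (simp add: frakA_def)
  have "k \<in> carrier Aut \<and> sect k [x] \<in> frakA" if k: "k \<in> gen SR" for k x
  proof
    show "k \<in> carrier Aut" using gen_in_Aut[OF invol_set_frakA[OF SR] k] .
    have "k \<in> gen SB" using k R_sub_B by blast
    then have "sect k [x] \<in> gen SAC" by (rule sect_B)
    then show "sect k [x] \<in> frakA" by (auto simp: gen_SAC frakA_def)
  qed
  then show ?thesis unfolding Suc by (rule factors_if_sections)
next
  case 0
  let ?s = "g_a \<circ> g_alpha \<circ> g_gamma" and ?t = "g_alpha \<circ> g_c"
  let ?Q = "\<lambda>u k. \<exists>u' l. (u, u') \<in> (tstep (gen SR))\<^sup>* \<and> l \<in> gen SR \<and> sect l (butlast u') \<in> frakA \<and>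
        sect l u' = sect k u \<and> (l u', k u) \<in> (tstep (gen SR))\<^sup>*"
  have st: "?s \<in> gen SR" "?t \<in> gen SR" "?s \<in> frakA" "?t \<in> frakA"
    by (simp_all add: gen_incl frakA_def)
  have step: "([L2], [L3]) \<in> tstep (gen SR)" "([L3], [L2]) \<in> tstep (gen SR)"
    using tstepI[of ?s "gen SR" "[L2]"] tstepI[of ?s "gen SR" "[L3]"] st by simp_all
  have "?Q [x] k" if k: "k \<in> gen SR" for x k
  proof (cases "k \<in> frakA")
    case True
    with k show ?thesis by (intro exI[of _ "[x]"] exI[of _ k]) simp
  next
    case False
    then have k: "k = ?s \<circ> ?t" using k st unfolding gen_SR by auto
    \<comment> \<open>a\<alpha>\<gamma> exchanges 2 and 3 with trivial sections, so these two
      letters are joined by steps. After this exchange \<alpha>c has at \<open>y\<close> the section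
      that the product has at \<open>x\<close>.\<close>
    define y where "y = (case x of L1 \<Rightarrow> L1 | L2 \<Rightarrow> L3 | L3 \<Rightarrow> L2 | L4 \<Rightarrow> L4)"
    have 1: "([x], [y]) \<in> (tstep (gen SR))\<^sup>*"
      unfolding y_def using step by (cases x) auto
    have 2: "sect ?t [y] = sect k [x]"
      unfolding k y_def by (cases x) (simp_all add: o_assoc)
    have 3: "(?t [y], k [x]) \<in> (tstep (gen SR))\<^sup>*"
      unfolding k y_def using step by (cases x) auto
    show ?thesis using 1 2 3 st by (intro exI[of _ "[y]"] exI[of _ ?t]) simp
  qed
  then show ?thesis unfolding factors_def 0 by (auto simp: length_Suc_conv)
qed

theorem factors_vertex_gens: "S \<in> insert SR vertex_gens \<Longrightarrow> factors (gen S) n"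
proof (induction n arbitrary: S)
  case 0
  show ?case
  proof (cases "S = SR")
    case False
    with "0.prems" have "S \<in> vertex_gens" by blast
    then obtain M where M: "vertex_table S M" by (rule vertex_gens_table)
    then obtain W V N where "section_data S M W V N" by (auto simp: vertex_table_def)
    with M show ?thesis
      unfolding vertex_table_def section_data_def by (metis factors_0)
  qed (simp only: factors_SR)
next
  case (Suc n)
  show ?case
  proof (cases "S = SR")
    case False
    with Suc.prems have "S \<in> vertex_gens" by blast
    from vertex_gens_table[OF this] obtain M where M: "vertex_table S M"
      "\<And>x. M x \<in> insert SR vertex_gens \<or> gen (M x) \<subseteq> frakA" by blast
    have "factors (gen (M x)) n" for x
      using M(2)[of x] Suc.IH factors_subset_frakA by blast
    moreover obtain W V N where "section_data S M W V N" using M(1) by (auto simp: vertex_table_def)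
    ultimately show ?thesis
      using M(1) unfolding vertex_table_def section_data_def by (metis factors_Suc)
  qed (simp only: factors_SR)
qed

corollary factors_calG:
  assumes "G \<in> calG"
  shows "factors G n"
  using calG_cases[OF assms]
proof (elim disjE imageE)
  fix S assume "G = gen S" "S \<in> vertex_gens"
  then show ?thesis using factors_vertex_gens[OF insertI2] by simp
qed (rule factors_subset_frakA)

section \<open>The group \<open>\<Gamma>\<close> and the coset complex\<close>

lemma Gam_gens_frakA: "{g_alpha, g_a, g_beta, g_b, g_gamma, g_c} \<subseteq> frakA"
  by (simp add: frakA_def)

lemma Gam_subgroup: "subgroup Gam Aut"
  unfolding Gam_def using gen_subgroup[OF invol_set_frakA[OF Gam_gens_frakA]] .

lemma Gam_in_Aut [simp]: "g \<in> Gam \<Longrightarrow> g \<in> carrier Aut"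
  using subgroup.mem_carrier[OF Gam_subgroup] .

lemma Gam_id [simp]: "id \<in> Gam"
  by (simp add: Gam_def)

lemma Gam_comp: "g \<in> Gam \<Longrightarrow> h \<in> Gam \<Longrightarrow> g \<circ> h \<in> Gam"
  unfolding Gam_def by (rule gen_comp)

lemma Gam_inv: "g \<in> Gam \<Longrightarrow> inv\<^bsub>Aut\<^esub> g \<in> Gam"
  unfolding Gam_def by (rule gen_inv[OF invol_set_frakA[OF Gam_gens_frakA]])

lemma frakA_Gam: "frakA \<subseteq> Gam"
  unfolding Gam_def frakA_def by (simp add: gen_comp gen_incl)

lemma sect_letter_Gam:
  assumes "g \<in> Gam"
  shows "sect g [x] \<in> Gam"
  using assms invol_set_frakA[OF Gam_gens_frakA] unfolding Gam_def
proof (induction arbitrary: x rule: gen_induct)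
  case id
  have "sect id [x] \<in> gen {g_alpha, g_a, g_beta, g_b, g_gamma, g_c}" by simp
  then show ?case .
next
  case (mult s g)
  have sg: "s \<in> carrier Aut" "g \<in> carrier Aut"
    using mult(1,2) Gam_in_Aut[of g] unfolding Gam_def by auto
  have "sect s [y] \<in> frakA" for y
    using mult(1) Gam_gens_frakA by (intro frakA_sect_letter) blast
  then have "sect s [y] \<in> gen {g_alpha, g_a, g_beta, g_b, g_gamma, g_c}" for y
    using frakA_Gam unfolding Gam_def by blast
  with mult(3)[of x] have "sect (s \<circ> g) [x] \<in> gen {g_alpha, g_a, g_beta, g_b, g_gamma, g_c}"
    using sg by (simp add: gen_comp)
  then show ?case .
qed

lemma sect_Gam: "g \<in> Gam \<Longrightarrow> sect g v \<in> Gam"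
proof (induction v rule: rev_induct)
  case (snoc x v)
  then show ?case using sect_letter_Gam[of "sect g v" x] by (simp add: sect_append)
qed simp

lemma six_groups_subgroup:
  assumes "G \<in> six_groups"
  shows "subgroup G Aut" "G \<subseteq> Gam"
proof -
  obtain S where S: "S \<in> vertex_gens" "G = gen S"
    using six_groups_vertex_gens[OF assms] by blast
  then have "S \<subseteq> frakA" unfolding vertex_gens_def frakA_def by auto
  then show "subgroup G Aut" "G \<subseteq> Gam"
    using gen_subgroup[OF invol_set_frakA] gen_least[OF Gam_subgroup] frakA_Gam S(2) by blast+
qed

lemma calG_consider:
  assumes "G \<in> calG"
  obtains "G \<in> six_groups"
    | H K where "G = H \<inter> K" "H \<in> six_groups" "K \<in> six_groups"
    | H K L where "G = H \<inter> K \<inter> L" "H \<in> six_groups" "K \<in> six_groups" "L \<in> six_groups"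
    | "G = {id}"
  using assms unfolding calG_def by blast

lemma calG_subgroup:
  assumes "G \<in> calG"
  shows "subgroup G Aut" "G \<subseteq> Gam"
proof -
  have triv: "subgroup {id} Aut" using Aut.triv_subgroup by simp
  have int: "subgroup (H \<inter> K) Aut" if "subgroup H Aut" "subgroup K Aut" for H K
    using that Aut.subgroups_Inter_pair by blast
  show "subgroup G Aut" "G \<subseteq> Gam"
    using assms by (cases rule: calG_consider; use six_groups_subgroup triv int in auto)+
qed

section \<open>Right translations of cosets and stabilizers of points\<close>

lemma coset_image: "S #>\<^bsub>Aut\<^esub> g = (\<lambda>s. s \<circ> g) ` S"
  by (auto simp: r_coset_def)

lemma coset_coset: "S #>\<^bsub>Aut\<^esub> g #>\<^bsub>Aut\<^esub> h = S #>\<^bsub>Aut\<^esub> (g \<circ> h)"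
  by (simp add: coset_image image_image comp_assoc)

lemma coset_id [simp]: "S #>\<^bsub>Aut\<^esub> id = S"
  by (simp add: coset_image)

lemma coset_inv_cancel [simp]:
  assumes "g \<in> carrier Aut"
  shows "S #>\<^bsub>Aut\<^esub> g #>\<^bsub>Aut\<^esub> inv\<^bsub>Aut\<^esub> g = S" "S #>\<^bsub>Aut\<^esub> inv\<^bsub>Aut\<^esub> g #>\<^bsub>Aut\<^esub> g = S"
  using assms by (simp_all add: coset_coset)

lemma Xi_act_comp:
  assumes "g \<in> carrier Aut" "h \<in> carrier Aut"
  shows "Xi_act (Xi_act \<xi> g) h = Xi_act \<xi> (g \<circ> h)"
  using assms by (simp add: Xi_act_def coset_coset Aut_inv_mult)

lemma Xi_act_id [simp]: "Xi_act \<xi> id = \<xi>"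
  using Aut.inv_one by (simp add: Xi_act_def)

lemma realization_support:
  assumes "\<xi> \<in> realization P"
  shows "{S. \<xi> S \<noteq> 0} \<in> fin_chains P" "\<xi> \<in> simplex_on {S. \<xi> S \<noteq> 0}"
proof -
  obtain C where C: "finite C" "C \<subseteq> P" "chain_subset C" "\<xi> \<in> simplex_on C"
    using assms unfolding realization_def fin_chains_def by blast
  then have sub: "{S. \<xi> S \<noteq> 0} \<subseteq> C" and sum: "sum \<xi> C = 1" and pos: "\<forall>S. 0 \<le> \<xi> S"
    by (auto simp: simplex_on_def)
  have "sum \<xi> {S. \<xi> S \<noteq> 0} = 1"
    using sum sum.mono_neutral_left[OF C(1) sub, of \<xi>] by auto
  moreover from this have "{S. \<xi> S \<noteq> 0} \<noteq> {}" by (metis sum.empty zero_neq_one)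
  ultimately show "\<xi> \<in> simplex_on {S. \<xi> S \<noteq> 0}" and "{S. \<xi> S \<noteq> 0} \<in> fin_chains P"
    using C sub pos finite_subset[OF sub C(1)]
    by (auto simp: simplex_on_def fin_chains_def chain_subset_def)
qed

definition stab :: "(taut set \<Rightarrow> real) \<Rightarrow> taut set" where
  "stab \<xi> = \<Inter>{S. \<xi> S \<noteq> 0}"

lemma fin_chain_Inter:
  assumes "C \<in> fin_chains P"
  shows "\<Inter>C \<in> C"
proof -
  have "finite C" "C \<noteq> {}" "chain_subset C" using assms by (auto simp: fin_chains_def)
  then show ?thesis
  proof (induction rule: finite_ne_induct)
    case (insert S C)
    then have "\<Inter>C \<in> C" by (auto simp: chain_subset_def)
    moreover have "S \<subseteq> \<Inter>C \<or> \<Inter>C \<subseteq> S"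
      using \<open>\<Inter>C \<in> C\<close> insert.prems by (auto simp: chain_subset_def)
    ultimately show ?case by (auto simp: Int_absorb1 Int_absorb2)
  qed simp
qed

lemma stab_calG:
  assumes "\<xi> \<in> T0"
  shows "stab \<xi> \<in> calG"
proof -
  have supp: "{S. \<xi> S \<noteq> 0} \<in> fin_chains calG"
    using realization_support(1)[of \<xi> calG] assms by (simp add: T0_def)
  then have "{S. \<xi> S \<noteq> 0} \<subseteq> calG" unfolding fin_chains_def by simp
  with fin_chain_Inter[OF supp] show ?thesis unfolding stab_def by blast
qed

lemma stab_Gam: "\<xi> \<in> T0 \<Longrightarrow> k \<in> stab \<xi> \<Longrightarrow> k \<in> Gam"
  using calG_subgroup(2)[OF stab_calG] by blast

lemma calG_coset:
  assumes "G \<in> calG" "g \<in> G"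
  shows "G #>\<^bsub>Aut\<^esub> g = G" "G #>\<^bsub>Aut\<^esub> inv\<^bsub>Aut\<^esub> g = G"
proof -
  have G: "subgroup G Aut" using calG_subgroup(1)[OF assms(1)] .
  have "g \<in> carrier Aut" using subgroup.mem_carrier[OF G assms(2)] .
  then show 1: "G #>\<^bsub>Aut\<^esub> g = G" using Aut.coset_join2 G assms(2) by blast
  show "G #>\<^bsub>Aut\<^esub> inv\<^bsub>Aut\<^esub> g = G"
    using coset_inv_cancel(1)[OF \<open>g \<in> carrier Aut\<close>, of G] by (simp add: 1)
qed

lemma calG_id: "G \<in> calG \<Longrightarrow> id \<in> G"
  using subgroup.one_closed[OF calG_subgroup(1)] by simp

lemma calG_cosetD:
  assumes "G #>\<^bsub>Aut\<^esub> inv\<^bsub>Aut\<^esub> g \<in> calG" "g \<in> carrier Aut"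
  shows "g \<in> G"
proof -
  obtain s where s: "s \<in> G" "id = s \<circ> inv\<^bsub>Aut\<^esub> g"
    using calG_id[OF assms(1)] by (auto simp: coset_image)
  then have "g = (s \<circ> inv\<^bsub>Aut\<^esub> g) \<circ> g" by simp
  also have "\<dots> = s" using assms(2) by (simp add: comp_assoc)
  finally show ?thesis using s(1) by simp
qed

lemma calG_support: "\<xi> \<in> T0 \<Longrightarrow> \<xi> S \<noteq> 0 \<Longrightarrow> S \<in> calG"
  using realization_support(1)[of \<xi> calG] by (auto simp: T0_def fin_chains_def)

lemma Xi_act_stab:
  assumes "\<And>S. \<xi> S \<noteq> 0 \<Longrightarrow> S \<in> calG \<and> g \<in> S" "g \<in> carrier Aut"
  shows "Xi_act \<xi> g = \<xi>"
proof
  fix S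
  show "Xi_act \<xi> g S = \<xi> S"
  proof (cases "\<xi> S = 0 \<and> \<xi> (S #>\<^bsub>Aut\<^esub> inv\<^bsub>Aut\<^esub> g) = 0")
    case False
    then consider "\<xi> S \<noteq> 0" | "\<xi> (S #>\<^bsub>Aut\<^esub> inv\<^bsub>Aut\<^esub> g) \<noteq> 0" by blast
    then have "S #>\<^bsub>Aut\<^esub> inv\<^bsub>Aut\<^esub> g = S"
    proof cases
      case 1
      then show ?thesis using assms calG_coset by blast
    next
      case 2
      then have "S #>\<^bsub>Aut\<^esub> inv\<^bsub>Aut\<^esub> g #>\<^bsub>Aut\<^esub> g = S #>\<^bsub>Aut\<^esub> inv\<^bsub>Aut\<^esub> g"
        using assms calG_coset(1) by blast
      then show ?thesis using assms(2) by simp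
    qed
    then show ?thesis by (simp add: Xi_act_def)
  qed (simp add: Xi_act_def)
qed

text \<open>\<open>T0\<close> is a strict fundamental domain: its vertices contain \<open>\<epsilon>\<close>, so a translation
  sending one of them into \<open>T0\<close> belongs to it.\<close>

lemma T0_act:
  assumes \<xi>: "\<xi> \<in> T0" and \<eta>: "\<eta> \<in> T0" and g: "g \<in> carrier Aut" and eq: "\<xi> = Xi_act \<eta> g"
  shows "\<xi> = \<eta>" "g \<in> stab \<xi>"
proof -
  have 1: "S \<in> calG \<and> g \<in> S" if "\<xi> S \<noteq> 0" for S
  proof -
    have "\<eta> (S #>\<^bsub>Aut\<^esub> inv\<^bsub>Aut\<^esub> g) \<noteq> 0" using that eq by (simp add: Xi_act_def)
    then show ?thesis using calG_support[OF \<eta>] calG_cosetD g calG_support[OF \<xi> that] by blast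
  qed
  then show "g \<in> stab \<xi>" by (auto simp: stab_def)
  have "\<xi> = Xi_act \<xi> (inv\<^bsub>Aut\<^esub> g)"
  proof (rule Xi_act_stab[symmetric])
    show "S \<in> calG \<and> inv\<^bsub>Aut\<^esub> g \<in> S" if "\<xi> S \<noteq> 0" for S
      using 1[OF that] calG_subgroup(1)[of S] subgroup.m_inv_closed[of S Aut g] by simp
  qed (use g in simp)
  also have "\<dots> = \<eta>" using g eq by (simp add: Xi_act_comp)
  finally show "\<xi> = \<eta>" .
qed

lemma T0_stab:
  assumes "\<xi> \<in> T0" "g \<in> stab \<xi>"
  shows "Xi_act \<xi> g = \<xi>"
proof (rule Xi_act_stab)
  show "S \<in> calG \<and> g \<in> S" if "\<xi> S \<noteq> 0" for S
    using assms(2) calG_support[OF assms(1) that] that by (auto simp: stab_def)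
  show "g \<in> carrier Aut" using assms stab_Gam Gam_in_Aut by blast
qed

lemma calG_coset_poset: "calG \<subseteq> coset_poset"
  unfolding coset_poset_def using coset_id Gam_id by blast

lemma fin_chains_mono: "P \<subseteq> Q \<Longrightarrow> fin_chains P \<subseteq> fin_chains Q"
  by (auto simp: fin_chains_def)

lemma T0_Xi: "\<xi> \<in> T0 \<Longrightarrow> \<xi> \<in> Xi"
  unfolding T0_def Xi_def realization_def using fin_chains_mono[OF calG_coset_poset] by blast

section \<open>Tensor products\<close>

lemma bim_left_comp:
  "g \<in> carrier Aut \<Longrightarrow> h \<in> carrier Aut \<Longrightarrow> bim_left (g \<circ> h) m = bim_left g (bim_left h m)"
  by (cases m) (simp add: sect_comp o_assoc)

lemma bim_left_id [simp]: "bim_left id m = m"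
  by (cases m) simp

lemma bim_left_bimod: "g \<in> Gam \<Longrightarrow> m \<in> bimod n \<Longrightarrow> bim_left g m \<in> bimod n"
  by (cases m) (auto simp: bimod_def Gam_comp sect_Gam)

lemma bim_right_bimod: "g \<in> Gam \<Longrightarrow> m \<in> bimod n \<Longrightarrow> bim_right m g \<in> bimod n"
  by (cases m) (auto simp: bimod_def Gam_comp)

lemma bim_left_right: "bim_left g (bim_right m h) = bim_right (bim_left g m) h"
  by (cases m) (simp add: o_assoc)

definition tens_eq :: "(taut set \<Rightarrow> real) \<times> word \<times> taut \<Rightarrow> (taut set \<Rightarrow> real) \<times> word \<times> taut \<Rightarrow> bool" where
  "tens_eq p q \<longleftrightarrow> (\<exists>g\<in>Gam. fst p = Xi_act (fst q) g \<and> snd q = bim_left g (snd p))"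

lemma tens_eq_refl: "tens_eq p p"
  unfolding tens_eq_def by (intro bexI[of _ id]) simp_all

lemma tens_eq_sym: "tens_eq p q \<Longrightarrow> tens_eq q p"
proof -
  assume "tens_eq p q"
  then obtain g where "g \<in> Gam" "fst p = Xi_act (fst q) g" "snd q = bim_left g (snd p)"
    by (auto simp: tens_eq_def)
  then show ?thesis
    unfolding tens_eq_def
    by (intro bexI[of _ "inv\<^bsub>Aut\<^esub> g"]) (simp_all add: Xi_act_comp bim_left_comp[symmetric] Gam_inv)
qed

lemma tens_eq_trans: "tens_eq p q \<Longrightarrow> tens_eq q r \<Longrightarrow> tens_eq p r"
proof -
  assume "tens_eq p q" "tens_eq q r"
  then obtain g h where "g \<in> Gam" "fst p = Xi_act (fst q) g" "snd q = bim_left g (snd p)"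
    "h \<in> Gam" "fst q = Xi_act (fst r) h" "snd r = bim_left h (snd q)"
    by (auto simp: tens_eq_def)
  then show ?thesis
    unfolding tens_eq_def
    by (intro bexI[of _ "h \<circ> g"]) (simp_all add: Xi_act_comp bim_left_comp Gam_comp)
qed

text \<open>Since \<Gamma> is a group acting on both factors, relating pairs by a single
  \<open>g\<close> is already symmetric and transitive, and no chains are needed.\<close>

lemma tens_rel_iff:
  "(p, q) \<in> tens_rel n \<longleftrightarrow> p \<in> Xi \<times> bimod n \<and> q \<in> Xi \<times> bimod n \<and> tens_eq p q"
proof -
  let ?R = "{((Xi_act \<xi> g, m), (\<xi>, bim_left g m)) | \<xi> g m. \<xi> \<in> Xi \<and> g \<in> Gam \<and> m \<in> bimod n}"
  have R: "tens_eq p q" if "(p, q) \<in> ?R" for p q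
    using that by (auto simp: tens_eq_def)
  have "tens_eq p q" if "(p, q) \<in> (?R \<union> ?R\<inverse>)\<^sup>*"
    using that
  proof (induction rule: rtrancl_induct)
    case (step q r)
    then have "tens_eq q r" using R tens_eq_sym by blast
    with step show ?case using tens_eq_trans by blast
  qed (rule tens_eq_refl)
  moreover have "(p, q) \<in> ?R" if "p \<in> Xi \<times> bimod n" "q \<in> Xi \<times> bimod n" "tens_eq p q"
  proof -
    obtain \<xi> m \<eta> m' where pq: "p = (\<xi>, m)" "q = (\<eta>, m')" by (cases p, cases q) blast
    with that(3) obtain g where "g \<in> Gam" "\<xi> = Xi_act \<eta> g" "m' = bim_left g m"
      by (auto simp: tens_eq_def)
    with that pq show ?thesis by blast
  qed
  ultimately show ?thesis
    unfolding tens_rel_def equiv_gen_def by blast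
qed

lemma equiv_tens_rel: "equiv (Xi \<times> bimod n) (tens_rel n)"
  unfolding tens_rel_def by (rule equiv_equiv_gen)

lemma tensor_eq_iff:
  assumes "\<xi> \<in> Xi" "m \<in> bimod n" "\<eta> \<in> Xi" "m' \<in> bimod n"
  shows "tensor n \<xi> m = tensor n \<eta> m' \<longleftrightarrow> (\<exists>g\<in>Gam. \<xi> = Xi_act \<eta> g \<and> m' = bim_left g m)"
proof -
  have "tensor n \<xi> m = tensor n \<eta> m' \<longleftrightarrow> ((\<xi>, m), (\<eta>, m')) \<in> tens_rel n"
    unfolding tensor_def using assms by (intro eq_equiv_class_iff[OF equiv_tens_rel]) auto
  then show ?thesis using assms by (simp add: tens_rel_iff tens_eq_def)
qed

lemma UN_tensor:
  assumes "\<xi> \<in> Xi" "m \<in> bimod n"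
    and "\<And>\<eta> m'. \<eta> \<in> Xi \<Longrightarrow> m' \<in> bimod n \<Longrightarrow> tensor n \<eta> m' = tensor n \<xi> m \<Longrightarrow> f \<eta> m' = f \<xi> m"
  shows "(\<Union>(\<eta>, m')\<in>tensor n \<xi> m. f \<eta> m') = f \<xi> m"
proof -
  have "(\<xi>, m) \<in> tensor n \<xi> m"
    unfolding tensor_def using assms(1,2) by (simp add: tens_rel_iff tens_eq_refl)
  moreover have "f \<eta> m' = f \<xi> m" if "(\<eta>, m') \<in> tensor n \<xi> m" for \<eta> m'
  proof -
    have "((\<xi>, m), (\<eta>, m')) \<in> tens_rel n" using that by (simp add: tensor_def)
    moreover from this have "tensor n \<xi> m = tensor n \<eta> m'"
      unfolding tensor_def by (rule equiv_class_eq[OF equiv_tens_rel])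
    ultimately show ?thesis using assms(3)[of \<eta> m'] by (simp add: tens_rel_iff)
  qed
  ultimately show ?thesis by fast
qed

lemma tens_act_tensor:
  assumes "\<xi> \<in> Xi" "m \<in> bimod n" "g \<in> Gam"
  shows "tens_act n (tensor n \<xi> m) g = tensor n \<xi> (bim_right m g)"
  unfolding tens_act_def
proof (rule UN_tensor[OF assms(1,2)])
  fix \<eta> m' assume m': "\<eta> \<in> Xi" "m' \<in> bimod n" "tensor n \<eta> m' = tensor n \<xi> m"
  then obtain h where "h \<in> Gam" "\<eta> = Xi_act \<xi> h" "m = bim_left h m'"
    using tensor_eq_iff[OF m'(1,2) assms(1,2)] by blast
  then show "tensor n \<eta> (bim_right m' g) = tensor n \<xi> (bim_right m g)"
    using m' assms tensor_eq_iff[OF m'(1) bim_right_bimod assms(1) bim_right_bimod]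
    by (simp add: bim_left_right) blast
qed

lemma bim_tensor_letter_bimod: "m \<in> bimod n \<Longrightarrow> bim_tensor m ([x], id) \<in> bimod (Suc n)"
  by (cases m) (auto simp: bimod_def sect_Gam)

lemma bim_tensor_letter_left:
  assumes "g \<in> carrier Aut" "m \<in> bimod n"
  shows "bim_tensor (bim_left g m) ([x], id) = bim_left g (bim_tensor m ([x], id))"
proof (cases m)
  case (Pair v h)
  then have "h \<in> carrier Aut" using assms(2) by (simp add: bimod_def)
  then show ?thesis
    using assms Pair by (simp add: sect_comp sect_append Aut_append Aut_single)
qed

lemma tens_letter_tensor:
  assumes "\<xi> \<in> Xi" "m \<in> bimod n"
  shows "tens_letter n (tensor n \<xi> m) x = tensor (Suc n) \<xi> (bim_tensor m ([x], id))"
  unfolding tens_letter_def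
proof (rule UN_tensor[OF assms])
  fix \<eta> m' assume m': "\<eta> \<in> Xi" "m' \<in> bimod n" "tensor n \<eta> m' = tensor n \<xi> m"
  then obtain h where h: "h \<in> Gam" "\<eta> = Xi_act \<xi> h" "m = bim_left h m'"
    using tensor_eq_iff[OF m'(1,2) assms] by blast
  have "bim_tensor m ([x], id) = bim_left h (bim_tensor m' ([x], id))"
    using h bim_tensor_letter_left[OF _ m'(2), of h x] by simp
  then show "tensor (Suc n) \<eta> (bim_tensor m' ([x], id)) = tensor (Suc n) \<xi> (bim_tensor m ([x], id))"
    using h(1,2) tensor_eq_iff[OF m'(1) bim_tensor_letter_bimod[OF m'(2)] assms(1) bim_tensor_letter_bimod[OF assms(2)]]
    by blast
qed

lemma word_bimod: "length v = n \<Longrightarrow> g \<in> Gam \<Longrightarrow> (v, g) \<in> bimod n"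
  by (simp add: bimod_def)

section \<open>Points of the tiles, the sets K and the maps \<kappa>\<close>

lemma T0_tensor_eq_iff:
  assumes "\<xi> \<in> T0" "\<eta> \<in> T0" "length v = n" "length w = n" "g \<in> Gam" "h \<in> Gam"
  shows "tensor n \<xi> (v, g) = tensor n \<eta> (w, h) \<longleftrightarrow>
    \<xi> = \<eta> \<and> (\<exists>k\<in>stab \<xi>. k v = w \<and> sect k v \<circ> g = h)"
proof -
  have "tensor n \<xi> (v, g) = tensor n \<eta> (w, h) \<longleftrightarrow>
      (\<exists>k\<in>Gam. \<xi> = Xi_act \<eta> k \<and> (w, h) = bim_left k (v, g))"
    using assms by (intro tensor_eq_iff) (simp_all add: T0_Xi word_bimod)
  also have "\<dots> \<longleftrightarrow> \<xi> = \<eta> \<and> (\<exists>k\<in>stab \<xi>. k v = w \<and> sect k v \<circ> g = h)"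
  proof
    assume "\<exists>k\<in>Gam. \<xi> = Xi_act \<eta> k \<and> (w, h) = bim_left k (v, g)"
    then show "\<xi> = \<eta> \<and> (\<exists>k\<in>stab \<xi>. k v = w \<and> sect k v \<circ> g = h)"
      using T0_act[OF assms(1,2)] by auto
  next
    assume "\<xi> = \<eta> \<and> (\<exists>k\<in>stab \<xi>. k v = w \<and> sect k v \<circ> g = h)"
    then obtain k where "\<xi> = \<eta>" "k \<in> stab \<xi>" "k v = w" "sect k v \<circ> g = h" by blast
    then show "\<exists>k\<in>Gam. \<xi> = Xi_act \<eta> k \<and> (w, h) = bim_left k (v, g)"
      using T0_stab[OF assms(1), of k] stab_Gam[OF assms(1), of k] by (intro bexI[of _ k]) simp_all
  qed
  finally show ?thesis .
qed

lemma tens_letter_word: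
  assumes "\<xi> \<in> T0" "length v = n"
  shows "tens_letter n (tensor n \<xi> (v, id)) x = tensor (Suc n) \<xi> (v @ [x], id)"
  using tens_letter_tensor[OF T0_Xi[OF assms(1)] word_bimod[OF assms(2) Gam_id]] by simp

lemma T_I: "\<xi> \<in> T0 \<Longrightarrow> length v = n \<Longrightarrow> tensor n \<xi> (v, id) \<in> T n"
  unfolding T_def by blast

lemma T_E:
  assumes "A \<in> T n"
  obtains \<xi> v where "\<xi> \<in> T0" "length v = n" "A = tensor n \<xi> (v, id)"
  using assms unfolding T_def by blast

text \<open>A point \<xi> \<otimes> v of \<open>K g n\<close> is also \<eta> \<otimes> w \<cdot> g
  with \<eta> in \<open>T0\<close>. Comparing the two forms gives \<eta> = \<xi> and an element
  \<open>k\<close> of the stabilizer with k(v) = w and section \<open>g\<close> at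
  \<open>v\<close>.\<close>

lemma K_iff:
  assumes "g \<in> Gam"
  shows "A \<in> K g n \<longleftrightarrow>
    (\<exists>\<xi> v k. \<xi> \<in> T0 \<and> length v = n \<and> k \<in> stab \<xi> \<and> sect k v = g \<and> A = tensor n \<xi> (v, id))"
proof
  assume "A \<in> K g n"
  then obtain \<xi> v \<eta> w where *: "\<xi> \<in> T0" "length v = n" "A = tensor n \<xi> (v, id)"
    "\<eta> \<in> T0" "length w = n" "A = tens_act n (tensor n \<eta> (w, id)) g"
    unfolding K_def by (auto elim!: T_E)
  then have "A = tensor n \<eta> (w, g)"
    using assms tens_act_tensor[OF T0_Xi word_bimod] by simp
  with * show "\<exists>\<xi> v k. \<xi> \<in> T0 \<and> length v = n \<and> k \<in> stab \<xi> \<and> sect k v = g \<and> A = tensor n \<xi> (v, id)"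
    using T0_tensor_eq_iff[OF *(1,4,2,5) Gam_id assms] by auto
next
  assume "\<exists>\<xi> v k. \<xi> \<in> T0 \<and> length v = n \<and> k \<in> stab \<xi> \<and> sect k v = g \<and> A = tensor n \<xi> (v, id)"
  then obtain \<xi> v k where *: "\<xi> \<in> T0" "length v = n" "k \<in> stab \<xi>" "sect k v = g"
    "A = tensor n \<xi> (v, id)" by blast
  have kv: "length (k v) = n" using *(2) stab_Gam[OF *(1,3)] by simp
  have "A = tensor n \<xi> (k v, g)"
    using * T0_tensor_eq_iff[OF *(1,1,2) kv Gam_id assms] by auto
  also have "\<dots> = tens_act n (tensor n \<xi> (k v, id)) g"
    using tens_act_tensor[OF T0_Xi[OF *(1)] word_bimod[OF kv Gam_id] assms] by simp
  finally show "A \<in> K g n"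
    unfolding K_def using T_I[OF *(1,2)] T_I[OF *(1) kv] *(5)
    by (intro IntI image_eqI[of _ _ "tensor n \<xi> (k v, id)"]) simp_all
qed

text \<open>Moving \<open>k\<close> across the tensor sign turns v \<cdot> h into k(v) \<cdot> gh,
  where g is the section of \<open>k\<close> at \<open>v\<close>; take h to be the inverse of
  g.\<close>

lemma kappa_tensor:
  assumes "\<xi> \<in> T0" "length v = n" "k \<in> stab \<xi>"
  shows "kappa (sect k v) n (tensor n \<xi> (v, id)) = tensor n \<xi> (k v, id)"
proof -
  have k: "k \<in> Gam" using stab_Gam assms by blast
  let ?g = "sect k v"
  have g: "?g \<in> Gam" using k by (rule sect_Gam)
  have "tensor n \<xi> (v, id) \<in> K ?g n"
    using assms K_iff[OF g] by blast
  then have "kappa ?g n (tensor n \<xi> (v, id)) = tensor n \<xi> (v, inv\<^bsub>Aut\<^esub> ?g)"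
    unfolding kappa_def
    using tens_act_tensor[OF T0_Xi[OF assms(1)] word_bimod[OF assms(2) Gam_id] Gam_inv[OF g]] by simp
  also have "\<dots> = tensor n \<xi> (k v, id)"
    using assms k Gam_inv[OF g] by (subst T0_tensor_eq_iff) auto
  finally show ?thesis .
qed

section \<open>The topology of \<open>\<T>\<^sub>n\<close>\<close>

lemma openin_prod_discrete:
  "openin (prod_topology X (discrete_topology B)) W \<longleftrightarrow>
     W \<subseteq> topspace X \<times> B \<and> (\<forall>b\<in>B. openin X {x \<in> topspace X. (x, b) \<in> W})"
proof (intro iffI conjI ballI)
  assume W: "openin (prod_topology X (discrete_topology B)) W"
  show "W \<subseteq> topspace X \<times> B" using openin_subset[OF W] by simp
  fix b assume "b \<in> B"
  then have "continuous_map X (prod_topology X (discrete_topology B)) (\<lambda>x. (x, b))"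
    by (simp add: continuous_map_pairwise o_def)
  from openin_continuous_map_preimage[OF this W] show "openin X {x \<in> topspace X. (x, b) \<in> W}" .
next
  assume W: "W \<subseteq> topspace X \<times> B \<and> (\<forall>b\<in>B. openin X {x \<in> topspace X. (x, b) \<in> W})"
  have "openin (prod_topology X (discrete_topology B)) (\<Union>b\<in>B. {x \<in> topspace X. (x, b) \<in> W} \<times> {b})"
    using W by (intro openin_Union) (auto simp: openin_prod_Times_iff)
  also have "(\<Union>b\<in>B. {x \<in> topspace X. (x, b) \<in> W} \<times> {b}) = W" using W by auto
  finally show "openin (prod_topology X (discrete_topology B)) W" .
qed

lemma closedin_prod_discrete:
  assumes "W \<subseteq> topspace X \<times> B"
  shows "closedin (prod_topology X (discrete_topology B)) W \<longleftrightarrow>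
     (\<forall>b\<in>B. closedin X {x \<in> topspace X. (x, b) \<in> W})"
proof -
  have "{x \<in> topspace X. (x, b) \<in> topspace X \<times> B - W} = topspace X - {x \<in> topspace X. (x, b) \<in> W}"
    if "b \<in> B" for b using that by auto
  then show ?thesis
    using assms by (simp add: closedin_def openin_prod_discrete Diff_subset)
qed

lemma topspace_realization_top [simp]: "topspace (realization_top P) = realization P"
proof -
  have "openin (realization_top P) (realization P)"
    unfolding openin_realization_top
  proof (intro conjI ballI)
    fix C assume "C \<in> fin_chains P"
    then have "realization P \<inter> simplex_on C = simplex_on C" by (auto simp: realization_def)
    then show "openin (top_of_set (simplex_on C)) (realization P \<inter> simplex_on C)" by simp
  qed simp
  then have "realization P \<subseteq> topspace (realization_top P)" by (rule openin_subset)
  moreover have "topspace (realization_top P) \<subseteq> realization P"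
    using openin_topspace[of "realization_top P"] openin_realization_top by blast
  ultimately show ?thesis by blast
qed

lemma topspace_Xi_top [simp]: "topspace Xi_top = Xi"
  by (simp add: Xi_top_def Xi_def)

lemma topspace_quotient_top [simp]: "topspace (quotient_top X E) = topspace X // E"
proof -
  have "{x \<in> topspace X. E `` {x} \<in> topspace X // E} = topspace X"
    by (auto intro: quotientI)
  then have "openin (quotient_top X E) (topspace X // E)"
    unfolding openin_quotient_top by simp
  then have "topspace X // E \<subseteq> topspace (quotient_top X E)" by (rule openin_subset)
  moreover have "topspace (quotient_top X E) \<subseteq> topspace X // E"
    using openin_topspace[of "quotient_top X E"] openin_quotient_top by blast
  ultimately show ?thesis by blast
qed

lemma topspace_Xi_n_top [simp]: "topspace (Xi_n_top n) = (Xi \<times> bimod n) // tens_rel n"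
  by (simp add: Xi_n_top_def)

lemma tensor_in_quotient: "\<xi> \<in> Xi \<Longrightarrow> m \<in> bimod n \<Longrightarrow> tensor n \<xi> m \<in> (Xi \<times> bimod n) // tens_rel n"
  by (simp add: tensor_def quotientI)

lemma simplex_on_realization: "C \<in> fin_chains P \<Longrightarrow> \<xi> \<in> simplex_on C \<Longrightarrow> \<xi> \<in> realization P"
  by (auto simp: realization_def)

lemma openin_Xi_n_top:
  assumes "U \<subseteq> (Xi \<times> bimod n) // tens_rel n"
  shows "openin (Xi_n_top n) U \<longleftrightarrow> (\<forall>m\<in>bimod n. \<forall>C\<in>fin_chains coset_poset.
     openin (top_of_set (simplex_on C)) {\<xi> \<in> simplex_on C. tensor n \<xi> m \<in> U})"
proof -
  have *: "{\<xi> \<in> Xi. tens_rel n `` {(\<xi>, m)} \<in> U} \<inter> simplex_on C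
      = {\<xi> \<in> simplex_on C. tensor n \<xi> m \<in> U}"
    if "m \<in> bimod n" "C \<in> fin_chains coset_poset" for m C
    using that simplex_on_realization[of C coset_poset] by (auto simp: tensor_def Xi_def)
  show ?thesis
    using assms
    unfolding Xi_n_top_def openin_quotient_top openin_prod_discrete topspace_prod_topology
      topspace_Xi_top topspace_discrete_topology
    by (auto simp: Xi_top_def openin_realization_top Xi_def[symmetric] *)
qed

lemma closedin_Xi_n_top:
  assumes F: "F \<subseteq> (Xi \<times> bimod n) // tens_rel n"
  shows "closedin (Xi_n_top n) F \<longleftrightarrow> (\<forall>m\<in>bimod n. \<forall>C\<in>fin_chains coset_poset.
     closedin (top_of_set (simplex_on C)) {\<xi> \<in> simplex_on C. tensor n \<xi> m \<in> F})"
proof -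
  have *: "{\<xi> \<in> simplex_on C. tensor n \<xi> m \<in> (Xi \<times> bimod n) // tens_rel n - F}
      = simplex_on C - {\<xi> \<in> simplex_on C. tensor n \<xi> m \<in> F}"
    if "m \<in> bimod n" "C \<in> fin_chains coset_poset" for m C
    using that simplex_on_realization[of C coset_poset] tensor_in_quotient[of _ m n]
    by (auto simp: Xi_def)
  have "closedin (Xi_n_top n) F \<longleftrightarrow> openin (Xi_n_top n) ((Xi \<times> bimod n) // tens_rel n - F)"
    using F by (simp add: closedin_def)
  also have "\<dots> \<longleftrightarrow> (\<forall>m\<in>bimod n. \<forall>C\<in>fin_chains coset_poset. openin (top_of_set (simplex_on C))
      (simplex_on C - {\<xi> \<in> simplex_on C. tensor n \<xi> m \<in> F}))"
    unfolding openin_Xi_n_top[OF Diff_subset] by (intro ball_cong refl) (simp only: *)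
  also have "\<dots> \<longleftrightarrow> (\<forall>m\<in>bimod n. \<forall>C\<in>fin_chains coset_poset.
     closedin (top_of_set (simplex_on C)) {\<xi> \<in> simplex_on C. tensor n \<xi> m \<in> F})"
    by (auto simp: closedin_def)
  finally show ?thesis .
qed

text \<open>The smallest coset of the chain contains some \<open>k\<close>, which then lies in every
  coset of it, so each has the form G \<cdot> k with G in \<open>calG\<close>. Thus every simplex is
  a translate of one in \<open>T0\<close>.\<close>

lemma coset_chain_translate:
  assumes D: "D \<in> fin_chains coset_poset"
  obtains C k where "C \<in> fin_chains calG" "k \<in> Gam" "D = (\<lambda>G. G #>\<^bsub>Aut\<^esub> k) ` C"
    "inj_on (\<lambda>G. G #>\<^bsub>Aut\<^esub> k) C"
proof -
  have D': "finite D" "D \<noteq> {}" "D \<subseteq> coset_poset" "chain_subset D"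
    using D by (auto simp: fin_chains_def)
  obtain G0 k where k: "G0 \<in> calG" "k \<in> Gam" "\<Inter>D = G0 #>\<^bsub>Aut\<^esub> k"
    using fin_chain_Inter[OF D] D'(3) by (auto simp: coset_poset_def)
  have kA: "k \<in> carrier Aut" using k(2) by simp
  have kD: "k \<in> S" if "S \<in> D" for S
  proof -
    have "k \<in> \<Inter>D" using calG_id[OF k(1)] unfolding k(3) coset_image
      by (rule rev_image_eqI) simp
    then show ?thesis using that by blast
  qed
  define C where "C = (\<lambda>S. S #>\<^bsub>Aut\<^esub> inv\<^bsub>Aut\<^esub> k) ` D"
  have C: "C \<subseteq> calG"
  proof
    fix H assume "H \<in> C"
    then obtain S where S: "S \<in> D" "H = S #>\<^bsub>Aut\<^esub> inv\<^bsub>Aut\<^esub> k" by (auto simp: C_def)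
    then obtain G g where G: "G \<in> calG" "g \<in> Gam" "S = G #>\<^bsub>Aut\<^esub> g"
      using D'(3) by (auto simp: coset_poset_def)
    have "k \<in> G #>\<^bsub>Aut\<^esub> g" using kD[OF S(1)] G(3) by simp
    then have "S = G #>\<^bsub>Aut\<^esub> k"
      using Aut.repr_independence[of k G g] calG_subgroup(1)[OF G(1)] G by simp
    then show "H \<in> calG" using S(2) G(1) kA by simp
  qed
  show thesis
  proof (rule that)
    show "D = (\<lambda>G. G #>\<^bsub>Aut\<^esub> k) ` C"
      using kA by (simp add: C_def image_image)
    show "inj_on (\<lambda>G. G #>\<^bsub>Aut\<^esub> k) C"
      using kA by (intro inj_on_inverseI[where g = "\<lambda>S. S #>\<^bsub>Aut\<^esub> inv\<^bsub>Aut\<^esub> k"]) simp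
    show "C \<in> fin_chains calG"
    proof -
      have "chain_subset C"
        using D'(4) unfolding C_def chain_subset_def coset_image ball_simps(9) using image_mono by metis
      then show ?thesis using C D'(1,2) by (simp add: fin_chains_def C_def)
    qed
  qed (rule k)
qed

lemma continuous_on_Xi_act: "continuous_on S (\<lambda>\<xi>. Xi_act \<xi> g)"
  unfolding Xi_act_def
  by (intro continuous_on_coordinatewise_then_product
      continuous_on_product_then_coordinatewise[OF continuous_on_id])

lemma Xi_act_simplex:
  assumes "k \<in> carrier Aut" "inj_on (\<lambda>G. G #>\<^bsub>Aut\<^esub> k) C" "\<xi> \<in> simplex_on ((\<lambda>G. G #>\<^bsub>Aut\<^esub> k) ` C)"
  shows "Xi_act \<xi> (inv\<^bsub>Aut\<^esub> k) \<in> simplex_on C"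
proof -
  have act: "Xi_act \<xi> (inv\<^bsub>Aut\<^esub> k) = (\<lambda>S. \<xi> (S #>\<^bsub>Aut\<^esub> k))"
    using assms(1) by (simp add: Xi_act_def)
  have "S \<in> C" if "\<xi> (S #>\<^bsub>Aut\<^esub> k) \<noteq> 0" for S
  proof -
    have "S #>\<^bsub>Aut\<^esub> k \<in> (\<lambda>G. G #>\<^bsub>Aut\<^esub> k) ` C"
      using assms(3) that by (auto simp: simplex_on_def)
    then obtain G where "G \<in> C" "S #>\<^bsub>Aut\<^esub> k = G #>\<^bsub>Aut\<^esub> k" by blast
    then show ?thesis using coset_inv_cancel(1)[OF assms(1)] by metis
  qed
  moreover have "(\<Sum>S\<in>C. \<xi> (S #>\<^bsub>Aut\<^esub> k)) = 1"
    using assms(3) sum.reindex[OF assms(2), of \<xi>] by (simp add: simplex_on_def)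
  ultimately show ?thesis
    unfolding act using assms(3) by (auto simp: simplex_on_def)
qed

lemma finite_words: "finite {v :: word. length v = n}"
proof -
  have "(UNIV :: letter set) = {L1, L2, L3, L4}"
    using letter.exhaust by auto
  then have "finite (UNIV :: letter set)" by (metis finite.emptyI finite.insertI)
  then show ?thesis using finite_lists_length_eq[of "UNIV :: letter set" n] by simp
qed

lemma T_subset: "T n \<subseteq> (Xi \<times> bimod n) // tens_rel n"
  by (auto elim!: T_E intro!: tensor_in_quotient T0_Xi word_bimod)

lemma closedin_face:
  fixes C :: "'a set"
  shows "closedin (top_of_set (simplex_on C)) {\<xi> \<in> simplex_on C. {S. \<xi> S \<noteq> 0} \<subseteq> B}"
proof -
  have "closed {\<xi> :: 'a \<Rightarrow> real. \<xi> S = 0}" for S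
    by (intro closed_Collect_eq continuous_on_const
        continuous_on_product_then_coordinatewise[OF continuous_on_id])
  then have "closed (\<Inter>S\<in>-B. {\<xi> :: 'a \<Rightarrow> real. \<xi> S = 0})" by blast
  then have "closedin (top_of_set (simplex_on C)) (simplex_on C \<inter> (\<Inter>S\<in>-B. {\<xi>. \<xi> S = 0}))"
    by (rule closedin_closed_Int)
  also have "simplex_on C \<inter> (\<Inter>S\<in>-B. {\<xi>. \<xi> S = 0}) = {\<xi> \<in> simplex_on C. {S. \<xi> S \<noteq> 0} \<subseteq> B}"
    by auto
  finally show ?thesis .
qed

lemma simplex_T0: "C \<in> fin_chains calG \<Longrightarrow> \<xi> \<in> simplex_on C \<Longrightarrow> \<xi> \<in> T0"
  unfolding T0_def by (rule simplex_on_realization)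

text \<open>On a simplex of \<open>T0\<close>, the points whose tensor product with \<open>m\<close> lies in \<open>F\<close> form the union
  of the corresponding sets for the words \<open>v\<close>, each restricted to the faces whose stabilizer
  moves \<open>v\<close> to \<open>m\<close>.\<close>

lemma closedin_simplex_T0:
  assumes F: "F \<subseteq> T n" and C: "C \<in> fin_chains calG" and m: "m \<in> bimod n"
    and closed: "\<And>v. length v = n \<Longrightarrow>
      closedin (top_of_set (simplex_on C)) {\<xi> \<in> simplex_on C. tensor n \<xi> (v, id) \<in> F}"
  shows "closedin (top_of_set (simplex_on C)) {\<xi> \<in> simplex_on C. tensor n \<xi> m \<in> F}"
proof -
  \<comment> \<open>The index set is finite because there are finitely many words of length
    \<open>n\<close> and faces of \<open>C\<close>. A point of the set is found at the index formed
    by its word and its own support.\<close>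
  define I where "I = {(v, B). length v = n \<and> B \<subseteq> C \<and> (\<exists>l\<in>\<Inter>B. m = bim_left l (v, id))}"
  define Z where "Z = (\<lambda>(v, B). {\<xi> \<in> simplex_on C. tensor n \<xi> (v, id) \<in> F} \<inter>
      {\<xi> \<in> simplex_on C. {S. \<xi> S \<noteq> 0} \<subseteq> B})"
  have "finite C" using C by (simp add: fin_chains_def)
  then have "finite ({v :: word. length v = n} \<times> Pow C)" using finite_words by simp
  then have "finite I" by (rule rev_finite_subset) (auto simp: I_def)
  moreover have "closedin (top_of_set (simplex_on C)) (Z i)" if "i \<in> I" for i
    using that closed closedin_face[of C] unfolding Z_def I_def
    by (auto intro!: closedin_Int)
  ultimately have "closedin (top_of_set (simplex_on C)) (\<Union>i\<in>I. Z i)"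
    by (intro closedin_Union) auto
  also have "(\<Union>i\<in>I. Z i) = {\<xi> \<in> simplex_on C. tensor n \<xi> m \<in> F}"
  proof (intro equalityI subsetI)
    fix \<xi> assume "\<xi> \<in> (\<Union>i\<in>I. Z i)"
    then obtain v B l where *: "length v = n" "l \<in> \<Inter>B" "m = bim_left l (v, id)"
      "\<xi> \<in> simplex_on C" "tensor n \<xi> (v, id) \<in> F" "{S. \<xi> S \<noteq> 0} \<subseteq> B"
      unfolding I_def Z_def by auto
    have \<xi>: "\<xi> \<in> T0" using simplex_T0[OF C *(4)] .
    have l: "l \<in> stab \<xi>" using *(2,6) by (auto simp: stab_def)
    have "tensor n \<xi> (v, id) = tensor n \<xi> m"
      using tensor_eq_iff[OF T0_Xi[OF \<xi>] word_bimod[OF *(1) Gam_id] T0_Xi[OF \<xi>] m]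
        T0_stab[OF \<xi> l] stab_Gam[OF \<xi> l] *(3) by metis
    with * show "\<xi> \<in> {\<xi> \<in> simplex_on C. tensor n \<xi> m \<in> F}" by simp
  next
    fix \<xi> assume *: "\<xi> \<in> {\<xi> \<in> simplex_on C. tensor n \<xi> m \<in> F}"
    then have \<xi>: "\<xi> \<in> T0" using simplex_T0[OF C] by simp
    obtain \<eta> v where \<eta>: "\<eta> \<in> T0" "length v = n" "tensor n \<xi> m = tensor n \<eta> (v, id)"
      using * F T_E[of "tensor n \<xi> m" n] by blast
    then obtain g where g: "g \<in> Gam" "\<eta> = Xi_act \<xi> g" "m = bim_left g (v, id)"
      using tensor_eq_iff[OF T0_Xi[OF \<eta>(1)] word_bimod[OF \<eta>(2) Gam_id] T0_Xi[OF \<xi>] m] by metis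
    then have "\<eta> = \<xi>" "g \<in> stab \<xi>"
      using T0_act[OF \<eta>(1) \<xi> _ g(2)] by auto
    moreover have "{S. \<xi> S \<noteq> 0} \<subseteq> C" using * by (simp add: simplex_on_def)
    ultimately have "(v, {S. \<xi> S \<noteq> 0}) \<in> I" "\<xi> \<in> Z (v, {S. \<xi> S \<noteq> 0})"
      using \<eta> g * unfolding I_def Z_def stab_def by auto
    then show "\<xi> \<in> (\<Union>i\<in>I. Z i)" by blast
  qed
  finally show ?thesis .
qed

text \<open>For the converse \<open>F\<close> is shown to be closed in all of
  \<open>Xi_n_top n\<close>. A simplex of \<open>Xi\<close> is translated back to one of
  \<open>T0\<close>, the translation being absorbed into \<open>m\<close>, and
  \<open>closedin_simplex_T0\<close> reduces arbitrary \<open>m\<close> to words.\<close>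

lemma closedin_T_top:
  assumes F: "F \<subseteq> T n"
  shows "closedin (T_top n) F \<longleftrightarrow> (\<forall>v. length v = n \<longrightarrow> (\<forall>C\<in>fin_chains calG.
     closedin (top_of_set (simplex_on C)) {\<xi> \<in> simplex_on C. tensor n \<xi> (v, id) \<in> F}))"
proof
  assume "closedin (T_top n) F"
  then obtain F' where F': "closedin (Xi_n_top n) F'" "F = F' \<inter> T n"
    by (auto simp: T_top_def closedin_subtopology)
  show "\<forall>v. length v = n \<longrightarrow> (\<forall>C\<in>fin_chains calG.
     closedin (top_of_set (simplex_on C)) {\<xi> \<in> simplex_on C. tensor n \<xi> (v, id) \<in> F})"
  proof (intro allI impI ballI)
    fix v :: word and C assume v: "length v = n" and C: "C \<in> fin_chains calG"
    have "closedin (top_of_set (simplex_on C)) {\<xi> \<in> simplex_on C. tensor n \<xi> (v, id) \<in> F'}"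
      using F'(1) closedin_Xi_n_top[OF closedin_subset[OF F'(1), simplified]]
        word_bimod[OF v Gam_id] C fin_chains_mono[OF calG_coset_poset] by blast
    also have "{\<xi> \<in> simplex_on C. tensor n \<xi> (v, id) \<in> F'} = {\<xi> \<in> simplex_on C. tensor n \<xi> (v, id) \<in> F}"
      using F'(2) T_I[OF simplex_T0[OF C] v] by auto
    finally show "closedin (top_of_set (simplex_on C)) {\<xi> \<in> simplex_on C. tensor n \<xi> (v, id) \<in> F}" .
  qed
next
  assume closed: "\<forall>v. length v = n \<longrightarrow> (\<forall>C\<in>fin_chains calG.
     closedin (top_of_set (simplex_on C)) {\<xi> \<in> simplex_on C. tensor n \<xi> (v, id) \<in> F})"
  have "closedin (Xi_n_top n) F"
    unfolding closedin_Xi_n_top[OF order_trans[OF F T_subset]]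
  proof (intro ballI)
    fix m D assume m: "m \<in> bimod n" and D: "D \<in> fin_chains coset_poset"
    obtain C k where C: "C \<in> fin_chains calG" and k: "k \<in> Gam" and CD: "D = (\<lambda>G. G #>\<^bsub>Aut\<^esub> k) ` C"
      "inj_on (\<lambda>G. G #>\<^bsub>Aut\<^esub> k) C" by (rule coset_chain_translate[OF D])
    have kA: "k \<in> carrier Aut" using k by simp
    let ?f = "\<lambda>\<xi>. Xi_act \<xi> (inv\<^bsub>Aut\<^esub> k)"
    let ?Z = "{\<xi> \<in> simplex_on C. tensor n \<xi> (bim_left k m) \<in> F}"
    have f: "?f \<xi> \<in> simplex_on C" if "\<xi> \<in> simplex_on D" for \<xi>
      using Xi_act_simplex[OF kA CD(2)] that CD(1) by simp
    have eq: "tensor n \<xi> m = tensor n (?f \<xi>) (bim_left k m)" if "\<xi> \<in> simplex_on D" for \<xi>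
    proof -
      have "\<xi> \<in> Xi" using simplex_on_realization[OF D that] by (simp add: Xi_def)
      moreover have "?f \<xi> \<in> Xi" using T0_Xi simplex_T0[OF C] f[OF that] by blast
      moreover have "\<xi> = Xi_act (?f \<xi>) k" using kA by (simp add: Xi_act_comp)
      ultimately show ?thesis
        using tensor_eq_iff[of \<xi> m n "?f \<xi>" "bim_left k m"] m k bim_left_bimod by blast
    qed
    have "closedin (top_of_set (simplex_on C)) ?Z"
      using closedin_simplex_T0[OF F C bim_left_bimod[OF k m]] closed C by blast
    then have "closedin (top_of_set (simplex_on D)) (simplex_on D \<inter> ?f -` ?Z)"
      using continuous_on_Xi_act f
      by (intro continuous_closedin_preimage_gen[where T = "simplex_on C"]) auto
    also have "simplex_on D \<inter> ?f -` ?Z = {\<xi> \<in> simplex_on D. tensor n \<xi> m \<in> F}"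
      using f eq by auto
    finally show "closedin (top_of_set (simplex_on D)) {\<xi> \<in> simplex_on D. tensor n \<xi> m \<in> F}" .
  qed
  then show "closedin (T_top n) F"
    unfolding T_top_def using F by (simp add: closedin_subset_topspace)
qed

lemma topspace_T_top [simp]: "topspace (T_top n) = T n"
  unfolding T_top_def using T_subset by (simp add: Int_absorb1)

text \<open>By \<open>closedin_T_top\<close> both topologies are tested on the same simplices: a
  word of length \<open>n + 1\<close> is a word of length \<open>n\<close> with a last
  letter.\<close>

theorem quotient_map_tens_letter:
  "quotient_map (prod_topology (T_top n) (discrete_topology UNIV)) (T_top (Suc n))
     (\<lambda>(A, x). tens_letter n A x)"
proof -
  have image: "(\<lambda>(A, x). tens_letter n A x) ` (T n \<times> UNIV) = T (Suc n)"
  proof (intro equalityI subsetI)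
    fix A assume "A \<in> (\<lambda>(A, x). tens_letter n A x) ` (T n \<times> UNIV)"
    then show "A \<in> T (Suc n)"
      by (auto elim!: T_E simp: tens_letter_word intro!: T_I)
  next
    fix A assume "A \<in> T (Suc n)"
    then obtain \<xi> u where u: "\<xi> \<in> T0" "length u = Suc n" "A = tensor (Suc n) \<xi> (u, id)"
      by (rule T_E)
    then obtain v x where v: "u = v @ [x]" "length v = n"
      by (cases u rule: rev_cases) auto
    then have "A = (\<lambda>(A, x). tens_letter n A x) (tensor n \<xi> (v, id), x)"
      using u tens_letter_word by simp
    then show "A \<in> (\<lambda>(A, x). tens_letter n A x) ` (T n \<times> UNIV)"
      using T_I[OF u(1) v(2)] by blast
  qed
  moreover have "closedin (prod_topology (T_top n) (discrete_topology UNIV))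
        {p \<in> T n \<times> UNIV. (case p of (A, x) \<Rightarrow> tens_letter n A x) \<in> U} \<longleftrightarrow>
      closedin (T_top (Suc n)) U" if U: "U \<subseteq> T (Suc n)" for U
  proof -
    let ?P = "\<lambda>C v. closedin (top_of_set (simplex_on C))
      {\<xi> \<in> simplex_on C. tensor (Suc n) \<xi> (v, id) \<in> U}"
    have 1: "{\<xi> \<in> simplex_on C. tensor n \<xi> (v, id) \<in> {A \<in> T n. tens_letter n A x \<in> U}}
        = {\<xi> \<in> simplex_on C. tensor (Suc n) \<xi> (v @ [x], id) \<in> U}"
      if "C \<in> fin_chains calG" "length v = n" for C v x
      using simplex_T0[OF that(1)] that(2) T_I tens_letter_word by auto
    have "closedin (prod_topology (T_top n) (discrete_topology UNIV))
        {p \<in> T n \<times> UNIV. (case p of (A, x) \<Rightarrow> tens_letter n A x) \<in> U} \<longleftrightarrow>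
      (\<forall>x. closedin (T_top n) {A \<in> T n. tens_letter n A x \<in> U})"
      by (subst closedin_prod_discrete) auto
    also have "\<dots> \<longleftrightarrow> (\<forall>x v. length v = n \<longrightarrow> (\<forall>C\<in>fin_chains calG. ?P C (v @ [x])))"
    proof -
      have "closedin (T_top n) {A \<in> T n. tens_letter n A x \<in> U} \<longleftrightarrow>
          (\<forall>v. length v = n \<longrightarrow> (\<forall>C\<in>fin_chains calG. ?P C (v @ [x])))" for x
        unfolding closedin_T_top[OF Collect_restrict] by (simp only: 1 cong: ball_cong imp_cong)
      then show ?thesis by simp
    qed
    also have "\<dots> \<longleftrightarrow> (\<forall>u. length u = Suc n \<longrightarrow> (\<forall>C\<in>fin_chains calG. ?P C u))"
      by (auto simp: length_Suc_conv_rev)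
    also have "\<dots> \<longleftrightarrow> closedin (T_top (Suc n)) U"
      using closedin_T_top[OF U] by simp
    finally show ?thesis .
  qed
  ultimately show ?thesis
    unfolding quotient_map_closedin by simp
qed

section \<open>Identifications and intersections\<close>

lemma tstep_stab:
  assumes "\<xi> \<in> T0" "(u, u') \<in> tstep (stab \<xi>)"
  obtains k where "k \<in> stab \<xi>" "k \<in> carrier Aut" "u \<noteq> []" "u' = k u"
    "sect k (butlast u) \<in> frakA" "sect k u = id"
  using assms stab_Gam[OF assms(1)] Gam_in_Aut unfolding tstep_def by blast

lemma stab_length:
  assumes "\<xi> \<in> T0" "(u, u') \<in> (tstep (stab \<xi>))\<^sup>*"
  shows "length u' = length u"
  using tstep_length[OF _ assms(2)] stab_Gam[OF assms(1)] Gam_in_Aut by blast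

lemma tstep_identification:
  assumes \<xi>: "\<xi> \<in> T0" and step: "(u, u') \<in> tstep (stab \<xi>)" and u: "length u = Suc n"
  shows "((tensor n \<xi> (butlast u, id), last u), (tensor n \<xi> (butlast u', id), last u'))
    \<in> identifications n"
proof -
  obtain k where k: "k \<in> stab \<xi>" "k \<in> carrier Aut" "u \<noteq> []" "u' = k u"
    "sect k (butlast u) \<in> frakA" "sect k u = id" by (rule tstep_stab[OF \<xi> step])
  obtain v x where v: "u = v @ [x]" "length v = n" using u by (cases u rule: rev_cases) auto
  let ?g = "sect k v"
  have "tensor n \<xi> (v, id) \<in> K ?g n"
    using K_iff[of ?g] \<xi> v(2) k(1) stab_Gam[OF \<xi> k(1)] sect_Gam by blast
  moreover have "kappa ?g n (tensor n \<xi> (v, id)) = tensor n \<xi> (k v, id)"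
    using kappa_tensor[OF \<xi> v(2) k(1)] .
  moreover have "sect ?g [x] = id" using k(2,6) v(1) by (simp add: sect_append)
  moreover have "u' = k v @ [on_letter ?g x]"
    using k(2,4) v(1) by (simp add: on_letter_sect_butlast)
  ultimately show ?thesis
    using k(5) v(1) unfolding identifications_def by auto
qed

lemma tsteps_identifications:
  assumes \<xi>: "\<xi> \<in> T0" and steps: "(u, u') \<in> (tstep (stab \<xi>))\<^sup>*" and u: "length u = Suc n"
  shows "((tensor n \<xi> (butlast u, id), last u), (tensor n \<xi> (butlast u', id), last u'))
    \<in> (identifications n)\<^sup>*"
  using steps
proof (induction rule: rtrancl_induct)
  case (step v v')
  then have "length v = Suc n" using stab_length[OF \<xi>] u by simp
  from tstep_identification[OF \<xi> step(2) this] show ?case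
    by (rule rtrancl_into_rtrancl[OF step(3)])
qed simp

lemma tsteps_tensor:
  assumes \<xi>: "\<xi> \<in> T0" and steps: "(u, u') \<in> (tstep (stab \<xi>))\<^sup>*"
  shows "tensor (length u) \<xi> (u, id) = tensor (length u) \<xi> (u', id)"
  using steps
proof (induction rule: rtrancl_induct)
  case (step v v')
  obtain k where k: "k \<in> stab \<xi>" "k \<in> carrier Aut" "v' = k v" "sect k v = id"
    by (rule tstep_stab[OF \<xi> step(2)])
  have v: "length v = length u" using stab_length[OF \<xi> step(1)] .
  then have "tensor (length u) \<xi> (v, id) = tensor (length u) \<xi> (v', id)"
    using k T0_tensor_eq_iff[OF \<xi> \<xi> v _ Gam_id Gam_id, of v'] by auto
  then show ?case by (rule trans[OF step(3)])
qed simp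

lemma kappa_letter:
  assumes "\<xi> \<in> T0" "length v = n" "k \<in> stab \<xi>"
  shows "kappa (sect (sect k v) [x]) (Suc n) (tens_letter n (tensor n \<xi> (v, id)) x) =
    tens_letter n (kappa (sect k v) n (tensor n \<xi> (v, id))) (on_letter (sect k v) x)"
proof -
  have k: "k \<in> carrier Aut" using stab_Gam[OF assms(1,3)] by simp
  have "kappa (sect k (v @ [x])) (Suc n) (tensor (Suc n) \<xi> (v @ [x], id)) =
      tensor (Suc n) \<xi> (k (v @ [x]), id)"
    using assms by (intro kappa_tensor) simp_all
  then show ?thesis
    using assms k by (simp add: sect_append kappa_tensor tens_letter_word on_letter_sect_butlast)
qed

lemma identifications_iff:
  assumes "p \<in> T n \<times> UNIV" "q \<in> T n \<times> UNIV"
    and eq: "(case p of (A, x) \<Rightarrow> tens_letter n A x) = (case q of (A, x) \<Rightarrow> tens_letter n A x)"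
  shows "(p, q) \<in> (identifications n)\<^sup>*"
proof -
  obtain \<xi> v x where p: "\<xi> \<in> T0" "length v = n" "p = (tensor n \<xi> (v, id), x)"
    using assms(1) by (cases p) (auto elim: T_E)
  obtain \<eta> w y where q: "\<eta> \<in> T0" "length w = n" "q = (tensor n \<eta> (w, id), y)"
    using assms(2) by (cases q) (auto elim: T_E)
  have "tensor (Suc n) \<xi> (v @ [x], id) = tensor (Suc n) \<eta> (w @ [y], id)"
    using eq p q by (simp add: tens_letter_word)
  then obtain k where k: "\<eta> = \<xi>" "k \<in> stab \<xi>" "k (v @ [x]) = w @ [y]" "sect k (v @ [x]) = id"
    using T0_tensor_eq_iff[OF p(1) q(1), of "v @ [x]" "Suc n" "w @ [y]" id id] p(2) q(2) by auto
  obtain u' l where l: "(v @ [x], u') \<in> (tstep (stab \<xi>))\<^sup>*" "l \<in> stab \<xi>"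
    "sect l (butlast u') \<in> frakA" "sect l u' = id" "(l u', w @ [y]) \<in> (tstep (stab \<xi>))\<^sup>*"
    using factorsD[OF factors_calG[OF stab_calG[OF p(1)]], of "v @ [x]" n k] p(2) k by auto
  have "length u' = Suc n" using stab_length[OF p(1) l(1)] p(2) by simp
  \<comment> \<open>The section at stake is trivial, so the middle passage by \<open>l\<close> is a
    step too and the whole way from one word to the other consists of steps.\<close>
  then have "(u', l u') \<in> tstep (stab \<xi>)" using l by (intro tstepI) auto
  with l have "(v @ [x], w @ [y]) \<in> (tstep (stab \<xi>))\<^sup>*" by (meson rtrancl.rtrancl_into_rtrancl rtrancl_trans)
  from tsteps_identifications[OF p(1) this] show ?thesis using p q k by simp
qed

lemma identifications_sound:
  assumes "(p, q) \<in> identifications n"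
  shows "p \<in> T n \<times> UNIV" "q \<in> T n \<times> UNIV"
    "(case p of (A, x) \<Rightarrow> tens_letter n A x) = (case q of (A, x) \<Rightarrow> tens_letter n A x)"
proof -
  obtain g x A where g: "g \<in> frakA" "A \<in> K g n" "sect g [x] = id" "p = (A, x)"
    "q = (kappa g n A, on_letter g x)"
    using assms unfolding identifications_def by blast
  then obtain \<xi> v k where A: "\<xi> \<in> T0" "length v = n" "k \<in> stab \<xi>" "sect k v = g" "A = tensor n \<xi> (v, id)"
    using K_iff frakA_Gam by blast
  have k: "k \<in> carrier Aut" using stab_Gam[OF A(1,3)] by simp
  have \<kappa>: "kappa g n A = tensor n \<xi> (k v, id)" using kappa_tensor[OF A(1-3)] A(4,5) by simp
  show "p \<in> T n \<times> UNIV" "q \<in> T n \<times> UNIV"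
    using g(4,5) A k \<kappa> by (auto intro!: T_I)
  have "tensor (Suc n) \<xi> (v @ [x], id) = tensor (Suc n) \<xi> (k (v @ [x]), id)"
    using A(1-4) k g(3) by (subst T0_tensor_eq_iff) (auto simp: sect_append intro!: bexI[of _ k])
  then show "(case p of (A, x) \<Rightarrow> tens_letter n A x) = (case q of (A, x) \<Rightarrow> tens_letter n A x)"
    using g(4,5) A k \<kappa> by (simp add: tens_letter_word on_letter_sect_butlast)
qed

lemma kernel_tens_letter:
  "{(p, q). p \<in> T n \<times> UNIV \<and> q \<in> T n \<times> UNIV \<and>
      (case p of (A, x) \<Rightarrow> tens_letter n A x) = (case q of (A, x) \<Rightarrow> tens_letter n A x)}
    = equiv_gen (T n \<times> UNIV) (identifications n)" (is "?E = _")
proof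
  have "equiv (T n \<times> UNIV) ?E"
    by (intro equivI refl_onI symI transI) (auto split: prod.splits)
  moreover have "identifications n \<subseteq> ?E"
    using identifications_sound by auto
  ultimately show "equiv_gen (T n \<times> UNIV) (identifications n) \<subseteq> ?E"
    by (rule equiv_gen_least)
  show "?E \<subseteq> equiv_gen (T n \<times> UNIV) (identifications n)"
  proof clarify
    fix A x B y assume "A \<in> T n" "B \<in> T n" "tens_letter n A x = tens_letter n B y"
    then have "((A, x), (B, y)) \<in> (identifications n)\<^sup>*"
      using identifications_iff[of "(A, x)" n "(B, y)"] by simp
    then have "((A, x), (B, y)) \<in> (identifications n \<union> (identifications n)\<inverse>)\<^sup>*"
      using rtrancl_mono[of "identifications n" "identifications n \<union> (identifications n)\<inverse>"] by blast
    then show "((A, x), (B, y)) \<in> equiv_gen (T n \<times> UNIV) (identifications n)"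
      using \<open>A \<in> T n\<close> \<open>B \<in> T n\<close> by (simp add: equiv_gen_def)
  qed
qed

text \<open>Steps do not change the point, so its word may be replaced by \<open>u'\<close>, where
  \<open>l\<close> has a prefix section in \<open>frakA\<close>; that section is the required
  \<open>h\<close>.\<close>

lemma K_Suc:
  assumes g: "g \<in> frakA"
  shows "K g (Suc n) =
    (\<Union>(h, x)\<in>{(h, x). h \<in> frakA \<and> sect h [x] = g}. (\<lambda>A. tens_letter n A x) ` K h n)" (is "_ = ?U")
proof (intro equalityI subsetI)
  fix A assume "A \<in> K g (Suc n)"
  then obtain \<xi> u k where A: "\<xi> \<in> T0" "length u = Suc n" "k \<in> stab \<xi>" "sect k u = g"
    "A = tensor (Suc n) \<xi> (u, id)"
    using K_iff g frakA_Gam by blast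
  obtain u' l where l: "(u, u') \<in> (tstep (stab \<xi>))\<^sup>*" "l \<in> stab \<xi>"
    "sect l (butlast u') \<in> frakA" "sect l u' = g"
    using factorsD[OF factors_calG[OF stab_calG[OF A(1)]] A(2,3)] A(4) g by metis
  have lG: "l \<in> Gam" using stab_Gam[OF A(1) l(2)] .
  obtain v x where v: "u' = v @ [x]" "length v = n"
    using stab_length[OF A(1) l(1)] A(2) by (cases u' rule: rev_cases) auto
  have "A = tens_letter n (tensor n \<xi> (v, id)) x"
    using tsteps_tensor[OF A(1) l(1)] A v by (simp add: tens_letter_word)
  moreover have "tensor n \<xi> (v, id) \<in> K (sect l v) n"
    using K_iff[OF sect_Gam[OF lG]] A(1) v(2) l(2) by blast
  moreover have "sect l v \<in> frakA" "sect (sect l v) [x] = g"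
    using l(3,4) v(1) lG by (simp_all add: sect_append)
  ultimately show "A \<in> ?U" by blast
next
  fix A assume "A \<in> ?U"
  then obtain h x B where h: "h \<in> frakA" "sect h [x] = g" "B \<in> K h n" "A = tens_letter n B x"
    by blast
  then obtain \<xi> v k where B: "\<xi> \<in> T0" "length v = n" "k \<in> stab \<xi>" "sect k v = h" "B = tensor n \<xi> (v, id)"
    using K_iff frakA_Gam by blast
  have "sect k (v @ [x]) = g" using B(4) h(2) stab_Gam[OF B(1,3)] by (simp add: sect_append)
  moreover have "A = tensor (Suc n) \<xi> (v @ [x], id)" using h(4) B by (simp add: tens_letter_word)
  moreover have "length (v @ [x]) = Suc n" using B(2) by simp
  ultimately show "A \<in> K g (Suc n)"
    using K_iff[OF subsetD[OF frakA_Gam g]] B(1,3) by blast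
qed

text \<open>The inverse of \<open>k\<close> has at k(v) the section inverse to \<open>g\<close>, and
  elements of \<open>frakA\<close> are involutions, so that section is \<open>g\<close>
  again.\<close>

lemma kappa_K:
  assumes g: "g \<in> frakA"
  shows "kappa g n \<in> K g n \<rightarrow> K g n"
proof
  fix A assume "A \<in> K g n"
  then obtain \<xi> v k where A: "\<xi> \<in> T0" "length v = n" "k \<in> stab \<xi>" "sect k v = g" "A = tensor n \<xi> (v, id)"
    using K_iff g frakA_Gam by blast
  have k: "k \<in> carrier Aut" using stab_Gam[OF A(1,3)] by simp
  let ?k = "inv\<^bsub>Aut\<^esub> k"
  have "sect ?k (k v) \<circ> g = id"
    using sect_comp[of ?k k v] A(4) k by simp
  then have "sect ?k (k v) \<circ> (g \<circ> g) = g" by (simp add: o_assoc)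
  then have "sect ?k (k v) = g" using frakA_invol(2)[OF g] by simp
  moreover have "?k \<in> stab \<xi>"
    using subgroup.m_inv_closed[OF calG_subgroup(1)[OF stab_calG[OF A(1)]] A(3)] .
  moreover have "kappa g n A = tensor n \<xi> (k v, id)" using kappa_tensor[OF A(1-3)] A(4,5) by simp
  moreover have "length (k v) = n" using A(2) k by simp
  ultimately show "kappa g n A \<in> K g n"
    using K_iff[of g] g frakA_Gam A(1) by blast
qed

lemma kappa_Suc:
  assumes "h \<in> frakA" "A \<in> K h n"
  shows "kappa (sect h [x]) (Suc n) (tens_letter n A x) = tens_letter n (kappa h n A) (on_letter h x)"
proof -
  obtain \<xi> v k where "\<xi> \<in> T0" "length v = n" "k \<in> stab \<xi>" "sect k v = h" "A = tensor n \<xi> (v, id)"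
    using assms K_iff frakA_Gam by blast
  then show ?thesis using kappa_letter by blast
qed

theorem theorem5p4:
  fixes n :: nat
  shows
    "(quotient_map (prod_topology (T_top n) (discrete_topology (UNIV :: letter set)))
        (T_top (Suc n)) (\<lambda>(A, x). tens_letter n A x)
      \<and> {(p, q). p \<in> T n \<times> UNIV \<and> q \<in> T n \<times> UNIV \<and>
           (case p of (A, x) \<Rightarrow> tens_letter n A x) = (case q of (A, x) \<Rightarrow> tens_letter n A x)}
        = equiv_gen (T n \<times> UNIV) (identifications n))
     \<and> (\<forall>g\<in>frakA.
          K g (Suc n) =
            (\<Union>(h, x)\<in>{(h, x). h \<in> frakA \<and> sect h [x] = g}. (\<lambda>A. tens_letter n A x) ` K h n)
        \<and> kappa g (Suc n) \<in> K g (Suc n) \<rightarrow> K g (Suc n)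
        \<and> (\<forall>h\<in>frakA. \<forall>x. \<forall>A\<in>K h n. sect h [x] = g \<longrightarrow>
             kappa g (Suc n) (tens_letter n A x) = tens_letter n (kappa h n A) (on_letter h x)))"
proof (intro conjI ballI allI impI)
  show "kappa g (Suc n) (tens_letter n A x) = tens_letter n (kappa h n A) (on_letter h x)"
    if "h \<in> frakA" "A \<in> K h n" "sect h [x] = g" for g h x A
    using kappa_Suc[OF that(1,2), of x] that(3) by simp
qed (rule quotient_map_tens_letter kernel_tens_letter K_Suc kappa_K; assumption)+

end
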